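(* Let $\Sigma$ be a fixed finite alphabet (its size $\sigma$ is a constant). There is an algorithm that, given a word $x$ of length $m$ and a word $y$ of length $n$ over $\Sigma$, computes $$\mathsf{LW}(\mathcal{M}_x,\mathcal{M}_y)=\sum_{w\in \mathcal{M}_x \bigtriangleup \mathcal{M}_y}\frac{1}{|w|^2}$$ in $\mathcal{O}(m+n)$ time and $\mathcal{O}(m+n)$ space, where $\mathcal{M}_x$ and $\mathcal{M}_y$ are the sets of all minimal absent words of $x$ and $y$, respectively, and $\bigtriangleup$ denotes symmetric difference.
   Context: A word $w$ is an absent word of a word $y$ if $w$ is not a factor (contiguous substring) of $y$. An absent word $w$ of $y$ is minimal if every proper factor of $w$ is a factor of $y$. $\mathcal{M}_y$ denotes the set of all minimal absent words of $y$ (with no bound on their length). The model of computation is the standard word RAM; the alphabet size is treated as a constant. *)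

theory Defs
  imports Complex_Main "HOL-Library.Sublist" "HOL-Library.Landau_Symbols"
begin

section \<open>Minimal absent words\<close>

definition absent_word :: "'a set \<Rightarrow> 'a list \<Rightarrow> 'a list \<Rightarrow> bool" where
  "absent_word \<Sigma> y w \<longleftrightarrow> w \<in> lists \<Sigma> \<and> \<not> sublist w y"

definition minimal_absent_words :: "'a set \<Rightarrow> 'a list \<Rightarrow> 'a list set" where
  "minimal_absent_words \<Sigma> y =
     {w. absent_word \<Sigma> y w \<and> (\<forall>u. strict_sublist u w \<longrightarrow> sublist u y)}"

definition LW :: "'a list set \<Rightarrow> 'a list set \<Rightarrow> rat" where
  "LW A B = (\<Sum>w\<in>sym_diff A B. 1 / (of_nat (length w))\<^sup>2)"

text \<open>The sum in \<^const>\<open>LW\<close> is a genuine finite sum without a division by zero.\<close>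

lemma Nil_notin_minimal_absent_words: "[] \<notin> minimal_absent_words \<Sigma> y"
  by (simp add: minimal_absent_words_def absent_word_def)

lemma finite_minimal_absent_words:
  assumes "finite \<Sigma>"
  shows "finite (minimal_absent_words \<Sigma> y)"
proof (rule finite_subset)
  show "minimal_absent_words \<Sigma> y \<subseteq> {w. set w \<subseteq> \<Sigma> \<and> length w \<le> Suc (length y)}"
  proof
    fix w assume w: "w \<in> minimal_absent_words \<Sigma> y"
    then have "w \<noteq> []"
      using Nil_notin_minimal_absent_words by metis
    then have "tl w \<noteq> w"
      by (cases w) auto
    then have "strict_sublist (tl w) w"
      by (simp add: strict_sublist_def)
    with w have "sublist (tl w) y"
      by (auto simp: minimal_absent_words_def)
    then have "length w \<le> Suc (length y)"
      using sublist_length_le by fastforce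
    with w show "w \<in> {w. set w \<subseteq> \<Sigma> \<and> length w \<le> Suc (length y)}"
      by (auto simp: minimal_absent_words_def absent_word_def)
  qed
  show "finite {w. set w \<subseteq> \<Sigma> \<and> length w \<le> Suc (length y)}"
    using assms by (rule finite_lists_length_le)
qed


section \<open>The word RAM\<close>

text \<open>
  Machine words of \<open>b\<close> bits are natural numbers below \<open>2 ^ b\<close>. The word length \<open>b\<close> is a
  parameter of the semantics and not of the program, so that one program serves all word lengths.

  The value to be computed is a rational number whose exact numerator and denominator do not fit
  into a bounded number of words. As usual, arithmetic on that value is counted at unit cost: it
  is carried out in separate registers holding exact rationals. These registers are write-only
  from the point of view of the word part of the machine: they can neither be tested nor
  converted back into words nor stored in memory, so unbounded precision cannot be
  exploited to speed up the computation.
\<close>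

datatype word_op = Add | Sub | Mul | Div | Mod | And | Or | Xor | Shl | Shr

datatype rat_op = RAdd | RSub | RMul | RDiv

datatype instr =
    Const nat nat
  | Move nat nat
  | Arith word_op nat nat nat
  | Load nat nat
  | Store nat nat
  | Jump nat
  | JumpEq nat nat nat
  | JumpLess nat nat nat
  | RatOfWord nat nat
  | RatArith rat_op nat nat nat

record state =
  pc :: nat
  reg :: "nat \<Rightarrow> nat"
  mem :: "nat \<Rightarrow> nat"
  rreg :: "nat \<Rightarrow> rat"

text \<open>All word arithmetic is modulo \<open>2 ^ b\<close>; \<open>u div 0 = 0\<close> and \<open>u mod 0 = u\<close>.\<close>

fun word_op_sem :: "nat \<Rightarrow> word_op \<Rightarrow> nat \<Rightarrow> nat \<Rightarrow> nat" where
  "word_op_sem b Add u v = (u + v) mod 2 ^ b"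
| "word_op_sem b Sub u v = (u + (2 ^ b - v)) mod 2 ^ b"
| "word_op_sem b Mul u v = (u * v) mod 2 ^ b"
| "word_op_sem b Div u v = u div v"
| "word_op_sem b Mod u v = u mod v"
| "word_op_sem b And u v = semiring_bit_operations_class.and u v"
| "word_op_sem b Or u v = semiring_bit_operations_class.or u v"
| "word_op_sem b Xor u v = semiring_bit_operations_class.xor u v"
| "word_op_sem b Shl u v = push_bit v u mod 2 ^ b"
| "word_op_sem b Shr u v = drop_bit v u"

fun rat_op_sem :: "rat_op \<Rightarrow> rat \<Rightarrow> rat \<Rightarrow> rat" where
  "rat_op_sem RAdd p q = p + q"
| "rat_op_sem RSub p q = p - q"
| "rat_op_sem RMul p q = p * q"
| "rat_op_sem RDiv p q = p / q"

definition set_reg :: "nat \<Rightarrow> nat \<Rightarrow> state \<Rightarrow> state" where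
  "set_reg i v s = s\<lparr>pc := Suc (pc s), reg := (reg s)(i := v)\<rparr>"

definition set_rreg :: "nat \<Rightarrow> rat \<Rightarrow> state \<Rightarrow> state" where
  "set_rreg i q s = s\<lparr>pc := Suc (pc s), rreg := (rreg s)(i := q)\<rparr>"

fun exec_instr :: "nat \<Rightarrow> instr \<Rightarrow> state \<Rightarrow> state" where
  "exec_instr b (Const i c) s = set_reg i (c mod 2 ^ b) s"
| "exec_instr b (Move i j) s = set_reg i (reg s j) s"
| "exec_instr b (Arith f i j k) s = set_reg i (word_op_sem b f (reg s j) (reg s k)) s"
| "exec_instr b (Load i j) s = set_reg i (mem s (reg s j)) s"
| "exec_instr b (Store i j) s =
     s\<lparr>pc := Suc (pc s), mem := (mem s)(reg s i := reg s j)\<rparr>"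
| "exec_instr b (Jump l) s = s\<lparr>pc := l\<rparr>"
| "exec_instr b (JumpEq i j l) s =
     s\<lparr>pc := (if reg s i = reg s j then l else Suc (pc s))\<rparr>"
| "exec_instr b (JumpLess i j l) s =
     s\<lparr>pc := (if reg s i < reg s j then l else Suc (pc s))\<rparr>"
| "exec_instr b (RatOfWord i j) s = set_rreg i (of_nat (reg s j)) s"
| "exec_instr b (RatArith f i j k) s = set_rreg i (rat_op_sem f (rreg s j) (rreg s k)) s"

fun instr_addresses :: "instr \<Rightarrow> state \<Rightarrow> nat set" where
  "instr_addresses (Load i j) s = {reg s j}"
| "instr_addresses (Store i j) s = {reg s i}"
| "instr_addresses _ s = {}"

definition halted :: "instr list \<Rightarrow> state \<Rightarrow> bool" where
  "halted P s \<longleftrightarrow> length P \<le> pc s"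

definition step :: "nat \<Rightarrow> instr list \<Rightarrow> state \<Rightarrow> state" where
  "step b P s = (if halted P s then s else exec_instr b (P ! pc s) s)"

definition addresses :: "instr list \<Rightarrow> state \<Rightarrow> nat set" where
  "addresses P s = (if halted P s then {} else instr_addresses (P ! pc s) s)"

text \<open>
  The input words are stored one after the other from address \<open>0\<close> on, one letter per memory cell,
  where \<open>enc\<close> numbers the letters. Their lengths are in the first two registers.
\<close>

definition init_state :: "('a \<Rightarrow> nat) \<Rightarrow> 'a list \<Rightarrow> 'a list \<Rightarrow> state" where
  "init_state enc x y =
     \<lparr>pc = 0,
      reg = (\<lambda>_. 0)(0 := length x, 1 := length y),
      mem = (\<lambda>a. if a < length (x @ y) then enc ((x @ y) ! a) else 0),
      rreg = (\<lambda>_. 0)\<rparr>"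

text \<open>
  Time is the number of executed instructions. Space is measured by the largest
  memory address accessed; a program uses only a constant number of registers on top of that.
  The result is read off from rational register \<open>0\<close>.
\<close>

definition computes_within ::
  "nat \<Rightarrow> instr list \<Rightarrow> state \<Rightarrow> rat \<Rightarrow> nat \<Rightarrow> nat \<Rightarrow> bool" where
  "computes_within b P s r time space \<longleftrightarrow>
     (\<exists>t\<le>time.
        halted P ((step b P ^^ t) s) \<and>
        rreg ((step b P ^^ t) s) 0 = r \<and>
        (\<forall>t'<t. addresses P ((step b P ^^ t') s) \<subseteq> {..<space}))"

end

theory Submission
  imports Defs
begin

text \<open>
  Let \<open>#\<close> be a new letter and consider the suffix automaton of \<open>z = x # y\<close>: its states are the classes
  of factors of \<open>z\<close> with the same set of end positions. Let \<open>w\<close> be the shortest word of a state, so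
  that \<open>tl w\<close> is the longest word of its suffix link. A word \<open>w b\<close> is a minimal absent word of \<open>x\<close> iff
  \<open>w\<close> and \<open>tl w b\<close> occur in \<open>x\<close> and \<open>w b\<close> does not, and every minimal absent word arises in this way
  from exactly one state and letter. Whether a state contains a factor of \<open>x\<close> (or \<open>y\<close>) is found
  by reading \<open>x\<close> (or \<open>y\<close>) from the root and marking upwards along suffix links until a marked
  state is met. The sum over the symmetric difference is then a single pass over all pairs of a
  state and a letter.

  The automaton is built letter by letter. The two inner loops of one step walk up the suffix links
  from the state of the whole text; they are amortised by the length of the longest word
  of the link, respectively of the link of the link, of that state, which grow by at most one per step.
\<close>

section \<open>End positions and suffix automata\<close>

definition endpos :: "'b list \<Rightarrow> 'b list \<Rightarrow> nat set" where
  "endpos z u = {i. i \<le> length z \<and> suffix u (take i z)}"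

lemma endpos_nonempty_iff: "endpos z u \<noteq> {} \<longleftrightarrow> sublist u z"
proof
  assume "endpos z u \<noteq> {}"
  then obtain i where "suffix u (take i z)" by (auto simp: endpos_def)
  then have "sublist u (take i z)" by (simp add: suffix_imp_sublist)
  then show "sublist u z"
    using sublist_order.order_trans sublist_take by blast
next
  assume "sublist u z"
  then obtain p q where "z = p @ u @ q" by (auto simp: sublist_def)
  then have "length p + length u \<in> endpos z u" by (auto simp: endpos_def suffix_def)
  then show "endpos z u \<noteq> {}" by blast
qed

lemma endpos_Nil [simp]: "endpos z [] = {..length z}"
  by (auto simp: endpos_def)

lemma endpos_snoc_text:
  "endpos (z @ [c]) u = endpos z u \<union> (if suffix u (z @ [c]) then {Suc (length z)} else {})"
  by (auto simp: endpos_def le_Suc_eq split: if_splits)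

lemma endpos_antimono: "suffix u v \<Longrightarrow> endpos z v \<subseteq> endpos z u"
  using suffix_order.trans by (auto simp: endpos_def)

lemma suffix_if_common_endpos:
  "i \<in> endpos z u \<Longrightarrow> i \<in> endpos z v \<Longrightarrow> length u \<le> length v \<Longrightarrow> suffix u v"
  by (auto simp: endpos_def intro: suffix_length_suffix)

lemma suffix_if_endpos_subset:
  "endpos z v \<subseteq> endpos z u \<Longrightarrow> endpos z v \<noteq> {} \<Longrightarrow> length u \<le> length v \<Longrightarrow> suffix u v"
  using suffix_if_common_endpos by (metis ex_in_conv subsetD)

lemma length_in_endpos_iff: "length z \<in> endpos z u \<longleftrightarrow> suffix u z"
  by (simp add: endpos_def)

lemma endpos_self: "endpos z z = {length z}"
  using suffix_length_le by (force simp: endpos_def)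

lemma endpos_snoc_word:
  "i \<in> endpos z (u @ [a]) \<longleftrightarrow> (\<exists>j. i = Suc j \<and> j < length z \<and> j \<in> endpos z u \<and> z ! j = a)"
  by (cases i) (auto simp: endpos_def take_Suc_conv_app_nth Suc_le_eq)

lemma endpos_cong_snoc:
  assumes "endpos z u = endpos z v"
  shows "endpos z (u @ [a]) = endpos z (v @ [a])"
    and "endpos (z @ [c]) (u @ [a]) = endpos (z @ [c]) (v @ [a])"
proof -
  show "endpos z (u @ [a]) = endpos z (v @ [a])"
    using assms by (auto simp: endpos_snoc_word)
  have "suffix (u @ [a]) (z @ [c]) = suffix (v @ [a]) (z @ [c])"
    using assms length_in_endpos_iff[of z u] length_in_endpos_iff[of z v] by auto
  then show "endpos (z @ [c]) (u @ [a]) = endpos (z @ [c]) (v @ [a])"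
    using \<open>endpos z (u @ [a]) = endpos z (v @ [a])\<close> by (simp add: endpos_snoc_text)
qed

lemma endpos_subset_snoc:
  "endpos z u \<subseteq> endpos z v \<Longrightarrow> endpos z (u @ [a]) \<subseteq> endpos z (v @ [a])"
  unfolding subset_iff endpos_snoc_word by blast

text \<open>
  \<open>W i\<close> is the longest word of state \<open>i\<close>. State 1 is the root; state 0 is an extra state below it,
  thought of as a word of length \<open>-1\<close> from which every letter leads to the root, and therefore
  \<open>len\<close> is the length of the longest word plus 1. A value 0 of \<open>dl\<close> stands for a missing
  transition, since no transition leads to state 0.
\<close>

locale suffix_automaton =
  fixes z :: "nat list" and sg cnt :: nat and W :: "nat \<Rightarrow> nat list"
    and len lk :: "nat \<Rightarrow> nat" and dl :: "nat \<Rightarrow> nat \<Rightarrow> nat"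
  assumes cnt_ge: "2 \<le> cnt"
    and W_root: "W 1 = []"
    and W_factor: "i \<in> {1..<cnt} \<Longrightarrow> endpos z (W i) \<noteq> {}"
    and W_cover: "endpos z u \<noteq> {} \<Longrightarrow>
      \<exists>i\<in>{1..<cnt}. endpos z (W i) = endpos z u \<and> suffix u (W i)"
    and W_inj: "i \<in> {1..<cnt} \<Longrightarrow> j \<in> {1..<cnt} \<Longrightarrow>
      endpos z (W i) = endpos z (W j) \<Longrightarrow> i = j"
    and len_bot: "len 0 = 0"
    and len_eq: "i \<in> {1..<cnt} \<Longrightarrow> len i = Suc (length (W i))"
    and lk_bot: "lk 0 = 0"
    and lk_root: "lk 1 = 0"
    and lk_mem: "i \<in> {2..<cnt} \<Longrightarrow> lk i \<in> {1..<cnt}"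
    and lk_strict: "i \<in> {2..<cnt} \<Longrightarrow> strict_suffix (W (lk i)) (W i)"
    and lk_max: "i \<in> {2..<cnt} \<Longrightarrow> j \<in> {1..<cnt} \<Longrightarrow>
      strict_suffix (W j) (W i) \<Longrightarrow> suffix (W j) (W (lk i))"
    and dl_bot: "a \<le> sg \<Longrightarrow> dl 0 a = 1"
    and dl_zero: "i \<in> {1..<cnt} \<Longrightarrow> a \<le> sg \<Longrightarrow> dl i a = 0 \<Longrightarrow> endpos z (W i @ [a]) = {}"
    and dl_nonzero: "i \<in> {1..<cnt} \<Longrightarrow> a \<le> sg \<Longrightarrow> dl i a \<noteq> 0 \<Longrightarrow>
      dl i a \<in> {1..<cnt} \<and> endpos z (W (dl i a)) = endpos z (W i @ [a])"
    and dl_fresh: "cnt \<le> i \<Longrightarrow> a \<le> sg \<Longrightarrow> dl i a = 0"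
begin

lemma suffix_W:
  assumes "j \<in> {1..<cnt}" "endpos z u = endpos z (W j)"
  shows "suffix u (W j)"
  using W_cover[of u] W_inj W_factor assms by metis

lemma W_eq_iff: "i \<in> {1..<cnt} \<Longrightarrow> j \<in> {1..<cnt} \<Longrightarrow> W i = W j \<longleftrightarrow> i = j"
  using W_inj by metis

lemma suffix_W_if_subset:
  assumes "j \<in> {1..<cnt}" "endpos z u \<subseteq> endpos z (W j)" "endpos z u \<noteq> {}"
    "endpos z u \<noteq> endpos z (W j)"
  shows "strict_suffix (W j) u"
proof -
  have "suffix (W j) u \<or> suffix u (W j)"
    using suffix_if_endpos_subset[of z u "W j"] suffix_if_common_endpos assms
    by (metis ex_in_conv nle_le subsetD)
  moreover have "\<not> suffix u (W j)"
    using endpos_antimono assms by blast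
  ultimately show ?thesis by (auto simp: strict_suffix_def)
qed

lemma len_pos: "i \<in> {1..<cnt} \<Longrightarrow> 0 < len i"
  by (simp add: len_eq)

lemma len_pos_nonzero: "i \<in> {1..<cnt} \<Longrightarrow> len i \<le> len j \<Longrightarrow> j \<noteq> 0"
  using len_pos[of i] len_bot by (cases j) auto

lemma lk_less: "i < cnt \<Longrightarrow> lk i < cnt"
  using lk_mem[of i] lk_bot lk_root cnt_ge by (cases "i = 0"; cases "i = 1") auto

lemma len_lk_less:
  assumes "i \<in> {1..<cnt}"
  shows "len (lk i) < len i"
proof (cases "i = 1")
  case True
  then show ?thesis using assms by (metis lk_root len_bot len_pos)
next
  case False
  then have "i \<in> {2..<cnt}" using assms by auto
  then show ?thesis
    using len_eq[OF lk_mem] len_eq[OF assms] suffix_length_less[OF lk_strict] by simp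
qed

lemma suffix_W_lk:
  assumes "p \<in> {1..<cnt}" "suffix (W p) t"
  shows "lk p = 0 \<or> suffix (W (lk p)) t"
proof (cases "p = 1")
  case True
  then show ?thesis by (metis lk_root)
next
  case False
  then show ?thesis
    using lk_strict[of p] assms by (auto simp: strict_suffix_def intro: suffix_order.trans)
qed

lemma len_lk_less_iff:
  assumes "p \<in> {1..<cnt}" "suffix (W p) t" "i \<in> {1..<cnt}" "suffix (W i) t"
  shows "len (lk p) < len i \<longleftrightarrow> i = p \<or> len p < len i"
proof
  assume less: "len (lk p) < len i"
  show "i = p \<or> len p < len i"
  proof (rule ccontr)
    assume "\<not> ?thesis"
    then have ne: "i \<noteq> p" and le: "len i \<le> len p" by auto
    then have "length (W i) \<le> length (W p)" using assms len_eq by simp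
    then have "suffix (W i) (W p)" using assms suffix_length_suffix by blast
    then have st: "strict_suffix (W i) (W p)"
      using ne W_eq_iff assms by (auto simp: strict_suffix_def)
    then have "p \<noteq> 1" using W_root by auto
    then have p: "p \<in> {2..<cnt}" using assms by auto
    have "suffix (W i) (W (lk p))" using lk_max p assms st by blast
    then show False
      using less len_eq[OF lk_mem[OF p]] len_eq[of i] assms suffix_length_le by fastforce
  qed
next
  assume "i = p \<or> len p < len i"
  then show "len (lk p) < len i" using len_lk_less[OF assms(1)] by auto
qed

end

lemma suffix_automaton_Nil:
  assumes "len 0 = 0" "len 1 = 1" "lk 0 = 0" "lk 1 = 0" "\<And>a. a \<le> sg \<Longrightarrow> dl 0 a = 1"
    "\<And>i a. 1 \<le> i \<Longrightarrow> a \<le> sg \<Longrightarrow> dl i a = 0"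
  shows "suffix_automaton [] sg 2 (\<lambda>_. []) len lk dl"
proof
  have *: "endpos [] u \<noteq> {} \<longleftrightarrow> u = []" for u :: "nat list"
    by (auto simp: endpos_def)
  show "\<exists>i\<in>{1..<2::nat}. endpos [] [] = endpos [] u \<and> suffix u []" if "endpos [] u \<noteq> {}"
    for u :: "nat list"
    using that * by (auto intro!: bexI[of _ 1])
  show "endpos [] ([] @ [a]) = {}" for a :: nat
    using *[of "[a]"] by simp
qed (use assms in \<open>auto simp: numeral_2_eq_2 less_Suc_eq\<close>)

locale suffix_automaton_extension = suffix_automaton +
  fixes c p q :: nat and s :: "nat list"
  assumes c_le: "c \<le> sg"
    and p_less: "p < cnt"
    and p_suffix: "p = 0 \<or> suffix (W p) z"
    and q_eq: "q = dl p c"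
    and q_nonzero: "q \<noteq> 0"
    and dl_above: "i \<in> {1..<cnt} \<Longrightarrow> suffix (W i) z \<Longrightarrow> len p < len i \<Longrightarrow> dl i c = 0"
    and s_eq: "s = (if p = 0 then [] else W p @ [c])"
begin

declare suffix_snoc [simp del]

lemma q_mem: "q \<in> {1..<cnt}"
proof (cases "p = 0")
  case True
  then show ?thesis using dl_bot c_le q_eq cnt_ge by auto
next
  case False
  then show ?thesis using dl_nonzero[of p c] c_le q_eq q_nonzero p_less by auto
qed

lemma endpos_s: "endpos z s = endpos z (W q)"
proof (cases "p = 0")
  case True
  then have "q = 1" using dl_bot c_le q_eq by auto
  then have "W q = []" using W_root by simp
  then show ?thesis using True s_eq by simp
next
  case False
  then show ?thesis using dl_nonzero[of p c] c_le q_eq q_nonzero p_less s_eq by auto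
qed

lemma endpos_s_nonempty: "endpos z s \<noteq> {}"
  using endpos_s W_factor q_mem by simp

lemma length_s: "length s = len p"
  using s_eq len_bot len_eq[of p] p_less by auto

lemma s_suffix: "suffix s (z @ [c])"
  using s_eq p_suffix by auto

lemma s_longest:
  assumes t: "suffix t (z @ [c])" "endpos z t \<noteq> {}"
  shows "suffix t s"
proof (cases t rule: rev_exhaust)
  case (snoc t' d)
  then have d: "d = c" and t': "suffix t' z" using t by auto
  then have ep: "length z \<in> endpos z t'" by (simp add: length_in_endpos_iff)
  obtain i where i: "i \<in> {1..<cnt}" "endpos z (W i) = endpos z t'" "suffix t' (W i)"
    using W_cover[of t'] ep by blast
  have Wi: "suffix (W i) z" using ep i(2) by (simp add: length_in_endpos_iff[symmetric])
  have "endpos z (W i @ [c]) = endpos z t"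
    using endpos_cong_snoc(1)[OF i(2)] snoc d by simp
  then have "dl i c \<noteq> 0" using dl_zero i t c_le by auto
  then have le: "len i \<le> len p" using dl_above i Wi by (meson not_le)
  then have p0: "p \<noteq> 0" using len_pos_nonzero[OF i(1)] by blast
  then have "length (W i) \<le> length (W p)" using le len_eq[of p] len_eq[of i] i p_less by auto
  then have "suffix (W i) (W p)" using Wi p_suffix p0 suffix_length_suffix by blast
  then show ?thesis using i(3) p0 s_eq snoc d by (auto intro: suffix_order.trans)
qed auto

lemma s_suffix_Wq: "suffix s (W q)"
  using suffix_W q_mem endpos_s by blast

lemma endpos_text: "endpos z (z @ [c]) = {}"
  using endpos_nonempty_iff[of z "z @ [c]"] sublist_length_le[of "z @ [c]" z] by auto

lemma unsplit_class:
  assumes "i \<in> {1..<cnt}" "i \<noteq> q" "endpos z t = endpos z (W i)" "suffix t (z @ [c])"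
  shows "suffix (W i) (z @ [c])"
proof -
  have ts: "suffix t s" using s_longest assms W_factor by auto
  have sub: "endpos z s \<subseteq> endpos z (W i)" using endpos_antimono[OF ts] assms by auto
  have ne: "endpos z s \<noteq> endpos z (W i)" using W_inj assms q_mem endpos_s by metis
  have "strict_suffix (W i) s"
    using suffix_W_if_subset[OF assms(1) sub endpos_s_nonempty ne] .
  then show ?thesis using s_suffix by (auto simp: strict_suffix_def intro: suffix_order.trans)
qed

lemma not_suffix_class:
  assumes "i \<in> {1..<cnt}" "endpos z t = endpos z (W i)" "\<not> suffix t (z @ [c])"
  shows "\<not> suffix (W i) (z @ [c])"
  using suffix_W[OF assms(1,2)] assms(3) suffix_order.trans by blast

lemma dl_suffix_zero_iff:
  assumes "i \<in> {1..<cnt}" "suffix (W i) z"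
  shows "dl i c = 0 \<longleftrightarrow> len p < len i"
proof
  assume 0: "dl i c = 0"
  show "len p < len i"
  proof (rule ccontr)
    assume "\<not> len p < len i"
    then have le: "len i \<le> len p" by simp
    then have p0: "p \<noteq> 0" using len_pos_nonzero[OF assms(1)] by blast
    then have "length (W i) \<le> length (W p)" using le len_eq[of p] len_eq[of i] assms p_less by auto
    then have "suffix (W i @ [c]) s" using assms p_suffix p0 suffix_length_suffix s_eq by auto
    then show False
      using dl_zero[OF assms(1) c_le 0] endpos_s_nonempty endpos_antimono by blast
  qed
qed (use dl_above assms in blast)

lemma endpos_extend_inj: "endpos (z @ [c]) u = endpos (z @ [c]) v \<Longrightarrow> endpos z u = endpos z v"
proof -
  have "endpos z u = endpos (z @ [c]) u \<inter> {..length z}" for u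
    by (auto simp: endpos_snoc_text) (auto simp: endpos_def)
  then show "endpos (z @ [c]) u = endpos (z @ [c]) v \<Longrightarrow> endpos z u = endpos z v" by metis
qed

lemma endpos_extend_nonempty: "endpos z u \<noteq> {} \<Longrightarrow> endpos (z @ [c]) u \<noteq> {}"
  by (auto simp: endpos_snoc_text)

lemma endpos_extend_new:
  "endpos z u = {} \<Longrightarrow> suffix u (z @ [c]) \<Longrightarrow> endpos (z @ [c]) u = endpos (z @ [c]) (z @ [c])"
  using endpos_text by (simp add: endpos_snoc_text)

lemma endpos_extend_class:
  assumes "j \<in> {1..<cnt}" "endpos z u = endpos z (W j)"
    and "j = q \<Longrightarrow> suffix u (z @ [c]) \<Longrightarrow> suffix (W q) (z @ [c])"
  shows "endpos (z @ [c]) (W j) = endpos (z @ [c]) u"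
proof (cases "suffix u (z @ [c])")
  case True
  then have "suffix (W j) (z @ [c])" using unsplit_class assms by metis
  then show ?thesis using True assms by (simp add: endpos_snoc_text)
next
  case False
  then show ?thesis using not_suffix_class[OF assms(1,2)] assms by (simp add: endpos_snoc_text)
qed

lemma length_old: "i \<in> {1..<cnt} \<Longrightarrow> length (W i) \<le> length z"
  using W_factor endpos_nonempty_iff sublist_length_le by blast

lemma strict_suffix_text:
  assumes "i \<in> {1..<cnt}" "suffix (W i) (z @ [c])"
  shows "suffix (W i) s"
  using s_longest assms W_factor by blast

lemma not_suffix_old: "i \<in> {1..<cnt} \<Longrightarrow> \<not> suffix (z @ [c]) (W i)"
  using length_old suffix_length_le by fastforce

lemma lk_q_strict_suffix:
  assumes "q \<noteq> 1"
  shows "strict_suffix (W (lk q)) s"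
proof -
  have q2: "q \<in> {2..<cnt}" using assms q_mem by auto
  have m: "lk q \<in> {1..<cnt}" using lk_mem q2 by blast
  have sub: "endpos z s \<subseteq> endpos z (W (lk q))"
    using endpos_s lk_strict[OF q2] endpos_antimono unfolding strict_suffix_def by metis
  have "endpos z s \<noteq> endpos z (W (lk q))"
    using W_inj[OF q_mem m] endpos_s lk_strict[OF q2] by force
  then show ?thesis using suffix_W_if_subset[OF m sub endpos_s_nonempty] by blast
qed

lemma extend_unsplit:
  assumes hlen: "len q = Suc (len p)"
    and len': "len' = len(cnt := Suc (Suc (length z)))"
    and lk': "lk' = lk(cnt := q)"
    and dl': "\<And>i a. a \<le> sg \<Longrightarrow> dl' i a =
      (if a = c \<and> i \<in> {1..<cnt} \<and> suffix (W i) z \<and> len p < len i then cnt else dl i a)"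
  shows "suffix_automaton (z @ [c]) sg (Suc cnt) (W(cnt := z @ [c])) len' lk' dl'"
proof -
  have Wq: "W q = s"
    using s_suffix_Wq length_s hlen len_eq[OF q_mem] by (auto simp: suffix_def)
  then have sq: "suffix (W q) (z @ [c])" using s_suffix by simp
  have cls: "endpos (z @ [c]) (W j) = endpos (z @ [c]) u"
    if "j \<in> {1..<cnt}" "endpos z u = endpos z (W j)" for j u
    using endpos_extend_class that sq by blast
  let ?W = "W(cnt := z @ [c])"
  show ?thesis
  proof
    show "2 \<le> Suc cnt" using cnt_ge by simp
    show "?W 1 = []" using W_root cnt_ge by simp
    show "endpos (z @ [c]) (?W i) \<noteq> {}" if "i \<in> {1..<Suc cnt}" for i
      using that W_factor[of i] endpos_extend_nonempty[of "W i"] by (auto simp: endpos_self less_Suc_eq)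
    show "\<exists>i\<in>{1..<Suc cnt}. endpos (z @ [c]) (?W i) = endpos (z @ [c]) u \<and> suffix u (?W i)"
      if u: "endpos (z @ [c]) u \<noteq> {}" for u
    proof (cases "endpos z u = {}")
      case True
      then have "suffix u (z @ [c])" using u by (auto simp: endpos_snoc_text split: if_splits)
      then show ?thesis using True endpos_extend_new cnt_ge by (intro bexI[of _ cnt]) auto
    next
      case False
      then obtain j where j: "j \<in> {1..<cnt}" "endpos z (W j) = endpos z u" "suffix u (W j)"
        using W_cover by blast
      then show ?thesis using cls[of j u] by (intro bexI[of _ j]) auto
    qed
    show "i = j" if "i \<in> {1..<Suc cnt}" "j \<in> {1..<Suc cnt}"
      "endpos (z @ [c]) (?W i) = endpos (z @ [c]) (?W j)" for i j
    proof -
      have "endpos z (?W i) = endpos z (?W j)" using that endpos_extend_inj by blast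
      then show ?thesis using that W_inj[of i j] W_factor[of i] W_factor[of j] endpos_text
        by (auto simp: less_Suc_eq split: if_splits)
    qed
    show "len' 0 = 0" using len' len_bot cnt_ge by auto
    show "len' i = Suc (length (?W i))" if "i \<in> {1..<Suc cnt}" for i
      using that len' len_eq[of i] by (auto simp: less_Suc_eq)
    show "lk' 0 = 0" using lk' lk_bot cnt_ge by auto
    show "lk' 1 = 0" using lk' lk_root cnt_ge by auto
    show "lk' i \<in> {1..<Suc cnt}" if "i \<in> {2..<Suc cnt}" for i
      using that lk' lk_mem[of i] q_mem by (auto simp: less_Suc_eq)
    show "strict_suffix (?W (lk' i)) (?W i)" if i: "i \<in> {2..<Suc cnt}" for i
    proof (cases "i = cnt")
      case True
      then show ?thesis
        using lk' q_mem sq endpos_text W_factor[OF q_mem] by (auto simp: strict_suffix_def)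
    next
      case False
      then show ?thesis using i lk_strict[of i] lk_mem[of i] lk' by auto
    qed
    show "suffix (?W j) (?W (lk' i))"
      if i: "i \<in> {2..<Suc cnt}" and j: "j \<in> {1..<Suc cnt}" and st: "strict_suffix (?W j) (?W i)" for i j
    proof (cases "j = cnt")
      case True
      then show ?thesis using i st not_suffix_old[of i]
        by (auto simp: strict_suffix_def less_Suc_eq split: if_splits)
    next
      case j': False
      then have jm: "j \<in> {1..<cnt}" using j by auto
      show ?thesis
      proof (cases "i = cnt")
        case True
        then show ?thesis
          using st j' jm lk' q_mem Wq strict_suffix_text[OF jm] by (auto simp: strict_suffix_def)
      next
        case False
        then show ?thesis using i st j' jm lk' lk_max[of i j] lk_mem[of i] by auto
      qed
    qed
    show "dl' 0 a = 1" if "a \<le> sg" for a using dl' dl_bot that by auto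
    show "endpos (z @ [c]) (?W i @ [a]) = {}"
      if i: "i \<in> {1..<Suc cnt}" and a: "a \<le> sg" and 0: "dl' i a = 0" for i a
    proof (cases "i = cnt")
      case True
      then show ?thesis
        using endpos_nonempty_iff[of "z @ [c]" "z @ [c, a]"] sublist_length_le[of "z @ [c, a]" "z @ [c]"]
        by auto
    next
      case False
      then have im: "i \<in> {1..<cnt}" using i by auto
      have n: "\<not> (a = c \<and> suffix (W i) z \<and> len p < len i)" and d0: "dl i a = 0"
        using 0 dl'[OF a, of i] im by (auto split: if_splits)
      have "endpos z (W i @ [a]) = {}" using dl_zero im a d0 by auto
      moreover have "\<not> suffix (W i @ [a]) (z @ [c])"
        using n dl_suffix_zero_iff[OF im] d0 by auto
      ultimately show ?thesis using False by (simp add: endpos_snoc_text)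
    qed
    show "dl' i a \<in> {1..<Suc cnt} \<and> endpos (z @ [c]) (?W (dl' i a)) = endpos (z @ [c]) (?W i @ [a])"
      if i: "i \<in> {1..<Suc cnt}" and a: "a \<le> sg" and nz: "dl' i a \<noteq> 0" for i a
    proof -
      have "i \<noteq> cnt" using nz dl'[OF a, of i] dl_fresh[of i a] a by auto
      then have im: "i \<in> {1..<cnt}" using i by auto
      show ?thesis
      proof (cases "a = c \<and> suffix (W i) z \<and> len p < len i")
        case True
        then have "endpos z (W i @ [c]) = {}" using dl_zero[OF im a] dl_above[OF im] by auto
        then show ?thesis
          using True im dl'[OF a, of i] endpos_extend_new[of "W i @ [c]"] by auto
      next
        case False
        then have d: "dl' i a = dl i a" using dl'[OF a, of i] by auto
        then have dm: "dl i a \<in> {1..<cnt}" "endpos z (W (dl i a)) = endpos z (W i @ [a])"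
          using dl_nonzero[OF im a] nz by auto
        then show ?thesis using cls[OF dm(1), of "W i @ [a]"] d im by auto
      qed
    qed
    show "dl' i a = 0" if "Suc cnt \<le> i" "a \<le> sg" for i a
      using dl'[OF that(2), of i] dl_fresh[of i a] that by auto
  qed
qed

lemma extend_split:
  assumes hlen: "len q \<noteq> Suc (len p)"
    and len': "len' = len(cnt := Suc (Suc (length z)), Suc cnt := Suc (len p))"
    and lk': "lk' = lk(cnt := Suc cnt, q := Suc cnt, Suc cnt := lk q)"
    and dl': "\<And>i a. a \<le> sg \<Longrightarrow> dl' i a =
      (let d1 = (\<lambda>i. if a = c \<and> i \<in> {1..<cnt} \<and> suffix (W i) z \<and> len p < len i then cnt else dl i a)
       in if i = Suc cnt then d1 q
          else if a = c \<and> i \<in> {1..<cnt} \<and> suffix (W i) z \<and> len i \<le> len p \<and> dl i c = q then Suc cnt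
          else d1 i)"
  shows "suffix_automaton (z @ [c]) sg (Suc (Suc cnt)) (W(cnt := z @ [c], Suc cnt := s)) len' lk' dl'"
proof -
  have Wq: "W q \<noteq> s" using length_s hlen len_eq[OF q_mem] by auto
  then have nsq: "\<not> suffix (W q) (z @ [c])"
    using strict_suffix_text[OF q_mem] s_suffix_Wq suffix_order.antisym by blast
  have sq: "strict_suffix s (W q)" using Wq s_suffix_Wq by (auto simp: strict_suffix_def)
  have q2: "q \<in> {2..<cnt}"
  proof -
    have "q \<noteq> 1" using sq W_root by auto
    then show ?thesis using q_mem by auto
  qed
  have cls: "endpos (z @ [c]) (W j) = endpos (z @ [c]) u"
    if "j \<in> {1..<cnt}" "endpos z u = endpos z (W j)" "j = q \<longrightarrow> \<not> suffix u (z @ [c])" for j u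
    using endpos_extend_class that by blast
  have clss: "endpos (z @ [c]) s = endpos (z @ [c]) u"
    if "endpos z u = endpos z (W q)" "suffix u (z @ [c])" for u
    using that endpos_s s_suffix by (simp add: endpos_snoc_text)
  have s_text: "strict_suffix s (z @ [c])"
    using s_suffix endpos_s_nonempty endpos_text by (auto simp: strict_suffix_def)
  let ?W = "W(cnt := z @ [c], Suc cnt := s)"
  have Wold: "?W i = W i" if "i \<in> {1..<cnt}" for i using that by auto
  have Wnew: "?W cnt = z @ [c]" "?W (Suc cnt) = s" by auto
  have cases3: "i \<in> {1..<cnt} \<or> i = cnt \<or> i = Suc cnt" if "i \<in> {1..<Suc (Suc cnt)}" for i
    using that by auto
  have lkq: "strict_suffix (W (lk q)) s" using lk_q_strict_suffix q2 by simp
  have dlstep: "(d = 0 \<longrightarrow> endpos (z @ [c]) (W i @ [a]) = {}) \<and>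
      (d \<noteq> 0 \<longrightarrow> d \<in> {1..<Suc (Suc cnt)} \<and> endpos (z @ [c]) (?W d) = endpos (z @ [c]) (W i @ [a]))"
    if im: "i \<in> {1..<cnt}" and a: "a \<le> sg" and d: "d = dl' i a" for i a d
  proof -
    consider (new) "a = c" "suffix (W i) z" "len p < len i"
      | (clone) "a = c" "suffix (W i) z" "len i \<le> len p" "dl i c = q"
      | (old) "a \<noteq> c \<or> \<not> suffix (W i) z \<or> (len i \<le> len p \<and> dl i c \<noteq> q)"
      by (meson not_le)
    then show ?thesis
    proof cases
      case new
      then have "endpos z (W i @ [c]) = {}" using dl_zero[OF im a] dl_above[OF im] by auto
      then show ?thesis
        using new im d dl'[OF a, of i] endpos_extend_new[of "W i @ [c]"] by auto
    next
      case clone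
      then have "endpos z (W i @ [c]) = endpos z (W q)"
        using dl_nonzero[OF im a] q_nonzero by auto
      then have "endpos (z @ [c]) s = endpos (z @ [c]) (W i @ [a])"
        using clss clone by auto
      then show ?thesis using clone im d dl'[OF a, of i] by auto
    next
      case old
      then have d': "d = dl i a" using d im dl'[OF a, of i] by (auto simp: Let_def)
      show ?thesis
      proof (cases "d = 0")
        case True
        then have "endpos z (W i @ [a]) = {}" using dl_zero[OF im a] d' by auto
        moreover have "\<not> suffix (W i @ [a]) (z @ [c])"
          using old dl_suffix_zero_iff[OF im] d' True by auto
        ultimately show ?thesis using True by (simp add: endpos_snoc_text)
      next
        case False
        then have dm: "d \<in> {1..<cnt}" "endpos z (W d) = endpos z (W i @ [a])"
          using dl_nonzero[OF im a] d' by auto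
        have "d = q \<longrightarrow> \<not> suffix (W i @ [a]) (z @ [c])"
          using old d' False dl_suffix_zero_iff[OF im] by auto
        then show ?thesis using cls[OF dm(1), of "W i @ [a]"] dm False by auto
      qed
    qed
  qed
  have dlcl: "dl' (Suc cnt) a = dl' q a" if a: "a \<le> sg" for a
  proof -
    have "\<not> (a = c \<and> suffix (W q) z \<and> len q \<le> len p)"
    proof
      assume "a = c \<and> suffix (W q) z \<and> len q \<le> len p"
      then have "length (W q) < length s" using length_s len_eq[OF q_mem] by auto
      then show False using s_suffix_Wq suffix_length_le by fastforce
    qed
    then show ?thesis using dl'[OF a, of "Suc cnt"] dl'[OF a, of q] q_mem by (auto simp: Let_def)
  qed
  have epcl: "endpos (z @ [c]) (s @ [a]) = endpos (z @ [c]) (W q @ [a])" for a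
    using endpos_cong_snoc(2)[OF endpos_s] .
  show ?thesis
  proof
    show "2 \<le> Suc (Suc cnt)" using cnt_ge by simp
    show "?W 1 = []" using W_root cnt_ge by simp
    show "endpos (z @ [c]) (?W i) \<noteq> {}" if "i \<in> {1..<Suc (Suc cnt)}" for i
      using cases3[OF that] W_factor[of i] endpos_extend_nonempty[of "W i"]
        endpos_extend_nonempty[OF endpos_s_nonempty] by (auto simp: endpos_self)
    show "\<exists>i\<in>{1..<Suc (Suc cnt)}. endpos (z @ [c]) (?W i) = endpos (z @ [c]) u \<and> suffix u (?W i)"
      if u: "endpos (z @ [c]) u \<noteq> {}" for u
    proof (cases "endpos z u = {}")
      case True
      then have "suffix u (z @ [c])" using u by (auto simp: endpos_snoc_text split: if_splits)
      then show ?thesis using True endpos_extend_new cnt_ge by (intro bexI[of _ cnt]) auto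
    next
      case False
      then obtain j where j: "j \<in> {1..<cnt}" "endpos z (W j) = endpos z u" "suffix u (W j)"
        using W_cover by blast
      show ?thesis
      proof (cases "j = q \<and> suffix u (z @ [c])")
        case True
        then have "suffix u s" using s_longest False by blast
        then show ?thesis using True j clss[of u] by (intro bexI[of _ "Suc cnt"]) auto
      next
        case False
        then show ?thesis using cls[of j u] j by (intro bexI[of _ j]) auto
      qed
    qed
    show "i = j" if "i \<in> {1..<Suc (Suc cnt)}" "j \<in> {1..<Suc (Suc cnt)}"
      and eq: "endpos (z @ [c]) (?W i) = endpos (z @ [c]) (?W j)" for i j
    proof -
      have e: "endpos z (?W i) = endpos z (?W j)" using eq endpos_extend_inj by blast
      have clone: "endpos (z @ [c]) (W k) \<noteq> endpos (z @ [c]) s" if "k \<in> {1..<cnt}" for k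
      proof
        assume *: "endpos (z @ [c]) (W k) = endpos (z @ [c]) s"
        then have "endpos z (W k) = endpos z (W q)" using endpos_extend_inj endpos_s by metis
        then have "k = q" using W_inj that q_mem by blast
        moreover have "suffix (W k) (z @ [c])"
          using * s_suffix length_in_endpos_iff[of "z @ [c]"] by blast
        ultimately show False using nsq by blast
      qed
      show ?thesis
        using cases3[OF that(1)] cases3[OF that(2)] e eq W_inj[of i j] W_factor[of i] W_factor[of j]
          endpos_text clone[of i] clone[of j] endpos_s_nonempty Wold[of i] Wold[of j] Wnew
        by metis
    qed
    show "len' 0 = 0" using len' len_bot cnt_ge by auto
    show "len' i = Suc (length (?W i))" if "i \<in> {1..<Suc (Suc cnt)}" for i
      using cases3[OF that] len' len_eq[of i] length_s by auto
    show "lk' 0 = 0" using lk' lk_bot cnt_ge q_nonzero by auto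
    show "lk' 1 = 0" using lk' lk_root cnt_ge q2 by auto
    show "lk' i \<in> {1..<Suc (Suc cnt)}" if "i \<in> {2..<Suc (Suc cnt)}" for i
      using that lk' lk_mem[of i] lk_mem[OF q2] by (auto simp: less_Suc_eq)
    show "strict_suffix (?W (lk' i)) (?W i)" if i: "i \<in> {2..<Suc (Suc cnt)}" for i
    proof -
      consider "i = Suc cnt" | "i = cnt" | "i = q" | "i \<in> {2..<cnt}" "i \<noteq> q" using i by fastforce
      then show ?thesis
      proof cases
        case 1 then show ?thesis using lk' lkq lk_mem[OF q2] by auto
      next
        case 2 then show ?thesis using lk' s_text q2 by auto
      next
        case 3 then show ?thesis using lk' sq q2 by auto
      next
        case 4 then show ?thesis using lk' lk_strict[of i] lk_mem[of i] by auto
      qed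
    qed
    show "suffix (?W j) (?W (lk' i))"
      if i: "i \<in> {2..<Suc (Suc cnt)}" and j: "j \<in> {1..<Suc (Suc cnt)}"
        and st: "strict_suffix (?W j) (?W i)" for i j
    proof -
      have jn: "j \<noteq> cnt"
      proof
        assume j: "j = cnt"
        then have "suffix (z @ [c]) (?W i)" "?W i \<noteq> z @ [c]" using st by (auto simp: strict_suffix_def)
        then have "i = Suc cnt" using not_suffix_old[of i] i by (auto split: if_splits simp: less_Suc_eq)
        then show False using \<open>suffix (z @ [c]) (?W i)\<close> s_text by (auto simp: strict_suffix_def)
      qed
      have lkqs: "suffix (W j) (W (lk q))" if "j \<in> {1..<cnt}" "strict_suffix (W j) s"
      proof -
        have "strict_suffix (W j) (W q)" using that sq suffix_order.less_trans by blast
        then show ?thesis using lk_max q2 that by blast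
      qed
      consider "i = Suc cnt" | "i = cnt" | "i = q" | "i \<in> {2..<cnt}" "i \<noteq> q" using i by fastforce
      then show ?thesis
      proof cases
        case 1
        then have "j \<noteq> Suc cnt" using st by (auto simp: strict_suffix_def)
        then have "j \<in> {1..<cnt}" using j jn by auto
        then show ?thesis using 1 st lkqs lk' lk_mem[OF q2] by auto
      next
        case 2
        then show ?thesis
          using cases3[OF j] jn st lk' q2 strict_suffix_text[of j] by (auto simp: strict_suffix_def)
      next
        case 3
        show ?thesis
        proof (cases "j = Suc cnt")
          case False
          then have jm: "j \<in> {1..<cnt}" using j jn by auto
          then have "strict_suffix (W j) (W q)" using st 3 q2 by auto
          then have "suffix (W j) (W (lk q))" using lk_max q2 jm by blast
          then have "suffix (W j) s" using lkq by (auto simp: strict_suffix_def)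
          then show ?thesis using 3 jm lk' q2 by auto
        qed (use 3 lk' q2 in auto)
      next
        case 4
        have lki: "?W (lk' i) = W (lk i)" using 4 lk' lk_mem[of i] by auto
        have im: "i \<in> {1..<cnt}" using 4 by auto
        show ?thesis
        proof (cases "j = Suc cnt")
          case True
          then have ss: "strict_suffix s (W i)" using st 4 by auto
          have sub: "endpos z (W i) \<subseteq> endpos z (W q)"
            using endpos_s ss endpos_antimono unfolding strict_suffix_def by metis
          have "endpos z (W i) \<noteq> endpos z (W q)" using W_inj im q_mem 4 by blast
          then have "strict_suffix (W q) (W i)"
            using suffix_W_if_subset[OF q_mem sub] W_factor[OF im] by blast
          then have "suffix (W q) (W (lk i))" using lk_max 4 q_mem by blast
          then show ?thesis using lki True s_suffix_Wq suffix_order.trans by auto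
        next
          case False
          then have jm: "j \<in> {1..<cnt}" using j jn by auto
          then show ?thesis using lki st 4 lk_max[of i j] by auto
        qed
      qed
    qed
    show "dl' 0 a = 1" if "a \<le> sg" for a using dl'[OF that, of 0] dl_bot that by auto
    show "endpos (z @ [c]) (?W i @ [a]) = {}"
      if i: "i \<in> {1..<Suc (Suc cnt)}" and a: "a \<le> sg" and 0: "dl' i a = 0" for i a
    proof -
      have "endpos (z @ [c]) ((z @ [c]) @ [a]) = {}"
        using endpos_nonempty_iff[of "z @ [c]" "z @ [c, a]"] sublist_length_le[of "z @ [c, a]" "z @ [c]"]
        by auto
      then show ?thesis
        using cases3[OF i] dlstep[of i a, OF _ a refl] 0 dlcl[OF a] epcl[of a] dlstep[OF q_mem a refl]
        by (elim disjE) auto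
    qed
    show "dl' i a \<in> {1..<Suc (Suc cnt)} \<and>
        endpos (z @ [c]) (?W (dl' i a)) = endpos (z @ [c]) (?W i @ [a])"
      if i: "i \<in> {1..<Suc (Suc cnt)}" and a: "a \<le> sg" and nz: "dl' i a \<noteq> 0" for i a
    proof -
      have "i \<noteq> cnt" using nz dl'[OF a, of i] dl_fresh[of i a] a by (auto simp: Let_def)
      then consider "i \<in> {1..<cnt}" | "i = Suc cnt" using cases3[OF i] by auto
      then show ?thesis
      proof cases
        case 1
        then show ?thesis using dlstep[OF 1 a refl] nz Wold[OF 1] by metis
      next
        case 2
        then show ?thesis using dlstep[OF q_mem a refl] nz dlcl[OF a] epcl[of a] by simp
      qed
    qed
    show "dl' i a = 0" if "Suc (Suc cnt) \<le> i" "a \<le> sg" for i a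
      using dl'[OF that(2), of i] dl_fresh[of i a] that by auto
  qed
qed

end

section \<open>Minimal absent words in the suffix automaton\<close>

context suffix_automaton_extension
begin

text \<open>The amortisation of the redirecting loop: \<open>p'\<close> is the state at which it stops.\<close>

lemma len_lk_q_le:
  assumes p': "\<And>i. i \<in> {1..<cnt} \<Longrightarrow> suffix (W i) z \<Longrightarrow> len p' < len i \<Longrightarrow> len i \<le> len p \<Longrightarrow> dl i c = q"
  shows "len (lk q) \<le> Suc (len p')"
proof (cases "q = 1")
  case True
  then show ?thesis by (metis lk_root len_bot zero_le)
next
  case False
  then have q2: "q \<in> {2..<cnt}" using q_mem by auto
  then have m: "lk q \<in> {1..<cnt}" using lk_mem by blast
  show ?thesis
  proof (cases "W (lk q)" rule: rev_exhaust)
    case Nil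
    then show ?thesis using len_eq[OF m] by simp
  next
    case (snoc t d)
    have "suffix (t @ [d]) (z @ [c])"
      using lk_q_strict_suffix[OF False] s_suffix snoc
      by (metis suffix_order.less_imp_le suffix_order.trans)
    then have d: "d = c" and t: "suffix t z" by auto
    then have ep: "length z \<in> endpos z t" by (simp add: length_in_endpos_iff)
    obtain i where i: "i \<in> {1..<cnt}" "endpos z (W i) = endpos z t" "suffix t (W i)"
      using W_cover[of t] ep by blast
    have Wi: "suffix (W i) z" using ep i(2) by (simp add: length_in_endpos_iff[symmetric])
    have e: "endpos z (W i @ [c]) = endpos z (W (lk q))"
      using endpos_cong_snoc(1)[OF i(2)] snoc d by simp
    then have nz: "dl i c \<noteq> 0" using dl_zero[OF i(1) c_le] W_factor[OF m] by auto
    have "dl i c \<noteq> q"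
      using dl_nonzero[OF i(1) c_le nz] e W_inj[OF q_mem m] lk_strict[OF q2] by force
    moreover have "len i \<le> len p" using dl_suffix_zero_iff[OF i(1) Wi] nz by simp
    ultimately have "len i \<le> len p'" using p'[OF i(1) Wi] by (meson not_le)
    then show ?thesis
      using len_eq[OF m] len_eq[OF i(1)] suffix_length_le[OF i(3)] snoc by simp
  qed
qed

lemma dl_eq_q_between:
  assumes p': "p' \<in> {1..<cnt}" "suffix (W p') z" "len p' \<le> len p"
    and i: "i \<in> {1..<cnt}" "suffix (W i) z" "len i \<le> len p'" "dl i c = q"
  shows "dl p' c = q"
proof -
  have p0: "p \<noteq> 0" using len_pos_nonzero[OF p'(1,3)] .
  then have p: "p \<in> {1..<cnt}" "suffix (W p) z" using p_less p_suffix by auto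
  have "suffix (W i) (W p')"
    using suffix_length_suffix[of "W i" z "W p'"] len_eq[OF i(1)] len_eq[OF p'(1)] i(2,3) p'(2) by simp
  then have 1: "endpos z (W p' @ [c]) \<subseteq> endpos z (W i @ [c])"
    by (intro endpos_subset_snoc endpos_antimono)
  have "suffix (W p') (W p)"
    using suffix_length_suffix[of "W p'" z "W p"] len_eq[OF p(1)] len_eq[OF p'(1)] p(2) p'(2,3) by simp
  then have "endpos z (W p @ [c]) \<subseteq> endpos z (W p' @ [c])"
    by (intro endpos_subset_snoc endpos_antimono)
  then have 2: "endpos z (W q) \<subseteq> endpos z (W p' @ [c])" using endpos_s s_eq p0 by simp
  have "endpos z (W q) = endpos z (W i @ [c])"
    using dl_nonzero[OF i(1) c_le] i(4) q_nonzero by auto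
  then have eq: "endpos z (W p' @ [c]) = endpos z (W q)" using 1 2 by auto
  then have nz: "dl p' c \<noteq> 0" using dl_zero[OF p'(1) c_le] W_factor[OF q_mem] by auto
  show ?thesis using dl_nonzero[OF p'(1) c_le nz] W_inj[OF _ q_mem] eq by auto
qed

lemma len_lk_q_le_unsplit: "len (lk q) \<le> Suc (len (lk p))"
proof (cases "p = 0")
  case True
  then have "q = 1" using dl_bot c_le q_eq by auto
  then show ?thesis by (metis lk_root len_bot zero_le)
next
  case False
  then have p: "p \<in> {1..<cnt}" "suffix (W p) z" using p_less p_suffix by auto
  show ?thesis
  proof (rule len_lk_q_le)
    fix i assume "i \<in> {1..<cnt}" "suffix (W i) z" "len (lk p) < len i" "len i \<le> len p"
    then show "dl i c = q" using len_lk_less_iff[OF p] q_eq by auto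
  qed
qed

end

lemma minimal_absent_words_iff:
  "v \<in> minimal_absent_words S x \<longleftrightarrow>
    v \<in> lists S \<and> v \<noteq> [] \<and> \<not> sublist v x \<and> sublist (butlast v) x \<and> sublist (tl v) x"
proof
  assume v: "v \<in> minimal_absent_words S x"
  then have ne: "v \<noteq> []" using Nil_notin_minimal_absent_words by metis
  then have "strict_sublist (butlast v) v" "strict_sublist (tl v) v"
    by (auto simp: strict_sublist_def) (metis append_butlast_last_id append_self_conv not_Cons_self2,
      metis list.collapse not_Cons_self2)
  then show "v \<in> lists S \<and> v \<noteq> [] \<and> \<not> sublist v x \<and> sublist (butlast v) x \<and> sublist (tl v) x"
    using v ne by (auto simp: minimal_absent_words_def absent_word_def)
next
  assume v: "v \<in> lists S \<and> v \<noteq> [] \<and> \<not> sublist v x \<and> sublist (butlast v) x \<and> sublist (tl v) x"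
  have "sublist u x" if u: "strict_sublist u v" for u
  proof -
    obtain p q where pq: "v = p @ u @ q"
      using u by (auto simp: strict_sublist_def sublist_def)
    have ne: "p \<noteq> [] \<or> q \<noteq> []" using u pq by (auto simp: strict_sublist_def)
    have "sublist u (tl v) \<or> sublist u (butlast v)"
    proof (cases "p = []")
      case True
      then have "butlast v = [] @ u @ butlast q" using pq ne by (simp add: butlast_append)
      then show ?thesis by (metis sublist_appendI)
    next
      case False
      then have "tl v = tl p @ u @ q" using pq by (simp add: tl_append2)
      then show ?thesis by (metis sublist_appendI)
    qed
    then show ?thesis using v sublist_order.order_trans by blast
  qed
  then show "v \<in> minimal_absent_words S x"
    using v by (auto simp: minimal_absent_words_def absent_word_def)
qed

lemma sublist_map_iff:
  assumes "inj_on f S" "u \<in> lists S" "x \<in> lists S"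
  shows "sublist (map f u) (map f x) \<longleftrightarrow> sublist u x"
proof
  assume "sublist (map f u) (map f x)"
  then obtain p q where "map f x = p @ map f u @ q" by (auto simp: sublist_def)
  then obtain x1 x2 x3 where x: "x = x1 @ x2 @ x3" "map f x2 = map f u"
    by (auto simp: map_eq_append_conv append_eq_map_conv)
  have "inj_on f (set x2 \<union> set u)"
    using assms x by (intro inj_on_subset[OF assms(1)]) auto
  then have "x2 = u" using x(2) map_inj_on by blast
  then show "sublist u x" using x by auto
qed (rule map_mono_sublist)

lemma minimal_absent_words_map:
  assumes "bij_betw f S T" "x \<in> lists S"
  shows "minimal_absent_words T (map f x) = map f ` minimal_absent_words S x"
proof -
  have inj: "inj_on f S" using assms bij_betw_def by blast
  have lists: "lists T = map f ` lists S"
    using assms by (metis bij_betw_def lists_image)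
  have iff: "map f v \<in> minimal_absent_words T (map f x) \<longleftrightarrow> v \<in> minimal_absent_words S x"
    if "v \<in> lists S" for v
  proof -
    have "butlast v \<in> lists S" "tl v \<in> lists S"
      using that by (auto dest: in_set_butlastD list.set_sel(2)[rotated])
        (metis list.sel(2) list.set_sel(2) subsetD)
    moreover have "map f v \<in> lists T" using that lists by blast
    ultimately show ?thesis
      using that sublist_map_iff[OF inj _ assms(2)]
      by (simp add: minimal_absent_words_iff map_butlast[symmetric] map_tl[symmetric] del: in_lists_conv_set)
  qed
  have sub: "minimal_absent_words S x \<subseteq> lists S" "minimal_absent_words T (map f x) \<subseteq> lists T"
    by (auto simp: minimal_absent_words_iff)
  show ?thesis
  proof (intro equalityI subsetI)
    fix w assume w: "w \<in> minimal_absent_words T (map f x)"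
    then obtain v where "v \<in> lists S" "w = map f v" using sub lists by blast
    then show "w \<in> map f ` minimal_absent_words S x" using w iff by blast
  qed (use iff sub in blast)
qed

lemma LW_image_map:
  assumes "inj_on f S" "A \<subseteq> lists S" "B \<subseteq> lists S"
  shows "LW (map f ` A) (map f ` B) = LW A B"
proof -
  have inj: "inj_on (map f) (lists S)"
    using assms(1) by (rule inj_on_mapI[OF inj_on_subset]) auto
  have diff: "map f ` (C - D) = map f ` C - map f ` D" if "C \<subseteq> lists S" "D \<subseteq> lists S" for C D
    by (rule inj_on_image_set_diff[OF inj]) (use that in auto)
  have "sym_diff (map f ` A) (map f ` B) = map f ` sym_diff A B"
    using assms by (simp only: image_Un diff)
  moreover have "inj_on (map f) (sym_diff A B)"
    using inj by (rule inj_on_subset) (use assms in auto)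
  ultimately show ?thesis by (simp add: LW_def sum.reindex)
qed

context suffix_automaton
begin

definition shortest :: "nat \<Rightarrow> nat list" where
  "shortest j = drop (length (W j) - len (lk j)) (W j)"

lemma length_shortest:
  assumes "j \<in> {1..<cnt}"
  shows "length (shortest j) = len (lk j)"
  using len_lk_less[OF assms] len_eq[OF assms] by (simp add: shortest_def)

lemma suffix_shortest: "suffix (shortest j) (W j)"
  by (simp add: shortest_def suffix_drop)

lemma shortest_root: "shortest 1 = []"
  unfolding shortest_def using W_root by simp

lemma endpos_shortest:
  assumes j: "j \<in> {1..<cnt}"
  shows "endpos z (shortest j) = endpos z (W j)"
proof (cases "j = 1")
  case True
  then show ?thesis using shortest_root W_root by metis
next
  case False
  then have j2: "j \<in> {2..<cnt}" using j by auto
  have sub: "endpos z (W j) \<subseteq> endpos z (shortest j)"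
    using endpos_antimono[OF suffix_shortest] .
  then have "endpos z (shortest j) \<noteq> {}" using W_factor[OF j] by auto
  then obtain i where i: "i \<in> {1..<cnt}" "endpos z (W i) = endpos z (shortest j)"
    "suffix (shortest j) (W i)"
    using W_cover by blast
  show ?thesis
  proof (rule ccontr)
    assume "\<not> ?thesis"
    then have "strict_suffix (W i) (W j)"
      using suffix_W_if_subset[OF i(1), of "W j"] sub i(2) W_factor[OF j] by auto
    then have "suffix (W i) (W (lk j))" using lk_max j2 i by blast
    then have "length (shortest j) \<le> length (W (lk j))"
      using i(3) suffix_length_le le_trans by blast
    then show False using length_shortest[OF j] len_eq[OF lk_mem[OF j2]] by simp
  qed
qed

lemma shortest_le:
  assumes j: "j \<in> {1..<cnt}" and u: "endpos z u = endpos z (W j)"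
  shows "suffix (shortest j) u"
proof (cases "j = 1")
  case True
  then show ?thesis using shortest_root by simp
next
  case False
  then have j2: "j \<in> {2..<cnt}" using j by auto
  have "length (W (lk j)) < length u"
  proof (rule ccontr)
    assume "\<not> ?thesis"
    then have "suffix u (W (lk j))"
      using suffix_W[OF j u] lk_strict[OF j2] suffix_length_suffix
      unfolding strict_suffix_def by (metis not_less)
    then have "endpos z (W (lk j)) \<subseteq> endpos z (W j)" using endpos_antimono u by metis
    moreover have "endpos z (W j) \<subseteq> endpos z (W (lk j))"
      using endpos_antimono lk_strict[OF j2] unfolding strict_suffix_def by blast
    ultimately have "lk j = j" using W_inj[OF lk_mem[OF j2] j] by auto
    then show False using lk_strict[OF j2] by simp
  qed
  then have "length (shortest j) \<le> length u"
    using length_shortest[OF j] len_eq[OF lk_mem[OF j2]] by simp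
  then show ?thesis using suffix_W[OF j u] suffix_shortest suffix_length_suffix by blast
qed

lemma tl_shortest:
  assumes "j \<in> {2..<cnt}"
  shows "tl (shortest j) = W (lk j)"
proof -
  have j: "j \<in> {1..<cnt}" using assms by auto
  have l: "length (tl (shortest j)) = length (W (lk j))"
    using length_shortest[OF j] len_eq[OF lk_mem[OF assms]] by simp
  have "suffix (tl (shortest j)) (W j)"
    using suffix_shortest suffix_order.trans suffix_tl by blast
  then have "suffix (tl (shortest j)) (W (lk j))"
    using lk_strict[OF assms] l suffix_length_suffix unfolding strict_suffix_def by force
  then show ?thesis using l by (auto simp: suffix_def)
qed

definition marks :: "nat list \<Rightarrow> nat set" where
  "marks X = {j \<in> {1..<cnt}. \<exists>i \<le> length X. \<exists>p \<in> {1..<cnt}.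
     endpos z (W p) = endpos z (take i X) \<and> suffix (W j) (W p)}"

lemma marks_eqI:
  assumes sub: "M \<subseteq> {1..<cnt}"
    and sound: "\<And>j. j \<in> M \<Longrightarrow> j \<in> marks X"
    and closed: "\<And>j. j \<in> M \<Longrightarrow> j \<noteq> 1 \<Longrightarrow> lk j \<in> M"
    and complete: "\<And>i. i \<le> length X \<Longrightarrow> \<exists>p\<in>M. endpos z (W p) = endpos z (take i X)"
  shows "M = marks X"
proof
  have down: "j \<in> M" if "p \<in> M" "j \<in> {1..<cnt}" "suffix (W j) (W p)" for p j
    using that
  proof (induction "length (W p)" arbitrary: p rule: less_induct)
    case less
    show ?case
    proof (cases "j = p")
      case False
      have p: "p \<in> {1..<cnt}" using less sub by blast
      have st: "strict_suffix (W j) (W p)"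
        using False less W_eq_iff p by (auto simp: strict_suffix_def)
      then have "p \<noteq> 1" using W_root by auto
      then have p2: "p \<in> {2..<cnt}" using p by auto
      have "suffix (W j) (W (lk p))" using lk_max p2 less st by blast
      then show ?thesis
        using less closed \<open>p \<noteq> 1\<close> suffix_length_less[OF lk_strict[OF p2]] by blast
    qed (use less in simp)
  qed
  show "marks X \<subseteq> M"
  proof
    fix j assume "j \<in> marks X"
    then obtain i p where ip: "j \<in> {1..<cnt}" "i \<le> length X" "p \<in> {1..<cnt}"
      "endpos z (W p) = endpos z (take i X)" "suffix (W j) (W p)"
      by (auto simp: marks_def)
    obtain p' where "p' \<in> M" "endpos z (W p') = endpos z (take i X)" using complete ip by blast
    then have "p \<in> M" using W_inj[of p p'] ip sub by auto
    then show "j \<in> M" using down ip by blast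
  qed
qed (use sound in blast)

end

text \<open>The text contains \<open>X\<close>, and no factor of \<open>X\<close> can be extended to the left beyond \<open>X\<close>
  without meeting the separator \<open>sg\<close>.\<close>

locale suffix_automaton_occurrence = suffix_automaton +
  fixes A X B :: "nat list"
  assumes z_eq: "z = A @ X @ B"
    and X_lists: "X \<in> lists {..<sg}"
    and A_sep: "A = [] \<or> last A = sg"
begin

lemma endpos_take: "i \<le> length X \<Longrightarrow> length A + i \<in> endpos z (take i X)"
  by (simp add: endpos_def z_eq suffix_def)

lemma suffix_take_if_endpos_subset:
  assumes "i \<le> length X" "u \<in> lists {..<sg}" "endpos z (take i X) \<subseteq> endpos z u"
  shows "suffix u (take i X)"
proof -
  have "length A + i \<in> endpos z u" using endpos_take assms by blast
  then have "suffix u (A @ take i X)" using assms by (simp add: endpos_def z_eq)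
  then consider "suffix u (take i X)" | u' where "u = u' @ take i X" "suffix u' A"
    by (auto simp: suffix_append)
  then show ?thesis
  proof cases
    case 2
    have "u' = []"
    proof (cases u' rule: rev_exhaust)
      case (snoc u'' d)
      then have "A \<noteq> []" "last A = d" using 2(2) by (auto simp: suffix_def)
      then show ?thesis using A_sep assms(2) 2 snoc by auto
    qed
    then show ?thesis using 2 by simp
  qed
qed

lemma sublist_z: "sublist u X \<Longrightarrow> endpos z u \<noteq> {}"
  using endpos_nonempty_iff z_eq sublist_appendI sublist_order.order_trans by metis

lemma lists_sublist: "sublist u X \<Longrightarrow> u \<in> lists {..<sg}"
  using X_lists set_mono_sublist by fastforce

lemma mem_marks_iff:
  assumes j: "j \<in> {1..<cnt}" and u: "endpos z u = endpos z (W j)" "u \<in> lists {..<sg}"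
  shows "j \<in> marks X \<longleftrightarrow> sublist u X"
proof
  assume "j \<in> marks X"
  then obtain i p where ip: "i \<le> length X" "p \<in> {1..<cnt}"
    "endpos z (W p) = endpos z (take i X)" "suffix (W j) (W p)"
    by (auto simp: marks_def)
  have "endpos z (take i X) \<subseteq> endpos z u" using endpos_antimono ip u by metis
  then have "suffix u (take i X)" using suffix_take_if_endpos_subset ip u by blast
  then show "sublist u X"
    using suffix_imp_sublist sublist_take sublist_order.order_trans by blast
next
  assume "sublist u X"
  then obtain i where i: "i \<le> length X" "suffix u (take i X)"
    using endpos_nonempty_iff[of X u] by (auto simp: endpos_def)
  have ne: "endpos z (take i X) \<noteq> {}" using endpos_take[OF i(1)] by blast
  obtain p where p: "p \<in> {1..<cnt}" "endpos z (W p) = endpos z (take i X)"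
    using W_cover[OF ne] by blast
  have sub: "endpos z (W p) \<subseteq> endpos z (W j)" using endpos_antimono[OF i(2)] p u by metis
  have "suffix (W j) (W p)"
  proof (cases "endpos z (W p) = endpos z (W j)")
    case True
    then show ?thesis using W_inj p j by auto
  next
    case False
    then show ?thesis
      using suffix_W_if_subset[OF j sub W_factor[OF p(1)]] by (simp add: strict_suffix_def)
  qed
  then show "j \<in> marks X" unfolding marks_def using j i p by blast
qed

lemma sublist_shortest_if_marked:
  assumes "j \<in> marks X"
  shows "sublist (shortest j) X"
proof -
  obtain i p where ip: "j \<in> {1..<cnt}" "i \<le> length X" "p \<in> {1..<cnt}"
    "endpos z (W p) = endpos z (take i X)" "suffix (W j) (W p)"
    using assms by (auto simp: marks_def)
  have "suffix (shortest j) (take i X)"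
  proof (cases "j = p")
    case True
    then show ?thesis using shortest_le ip by metis
  next
    case False
    have sub: "endpos z (take i X) \<subseteq> endpos z (W j)" using endpos_antimono ip by metis
    have "endpos z (take i X) \<noteq> endpos z (W j)" using W_inj ip False by metis
    moreover have "endpos z (take i X) \<noteq> {}" using endpos_take ip by blast
    ultimately have "strict_suffix (W j) (take i X)"
      using suffix_W_if_subset[OF ip(1) sub] by blast
    then show ?thesis using suffix_shortest by (auto simp: strict_suffix_def intro: suffix_order.trans)
  qed
  then show ?thesis using suffix_imp_sublist sublist_take sublist_order.order_trans by blast
qed

lemma marked_dl_iff:
  assumes "P \<in> {1..<cnt}" "b < sg" "endpos z w = endpos z (W P)" "w \<in> lists {..<sg}"
  shows "dl P b \<in> marks X \<longleftrightarrow> sublist (w @ [b]) X"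
proof -
  have e: "endpos z (W P @ [b]) = endpos z (w @ [b])" using endpos_cong_snoc(1) assms(3) by metis
  show ?thesis
  proof (cases "dl P b = 0")
    case True
    then have "endpos z (w @ [b]) = {}" using dl_zero[OF assms(1)] assms(2) e by auto
    then show ?thesis using True sublist_z by (auto simp: marks_def)
  next
    case False
    then show ?thesis
      using mem_marks_iff[of "dl P b" "w @ [b]"] dl_nonzero[OF assms(1), of b] assms e by auto
  qed
qed

lemma root_marked: "1 \<in> marks X"
proof -
  have "endpos z [] = endpos z (W 1)" using W_root by simp
  then show ?thesis using mem_marks_iff[of 1 "[]"] cnt_ge by auto
qed

lemma maw_iff:
  assumes P: "P \<in> {1..<cnt}" and b: "b < sg"
  shows "shortest P @ [b] \<in> minimal_absent_words {..<sg} X \<longleftrightarrow>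
    P \<in> marks X \<and> dl (lk P) b \<in> marks X \<and> dl P b \<notin> marks X"
proof -
  have m: "P \<in> marks X \<longleftrightarrow> shortest P \<in> lists {..<sg} \<and> sublist (shortest P) X"
    using sublist_shortest_if_marked lists_sublist mem_marks_iff[OF P endpos_shortest[OF P]] by blast
  have d: "dl P b \<in> marks X \<longleftrightarrow> sublist (shortest P @ [b]) X" if "shortest P \<in> lists {..<sg}"
    using marked_dl_iff[OF P b endpos_shortest[OF P] that] .
  have l: "dl (lk P) b \<in> marks X \<longleftrightarrow> sublist (tl (shortest P @ [b])) X"
    if s: "shortest P \<in> lists {..<sg}"
  proof (cases "P = 1")
    case True
    then have "dl (lk P) b = 1" using lk_root dl_bot[of b] b by simp
    moreover have "tl (shortest P @ [b]) = []" using True shortest_root by simp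
    ultimately show ?thesis using root_marked by simp
  next
    case False
    then have P2: "P \<in> {2..<cnt}" using P by auto
    then have "len (lk P) \<noteq> 0" using len_eq[OF lk_mem] by simp
    then have ne: "shortest P \<noteq> []" using length_shortest[OF P] by auto
    then have "tl (shortest P) \<in> lists {..<sg}" using s by (auto dest: list.set_sel(2))
    then show ?thesis
      using marked_dl_iff[OF lk_mem[OF P2] b refl] tl_shortest[OF P2] ne by simp
  qed
  show ?thesis
    using m d l b by (auto simp: minimal_absent_words_iff simp del: in_lists_conv_set)
qed

lemma maw_shortest:
  assumes v: "v \<in> minimal_absent_words {..<sg} X"
  shows "\<exists>P\<in>{1..<cnt}. \<exists>b<sg. v = shortest P @ [b]"
proof -
  have vs: "v \<in> lists {..<sg}" "v \<noteq> []" "\<not> sublist v X" "sublist (butlast v) X" "sublist (tl v) X"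
    using v by (auto simp: minimal_absent_words_iff)
  then obtain w b where w: "v = w @ [b]" by (metis rev_exhaust)
  have wl: "w \<in> lists {..<sg}" "b < sg" "sublist w X" using vs w by auto
  obtain P where P: "P \<in> {1..<cnt}" "endpos z (W P) = endpos z w"
    using W_cover[OF sublist_z[OF wl(3)]] by blast
  have suf: "suffix (shortest P) w" using shortest_le P by metis
  have "shortest P = w"
  proof (rule ccontr)
    assume ne: "shortest P \<noteq> w"
    then have wne: "w \<noteq> []" using suf by auto
    then have "suffix (shortest P) (tl w)" using suf ne by (cases w) (auto simp: suffix_Cons)
    then have "endpos z (tl w) \<subseteq> endpos z w" using endpos_antimono endpos_shortest P by metis
    have "sublist (tl w @ [b]) X" using vs(5) w wne by simp
    then obtain i where i: "i \<in> endpos X (tl w @ [b])" using endpos_nonempty_iff[of X] by blast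
    then obtain k where k: "i = Suc k" "k < length X" "suffix (tl w) (take k X)" "X ! k = b"
      unfolding endpos_snoc_word by (auto simp: endpos_def)
    have "endpos z (take k X) \<subseteq> endpos z w"
      using endpos_antimono[OF k(3)] \<open>endpos z (tl w) \<subseteq> endpos z w\<close> by blast
    then have "suffix w (take k X)" using suffix_take_if_endpos_subset k wl by simp
    then have "i \<in> endpos X (w @ [b])" unfolding endpos_snoc_word using k by (auto simp: endpos_def)
    then show False using vs(3) w endpos_nonempty_iff by blast
  qed
  then show ?thesis using w wl P by blast
qed

end

context suffix_automaton
begin

lemma shortest_snoc_inj: "inj_on (\<lambda>(P, b). shortest P @ [b]) ({1..<cnt} \<times> S)"
proof -
  have "P = P' \<and> b = b'"
    if "P \<in> {1..<cnt}" "P' \<in> {1..<cnt}" "shortest P @ [b] = shortest P' @ [b']" for P P' b b'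
    using that endpos_shortest W_inj by (metis append1_eq_conv)
  then show ?thesis by (force intro: inj_onI)
qed

lemma LW_eq_sum:
  assumes "suffix_automaton_occurrence z sg cnt W len lk dl A X B"
    and "suffix_automaton_occurrence z sg cnt W len lk dl A' Y B'"
  shows "LW (minimal_absent_words {..<sg} X) (minimal_absent_words {..<sg} Y) =
    (\<Sum>P\<in>{1..<cnt}. \<Sum>b<sg.
       if (P \<in> marks X \<and> dl (lk P) b \<in> marks X \<and> dl P b \<notin> marks X) \<noteq>
          (P \<in> marks Y \<and> dl (lk P) b \<in> marks Y \<and> dl P b \<notin> marks Y)
       then 1 / (of_nat (Suc (len (lk P))))\<^sup>2 else 0)"
proof -
  interpret X: suffix_automaton_occurrence z sg cnt W len lk dl A X B by fact
  interpret Y: suffix_automaton_occurrence z sg cnt W len lk dl A' Y B' by fact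
  let ?D = "sym_diff (minimal_absent_words {..<sg} X) (minimal_absent_words {..<sg} Y)"
  let ?f = "\<lambda>(P, b). shortest P @ [b]"
  let ?A = "{1..<cnt} \<times> {..<sg}"
  let ?S = "{x \<in> ?A. ?f x \<in> ?D}"
  have img: "?f ` ?S = ?D"
    using X.maw_shortest Y.maw_shortest by fastforce
  have inj: "inj_on ?f ?S" by (rule inj_on_subset[OF shortest_snoc_inj]) auto
  have "LW (minimal_absent_words {..<sg} X) (minimal_absent_words {..<sg} Y) =
      (\<Sum>w\<in>?f ` ?S. 1 / (of_nat (length w))\<^sup>2)"
    by (simp only: LW_def img)
  also have "\<dots> = (\<Sum>x\<in>?S. 1 / (of_nat (length (?f x)))\<^sup>2)"
    by (simp only: sum.reindex[OF inj] o_def)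
  also have "\<dots> = (\<Sum>x\<in>?A. if ?f x \<in> ?D then 1 / (of_nat (length (?f x)))\<^sup>2 else 0)"
    by (rule sum.inter_filter) simp
  also have "\<dots> = (\<Sum>P\<in>{1..<cnt}. \<Sum>b<sg. if shortest P @ [b] \<in> ?D
      then 1 / (of_nat (length (shortest P @ [b])))\<^sup>2 else 0)"
    by (simp only: sum.cartesian_product case_prod_unfold)
  also have "\<dots> = (\<Sum>P\<in>{1..<cnt}. \<Sum>b<sg.
       if (P \<in> marks X \<and> dl (lk P) b \<in> marks X \<and> dl P b \<notin> marks X) \<noteq>
          (P \<in> marks Y \<and> dl (lk P) b \<in> marks Y \<and> dl P b \<notin> marks Y)
       then 1 / (of_nat (Suc (len (lk P))))\<^sup>2 else 0)"
  proof (intro sum.cong refl)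
    fix P b assume P: "P \<in> {1..<cnt}" and b: "b \<in> {..<sg}"
    have "length (shortest P @ [b]) = Suc (len (lk P))" using length_shortest[OF P] by simp
    moreover have "shortest P @ [b] \<in> ?D \<longleftrightarrow>
       (P \<in> marks X \<and> dl (lk P) b \<in> marks X \<and> dl P b \<notin> marks X) \<noteq>
       (P \<in> marks Y \<and> dl (lk P) b \<in> marks Y \<and> dl P b \<notin> marks Y)"
      using X.maw_iff[OF P] Y.maw_iff[OF P] b by auto
    ultimately show "(if shortest P @ [b] \<in> ?D
      then 1 / (of_nat (length (shortest P @ [b])))\<^sup>2 else 0) =
      (if (P \<in> marks X \<and> dl (lk P) b \<in> marks X \<and> dl P b \<notin> marks X) \<noteq>
          (P \<in> marks Y \<and> dl (lk P) b \<in> marks Y \<and> dl P b \<notin> marks Y)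
       then 1 / (of_nat (Suc (len (lk P))))\<^sup>2 else (0 :: rat))"
      by (simp only:)
  qed
  finally show ?thesis .
qed

end

section \<open>A structured language compiled to the word RAM\<close>

text \<open>
  Programs act on variables and on a two-dimensional store \<open>st\<close>, the rows of which are the
  records of the automaton. \<open>LdX\<close> and \<open>StoX\<close> address the entry of a row at offset 4 plus the value of
  a variable, \<open>AccInv v\<close> adds the inverse square of \<open>v\<close> to the result, and \<open>tm\<close> counts steps.
\<close>

datatype atom =
    SetC nat nat
  | Mov nat nat
  | Plus nat nat nat
  | Inp nat nat
  | Ld nat nat nat
  | LdX nat nat nat
  | Sto nat nat nat
  | StoX nat nat nat
  | AccInv nat

datatype cmp = Eq | Less

datatype com =
    Atom atom
  | Seq com com (infixr ";;" 60)
  | Branch cmp nat nat com com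
  | While bool cmp nat nat com

record ast =
  rg :: "nat \<Rightarrow> nat"
  st :: "nat \<Rightarrow> nat \<Rightarrow> nat"
  acc :: rat
  tm :: nat

fun test :: "cmp \<Rightarrow> nat \<Rightarrow> nat \<Rightarrow> ast \<Rightarrow> bool" where
  "test Eq i j s \<longleftrightarrow> rg s i = rg s j"
| "test Less i j s \<longleftrightarrow> rg s i < rg s j"

definition tick :: "ast \<Rightarrow> ast" where
  "tick s = s\<lparr>tm := Suc (tm s)\<rparr>"

lemma tick_sel [simp]:
  "rg (tick s) = rg s" "st (tick s) = st s" "acc (tick s) = acc s" "tm (tick s) = Suc (tm s)"
  by (auto simp: tick_def)

locale store_machine =
  fixes b :: nat and inp :: "nat list" and R cap lim :: nat
  assumes lim_le: "lim \<le> 2 ^ b"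
    and store_le: "length inp + cap * R \<le> lim"
    and R_ge: "5 \<le> R"
    and cap_ge: "1 \<le> cap"
begin

fun atom_ok :: "atom \<Rightarrow> ast \<Rightarrow> bool" where
  "atom_ok (SetC v k) s \<longleftrightarrow> k < lim"
| "atom_ok (Mov v w) s \<longleftrightarrow> True"
| "atom_ok (Plus v w u) s \<longleftrightarrow> rg s w + rg s u < lim"
| "atom_ok (Inp v w) s \<longleftrightarrow> rg s w < length inp"
| "atom_ok (Ld v i k) s \<longleftrightarrow> rg s i < cap \<and> k < R"
| "atom_ok (LdX v i a) s \<longleftrightarrow> rg s i < cap \<and> 4 + rg s a < R"
| "atom_ok (Sto i k v) s \<longleftrightarrow> rg s i < cap \<and> k < R"
| "atom_ok (StoX i a v) s \<longleftrightarrow> rg s i < cap \<and> 4 + rg s a < R"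
| "atom_ok (AccInv v) s \<longleftrightarrow> True"

definition upd :: "(nat \<Rightarrow> nat \<Rightarrow> nat) \<Rightarrow> nat \<Rightarrow> nat \<Rightarrow> nat \<Rightarrow> nat \<Rightarrow> nat \<Rightarrow> nat" where
  "upd F i k v = (\<lambda>i' k'. if i' = i \<and> k' = k then v else F i' k')"

fun atom_ex :: "atom \<Rightarrow> ast \<Rightarrow> ast" where
  "atom_ex (SetC v k) s = (tick s)\<lparr>rg := (rg s)(v := k)\<rparr>"
| "atom_ex (Mov v w) s = (tick s)\<lparr>rg := (rg s)(v := rg s w)\<rparr>"
| "atom_ex (Plus v w u) s = (tick s)\<lparr>rg := (rg s)(v := rg s w + rg s u)\<rparr>"
| "atom_ex (Inp v w) s = (tick s)\<lparr>rg := (rg s)(v := inp ! rg s w)\<rparr>"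
| "atom_ex (Ld v i k) s = (tick s)\<lparr>rg := (rg s)(v := st s (rg s i) k)\<rparr>"
| "atom_ex (LdX v i a) s = (tick s)\<lparr>rg := (rg s)(v := st s (rg s i) (4 + rg s a))\<rparr>"
| "atom_ex (Sto i k v) s = (tick s)\<lparr>st := upd (st s) (rg s i) k (rg s v)\<rparr>"
| "atom_ex (StoX i a v) s = (tick s)\<lparr>st := upd (st s) (rg s i) (4 + rg s a) (rg s v)\<rparr>"
| "atom_ex (AccInv v) s = (tick s)\<lparr>acc := acc s + 1 / (of_nat (rg s v))\<^sup>2\<rparr>"

inductive big :: "com \<Rightarrow> ast \<Rightarrow> ast \<Rightarrow> bool" where
  Atom: "atom_ok a s \<Longrightarrow> big (Atom a) s (atom_ex a s)"
| Seq: "big c s s' \<Longrightarrow> big d s' s'' \<Longrightarrow> big (c ;; d) s s''"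
| BranchT: "test t i j s \<Longrightarrow> big c (tick s) s' \<Longrightarrow> big (Branch t i j c d) s s'"
| BranchF: "\<not> test t i j s \<Longrightarrow> big d (tick s) s' \<Longrightarrow> big (Branch t i j c d) s s'"
| WhileT: "test t i j s = p \<Longrightarrow> big c (tick s) s' \<Longrightarrow> big (While p t i j c) s' s'' \<Longrightarrow>
    big (While p t i j c) s s''"
| WhileF: "test t i j s \<noteq> p \<Longrightarrow> big (While p t i j c) s (tick s)"

definition wp :: "com \<Rightarrow> (ast \<Rightarrow> bool) \<Rightarrow> ast \<Rightarrow> bool" where
  "wp c Q s \<longleftrightarrow> (\<exists>s'. big c s s' \<and> Q s')"

inductive_cases big_AtomE: "big (Atom a) s s'"
inductive_cases big_SeqE: "big (c ;; d) s s'"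
inductive_cases big_BranchE: "big (Branch t i j c d) s s'"

lemma wp_Atom: "wp (Atom a) Q s \<longleftrightarrow> atom_ok a s \<and> Q (atom_ex a s)"
  by (auto simp: wp_def intro: big.Atom elim: big_AtomE)

lemma wp_Seq: "wp (c ;; d) Q s \<longleftrightarrow> wp c (wp d Q) s"
  by (auto simp: wp_def intro: big.Seq elim!: big_SeqE)

lemma wp_Branch: "wp (Branch t i j c d) Q s \<longleftrightarrow> (if test t i j s then wp c Q (tick s) else wp d Q (tick s))"
  by (auto simp: wp_def intro: big.BranchT big.BranchF elim: big_BranchE)

lemmas wp_simps = wp_Atom wp_Seq wp_Branch

lemma wp_While:
  fixes \<mu> :: "ast \<Rightarrow> nat"
  assumes "I s"
    and step: "\<And>s. I s \<Longrightarrow> test t i j s = p \<Longrightarrow> wp c (\<lambda>s'. I s' \<and> \<mu> s' < \<mu> s) (tick s)"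
    and exit: "\<And>s. I s \<Longrightarrow> test t i j s \<noteq> p \<Longrightarrow> Q (tick s)"
  shows "wp (While p t i j c) Q s"
  using assms(1)
proof (induction "\<mu> s" arbitrary: s rule: less_induct)
  case less
  show ?case
  proof (cases "test t i j s = p")
    case True
    then obtain s' where s': "big c (tick s) s'" "I s'" "\<mu> s' < \<mu> s"
      using step[OF less.prems] by (auto simp: wp_def)
    then obtain s'' where "big (While p t i j c) s' s''" "Q s''"
      using less.hyps[of s'] by (auto simp: wp_def)
    then show ?thesis using True s' by (auto simp: wp_def intro: big.WhileT)
  next
    case False
    then show ?thesis using exit[OF less.prems] by (auto simp: wp_def intro: big.WhileF)
  qed
qed

end

text \<open>Variable \<open>v\<close> lives in register \<open>v + 4\<close>; registers 0 and 1 are scratch, register 2 holds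
  the record size and register 3 the base address of the store.\<close>

fun atom_code :: "atom \<Rightarrow> instr list" where
  "atom_code (SetC v k) = [Const (v + 4) k]"
| "atom_code (Mov v w) = [Move (v + 4) (w + 4)]"
| "atom_code (Plus v w u) = [Arith Add (v + 4) (w + 4) (u + 4)]"
| "atom_code (Inp v w) = [Load (v + 4) (w + 4)]"
| "atom_code (Ld v i k) = [Arith Mul 0 (i + 4) 2, Arith Add 0 3 0, Const 1 k, Arith Add 0 0 1,
     Load (v + 4) 0]"
| "atom_code (LdX v i a) = [Arith Mul 0 (i + 4) 2, Arith Add 0 3 0, Const 1 4,
     Arith Add 1 1 (a + 4), Arith Add 0 0 1, Load (v + 4) 0]"
| "atom_code (Sto i k v) = [Arith Mul 0 (i + 4) 2, Arith Add 0 3 0, Const 1 k, Arith Add 0 0 1,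
     Store 0 (v + 4)]"
| "atom_code (StoX i a v) = [Arith Mul 0 (i + 4) 2, Arith Add 0 3 0, Const 1 4,
     Arith Add 1 1 (a + 4), Arith Add 0 0 1, Store 0 (v + 4)]"
| "atom_code (AccInv v) = [Const 0 1, RatOfWord 1 0, RatOfWord 2 (v + 4), RatArith RMul 2 2 2,
     RatArith RDiv 1 1 2, RatArith RAdd 0 0 1]"

fun jump_code :: "cmp \<Rightarrow> nat \<Rightarrow> nat \<Rightarrow> nat \<Rightarrow> instr" where
  "jump_code Eq i j l = JumpEq (i + 4) (j + 4) l"
| "jump_code Less i j l = JumpLess (i + 4) (j + 4) l"

fun size_code :: "com \<Rightarrow> nat" where
  "size_code (Atom a) = length (atom_code a)"
| "size_code (c ;; d) = size_code c + size_code d"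
| "size_code (Branch t i j c d) = size_code c + size_code d + 2"
| "size_code (While p t i j c) = size_code c + 3"

fun code :: "com \<Rightarrow> nat \<Rightarrow> instr list" where
  "code (Atom a) l = atom_code a"
| "code (c ;; d) l = code c l @ code d (l + size_code c)"
| "code (Branch t i j c d) l =
     [jump_code t i j (l + size_code d + 2)] @ code d (l + 1) @
     [Jump (l + size_code c + size_code d + 2)] @ code c (l + size_code d + 2)"
| "code (While p t i j c) l =
     [jump_code t i j (if p then l + 2 else l + size_code c + 3),
      Jump (if p then l + size_code c + 3 else l + 2)] @ code c (l + 2) @ [Jump l]"

lemma length_code [simp]: "length (code c l) = size_code c"
  by (induction c arbitrary: l) auto

definition code_at :: "instr list \<Rightarrow> nat \<Rightarrow> instr list \<Rightarrow> bool" where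
  "code_at P l is \<longleftrightarrow> (\<exists>pre post. P = pre @ is @ post \<and> length pre = l)"

lemma code_at_append:
  "code_at P l (is @ js) \<Longrightarrow> code_at P l is \<and> code_at P (l + length is) js"
proof -
  assume "code_at P l (is @ js)"
  then obtain pre post where P: "P = pre @ (is @ js) @ post" "length pre = l"
    by (auto simp: code_at_def)
  then have "P = pre @ is @ (js @ post)" "P = (pre @ is) @ js @ post" by auto
  then show ?thesis unfolding code_at_def using P(2) by (metis length_append)
qed

lemma code_at_Cons: "code_at P l (i # is) \<Longrightarrow> l < length P \<and> P ! l = i \<and> code_at P (Suc l) is"
proof -
  assume *: "code_at P l (i # is)"
  then obtain pre post where "P = pre @ (i # is) @ post" "length pre = l"
    by (auto simp: code_at_def)
  then have "l < length P" "P ! l = i" by (auto simp: nth_append)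
  then show ?thesis using code_at_append[of P l "[i]" "is"] * by simp
qed

lemma code_at_While:
  assumes "code_at P l (code (While p t i j c) l)"
  shows "l < length P" "P ! l = jump_code t i j (if p then l + 2 else l + size_code c + 3)"
    "Suc l < length P" "P ! Suc l = Jump (if p then l + size_code c + 3 else l + 2)"
    "code_at P (l + 2) (code c (l + 2))"
    "l + 2 + size_code c < length P" "P ! (l + 2 + size_code c) = Jump l"
proof -
  let ?J1 = "jump_code t i j (if p then l + 2 else l + size_code c + 3)"
  let ?J2 = "Jump (if p then l + size_code c + 3 else l + 2)"
  have "code_at P l (?J1 # ?J2 # code c (l + 2) @ [Jump l])"
    using assms unfolding code.simps by simp
  then have 1: "l < length P" "P ! l = ?J1" "code_at P (Suc l) (?J2 # code c (l + 2) @ [Jump l])"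
    using code_at_Cons by blast+
  have 2: "Suc l < length P" "P ! Suc l = ?J2"
    "code_at P (Suc (Suc l)) (code c (l + 2) @ [Jump l])"
    using code_at_Cons[OF 1(3)] by blast+
  have 3: "code_at P (l + 2) (code c (l + 2))" "code_at P (l + 2 + size_code c) [Jump l]"
    using code_at_append[OF 2(3)] by auto
  show "l < length P" "P ! l = ?J1" "Suc l < length P" "P ! Suc l = ?J2"
    "code_at P (l + 2) (code c (l + 2))"
    "l + 2 + size_code c < length P" "P ! (l + 2 + size_code c) = Jump l"
    using 1 2 3 code_at_Cons[OF 3(2)] by blast+
qed

definition runs :: "nat \<Rightarrow> instr list \<Rightarrow> nat \<Rightarrow> state \<Rightarrow> nat \<Rightarrow> state \<Rightarrow> bool" where
  "runs b P S s n s' \<longleftrightarrow> (step b P ^^ n) s = s' \<and>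
     (\<forall>t<n. addresses P ((step b P ^^ t) s) \<subseteq> {..<S})"

lemma runs_trans:
  assumes "runs b P S s n s'" "runs b P S s' n' s''"
  shows "runs b P S s (n + n') s''"
proof -
  have e: "(step b P ^^ (n + k)) s = (step b P ^^ k) s'" for k
    using assms(1) by (simp add: runs_def add.commute[of n] funpow_add)
  have "addresses P ((step b P ^^ t) s) \<subseteq> {..<S}" if "t < n + n'" for t
  proof (cases "t < n")
    case False
    then show ?thesis using e[of "t - n"] assms(2) that by (auto simp: runs_def)
  qed (use assms(1) in \<open>auto simp: runs_def\<close>)
  then show ?thesis using e[of n'] assms(2) by (auto simp: runs_def)
qed

lemma runs_1:
  "pc s < length P \<Longrightarrow> instr_addresses (P ! pc s) s \<subseteq> {..<S} \<Longrightarrow>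
    runs b P S s 1 (exec_instr b (P ! pc s) s)"
  by (auto simp: runs_def step_def halted_def addresses_def)

fun straight :: "instr \<Rightarrow> bool" where
  "straight (Jump l) = False"
| "straight (JumpEq i j l) = False"
| "straight (JumpLess i j l) = False"
| "straight _ = True"

lemma pc_straight: "straight i \<Longrightarrow> pc (exec_instr b i s) = Suc (pc s)"
  by (cases i) (auto simp: set_reg_def set_rreg_def)

fun addrs_ok :: "nat \<Rightarrow> nat \<Rightarrow> instr list \<Rightarrow> state \<Rightarrow> bool" where
  "addrs_ok b S [] s = True"
| "addrs_ok b S (i # is) s = (instr_addresses i s \<subseteq> {..<S} \<and> addrs_ok b S is (exec_instr b i s))"

lemma runs_straight:
  assumes "list_all straight is" "code_at P (pc s) is" "addrs_ok b S is s"
  shows "runs b P S s (length is) (fold (exec_instr b) is s)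
    \<and> pc (fold (exec_instr b) is s) = pc s + length is"
  using assms
proof (induction "is" arbitrary: s)
  case (Cons i "is")
  have c: "pc s < length P" "P ! pc s = i" "code_at P (Suc (pc s)) is"
    using code_at_Cons[OF Cons.prems(2)] by auto
  have pc: "pc (exec_instr b i s) = Suc (pc s)" using Cons.prems pc_straight by simp
  have "runs b P S s 1 (exec_instr b i s)" using runs_1[of s P S b] c Cons.prems by simp
  moreover have "runs b P S (exec_instr b i s) (length is) (fold (exec_instr b) is (exec_instr b i s))
    \<and> pc (fold (exec_instr b) is (exec_instr b i s)) = pc (exec_instr b i s) + length is"
    using Cons c pc by simp
  ultimately show ?case using pc runs_trans[of b P S s 1] by fastforce
qed (simp add: runs_def)

lemma straight_atom_code: "list_all straight (atom_code a)"
  by (cases a) auto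

lemma length_atom_code: "length (atom_code a) \<le> 6"
  by (cases a) auto

context store_machine
begin

definition space :: nat where
  "space = length inp + cap * R"

definition sim :: "ast \<Rightarrow> state \<Rightarrow> bool" where
  "sim s m \<longleftrightarrow> (\<forall>v. reg m (v + 4) = rg s v) \<and> reg m 2 = R \<and> reg m 3 = length inp
     \<and> (\<forall>j < length inp. mem m j = inp ! j)
     \<and> (\<forall>i < cap. \<forall>k < R. mem m (length inp + i * R + k) = st s i k)
     \<and> rreg m 0 = acc s"

lemma sim_tick [simp]: "sim (tick s) = sim s"
  by (auto simp: sim_def)

lemma sim_pc [simp]: "sim s (m\<lparr>pc := l\<rparr>) = sim s m"
  by (auto simp: sim_def)

lemma address_bounds:
  assumes "i < cap" "k < R"
  shows "i * R < 2 ^ b" "length inp + i * R < 2 ^ b" "length inp + i * R + k < 2 ^ b"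
    "length inp + i * R + k < space" "k < 2 ^ b"
proof -
  have "Suc i * R \<le> cap * R" using assms by (intro mult_le_mono1) simp
  then show "i * R < 2 ^ b" "length inp + i * R < 2 ^ b" "length inp + i * R + k < 2 ^ b"
    "length inp + i * R + k < space" "k < 2 ^ b"
    using assms store_le lim_le by (auto simp: space_def)
qed

lemma address_eq_iff:
  assumes "k < R" "k' < R"
  shows "length inp + i * R + k = length inp + i' * R + k' \<longleftrightarrow> i = i' \<and> k = k'"
proof
  assume "length inp + i * R + k = length inp + i' * R + k'"
  then have e: "i * R + k = i' * R + k'" by simp
  have "i = (i * R + k) div R" "i' = (i' * R + k') div R" using assms by auto
  then have "i = i'" using e by simp
  then show "i = i' \<and> k = k'" using e by simp
qed simp

lemma sim_store:
  assumes "sim s m" "i < cap" "k < R" "reg m' = (reg m)(0 := u, 1 := v)" "rreg m' = rreg m"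
    "mem m' = (mem m)(length inp + i * R + k := w)"
  shows "sim ((tick s)\<lparr>st := upd (st s) i k w\<rparr>) m'"
  using assms address_eq_iff[OF _ assms(3)] by (auto simp: sim_def upd_def)

lemma sim_load:
  assumes "sim s m" "reg m' = (reg m)(0 := u, 1 := u', v + 4 := w)" "rreg m' = rreg m" "mem m' = mem m"
  shows "sim ((tick s)\<lparr>rg := (rg s)(v := w)\<rparr>) m'"
  using assms by (auto simp: sim_def)

lemma sim_assign:
  assumes "sim s m" "reg m' = (reg m)(v + 4 := w)" "rreg m' = rreg m" "mem m' = mem m"
  shows "sim ((tick s)\<lparr>rg := (rg s)(v := w)\<rparr>) m'"
  using assms by (auto simp: sim_def)

lemma sim_atom:
  assumes "sim s m" "atom_ok a s"
  shows "sim (atom_ex a s) (fold (exec_instr b) (atom_code a) m) \<and>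
    addrs_ok b space (atom_code a) m"
proof -
  have rg: "reg m (v + 4) = rg s v" for v using assms by (simp add: sim_def)
  have base: "reg m 2 = R" "reg m 3 = length inp" using assms by (auto simp: sim_def)
  have R2: "4 < (2::nat) ^ b"
    using R_ge address_bounds(5)[of 0 4] cap_ge by auto
  note simps = set_reg_def set_rreg_def rg base
  show ?thesis
  proof (cases a)
    case (SetC v k)
    then show ?thesis using assms lim_le by (auto simp: simps intro!: sim_assign[where m = m])
  next
    case (Mov v w)
    then show ?thesis using assms by (auto simp: simps intro!: sim_assign[where m = m])
  next
    case (Plus v w u)
    then show ?thesis using assms lim_le by (auto simp: simps intro!: sim_assign[where m = m])
  next
    case (Inp v w)
    then have "mem m (rg s w) = inp ! rg s w" using assms by (auto simp: sim_def)
    then show ?thesis using Inp assms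
      by (auto simp: simps space_def intro!: sim_assign[where m = m])
  next
    case (Ld v i k)
    then have ok: "rg s i < cap" "k < R" using assms by auto
    then have "mem m (length inp + rg s i * R + k) = st s (rg s i) k"
      using assms by (auto simp: sim_def)
    then show ?thesis using Ld assms address_bounds[OF ok]
      by (auto simp: simps intro!: sim_load[where m = m])
  next
    case (LdX v i x)
    then have ok: "rg s i < cap" "4 + rg s x < R" using assms by auto
    then have "mem m (length inp + rg s i * R + (4 + rg s x)) = st s (rg s i) (4 + rg s x)"
      using assms unfolding sim_def by blast
    then show ?thesis using LdX assms address_bounds[OF ok] R2
      by (auto simp: simps intro!: sim_load[where m = m])
  next
    case (Sto i k v)
    then have ok: "rg s i < cap" "k < R" using assms by auto
    then show ?thesis using Sto assms address_bounds[OF ok]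
      by (auto simp: simps intro!: sim_store[where m = m])
  next
    case (StoX i x v)
    then have ok: "rg s i < cap" "4 + rg s x < R" using assms by auto
    then show ?thesis using StoX assms address_bounds[OF ok] R2
      by (auto simp: simps add.assoc intro!: sim_store[where m = m])
  next
    case (AccInv v)
    then show ?thesis using assms R2
      by (auto simp: simps sim_def power2_eq_square)
  qed
qed

lemma exec_jump_code:
  assumes "sim s m"
  shows "exec_instr b (jump_code t i j l) m = m\<lparr>pc := if test t i j s then l else Suc (pc m)\<rparr>"
    and "instr_addresses (jump_code t i j l) m = {}"
  using assms by (cases t; simp add: sim_def)+

lemma tm_atom_ex: "tm (atom_ex a s) = Suc (tm s)"
  by (cases a) auto

lemma runs_big:
  assumes "big c s s'" "sim s m" "code_at P (pc m) (code c (pc m))"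
  shows "\<exists>n m'. runs b P space m n m' \<and> sim s' m' \<and> pc m' = pc m + size_code c
    \<and> n + 6 * tm s \<le> 6 * tm s'"
  using assms
proof (induction arbitrary: m rule: big.induct)
  case (Atom a s)
  then have "runs b P space m (length (atom_code a)) (fold (exec_instr b) (atom_code a) m)
    \<and> pc (fold (exec_instr b) (atom_code a) m) = pc m + length (atom_code a)"
    using sim_atom straight_atom_code by (intro runs_straight) auto
  then show ?case using sim_atom[of s m a] Atom length_atom_code[of a] tm_atom_ex[of a s]
    by (intro exI[of _ "length (atom_code a)"] exI[of _ "fold (exec_instr b) (atom_code a) m"]) auto
next
  case (Seq c s s' d s'')
  have cs: "code_at P (pc m) (code c (pc m))" "code_at P (pc m + size_code c) (code d (pc m + size_code c))"
    using code_at_append[of P "pc m" "code c (pc m)"] Seq.prems by auto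
  obtain n m' where 1: "runs b P space m n m'" "sim s' m'" "pc m' = pc m + size_code c"
    "n + 6 * tm s \<le> 6 * tm s'" using Seq.IH(1)[OF Seq.prems(1) cs(1)] by blast
  obtain n' m'' where 2: "runs b P space m' n' m''" "sim s'' m''" "pc m'' = pc m' + size_code d"
    "n' + 6 * tm s' \<le> 6 * tm s''" using Seq.IH(2)[OF 1(2)] 1(3) cs(2) by auto
  show ?case using runs_trans[OF 1(1) 2(1)] 1 2
    by (intro exI[of _ "n + n'"] exI[of _ m'']) auto
next
  case (BranchT t i j s c s' d)
  let ?l = "pc m + size_code d + 2"
  have j: "pc m < length P" "P ! pc m = jump_code t i j ?l"
    and c: "code_at P ?l (code c ?l)"
    using code_at_Cons[of P "pc m" "jump_code t i j ?l"]
      code_at_append[of P "Suc (pc m)" "code d (Suc (pc m))"]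
      code_at_Cons[of P "Suc (pc m + size_code d)" _ "code c ?l"] BranchT.prems by auto
  have 1: "runs b P space m 1 (m\<lparr>pc := ?l\<rparr>)"
    using runs_1[OF j(1), of space b] j(2) exec_jump_code[OF BranchT.prems(1), of t i j ?l] BranchT.hyps by simp
  obtain n m' where 2: "runs b P space (m\<lparr>pc := ?l\<rparr>) n m'" "sim s' m'" "pc m' = ?l + size_code c"
    "n + 6 * tm (tick s) \<le> 6 * tm s'" using BranchT.IH[of "m\<lparr>pc := ?l\<rparr>"] BranchT.prems c by auto
  show ?case using runs_trans[OF 1 2(1)] 2
    by (intro exI[of _ "1 + n"] exI[of _ m']) auto
next
  case (BranchF t i j s d s' c)
  let ?l = "pc m + size_code d + 2"
  let ?e = "pc m + size_code c + size_code d + 2"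
  have j: "pc m < length P" "P ! pc m = jump_code t i j ?l"
    and d: "code_at P (Suc (pc m)) (code d (Suc (pc m)))"
    and e: "Suc (pc m + size_code d) < length P" "P ! Suc (pc m + size_code d) = Jump ?e"
    using code_at_Cons[of P "pc m" "jump_code t i j ?l"]
      code_at_append[of P "Suc (pc m)" "code d (Suc (pc m))"]
      code_at_Cons[of P "Suc (pc m + size_code d)" _ "code c ?l"] BranchF.prems by auto
  have 1: "runs b P space m 1 (m\<lparr>pc := Suc (pc m)\<rparr>)"
    using runs_1[OF j(1), of space b] j(2) exec_jump_code[OF BranchF.prems(1), of t i j ?l] BranchF.hyps by simp
  obtain n m' where 2: "runs b P space (m\<lparr>pc := Suc (pc m)\<rparr>) n m'" "sim s' m'"
    "pc m' = Suc (pc m) + size_code d" "n + 6 * tm (tick s) \<le> 6 * tm s'"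
    using BranchF.IH[of "m\<lparr>pc := Suc (pc m)\<rparr>"] BranchF.prems d by auto
  have 3: "runs b P space m' 1 (m'\<lparr>pc := ?e\<rparr>)"
    using runs_1[of m' P space b] e 2(3) by simp
  show ?case using runs_trans[OF runs_trans[OF 1 2(1)] 3] 2
    by (intro exI[of _ "1 + n + 1"] exI[of _ "m'\<lparr>pc := ?e\<rparr>"]) auto
next
  case (WhileT t i j s p c s' s'')
  let ?e = "pc m + size_code c + 3"
  have j: "pc m < length P" "P ! pc m = jump_code t i j (if p then pc m + 2 else ?e)"
    and j': "Suc (pc m) < length P" "P ! Suc (pc m) = Jump (if p then ?e else pc m + 2)"
    and c: "code_at P (pc m + 2) (code c (pc m + 2))"
    and e: "pc m + 2 + size_code c < length P" "P ! (pc m + 2 + size_code c) = Jump (pc m)"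
    using code_at_While[OF WhileT.prems(2)] by blast+
  have 1: "\<exists>k\<le>2. runs b P space m k (m\<lparr>pc := pc m + 2\<rparr>)"
  proof (cases p)
    case True
    then show ?thesis
      using runs_1[OF j(1), of space b] j(2) exec_jump_code[OF WhileT.prems(1), of t i j] WhileT.hyps
      by (intro exI[of _ 1]) auto
  next
    case False
    then have "runs b P space m 1 (m\<lparr>pc := Suc (pc m)\<rparr>)"
      using runs_1[OF j(1), of space b] j(2) exec_jump_code[OF WhileT.prems(1), of t i j] WhileT.hyps
      by auto
    moreover have "runs b P space (m\<lparr>pc := Suc (pc m)\<rparr>) 1 (m\<lparr>pc := pc m + 2\<rparr>)"
      using runs_1[of "m\<lparr>pc := Suc (pc m)\<rparr>" P space b] j' False by auto
    ultimately show ?thesis using runs_trans by (metis one_add_one order_refl)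
  qed
  then obtain k where k: "k \<le> 2" "runs b P space m k (m\<lparr>pc := pc m + 2\<rparr>)" by blast
  obtain n m' where 2: "runs b P space (m\<lparr>pc := pc m + 2\<rparr>) n m'" "sim s' m'"
    "pc m' = pc m + 2 + size_code c" "n + 6 * tm (tick s) \<le> 6 * tm s'"
    using WhileT.IH(1)[of "m\<lparr>pc := pc m + 2\<rparr>"] WhileT.prems c by auto
  have 3: "runs b P space m' 1 (m'\<lparr>pc := pc m\<rparr>)"
    using runs_1[of m' P space b] e 2(3) by simp
  obtain n' m'' where 4: "runs b P space (m'\<lparr>pc := pc m\<rparr>) n' m''" "sim s'' m''"
    "pc m'' = ?e" "n' + 6 * tm s' \<le> 6 * tm s''"
    using WhileT.IH(2)[of "m'\<lparr>pc := pc m\<rparr>"] WhileT.prems 2(2) by auto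
  show ?case
    using runs_trans[OF runs_trans[OF runs_trans[OF k(2) 2(1)] 3] 4(1)] 2 4 k(1)
    by (intro exI[of _ "k + n + 1 + n'"] exI[of _ m'']) auto
next
  case (WhileF t i j s p c)
  let ?e = "pc m + size_code c + 3"
  have j: "pc m < length P" "P ! pc m = jump_code t i j (if p then pc m + 2 else ?e)"
    and j': "Suc (pc m) < length P" "P ! Suc (pc m) = Jump (if p then ?e else pc m + 2)"
    using code_at_While[OF WhileF.prems(2)] by blast+
  have 1: "\<exists>k\<le>2. runs b P space m k (m\<lparr>pc := ?e\<rparr>)"
  proof (cases p)
    case False
    then show ?thesis
      using runs_1[OF j(1), of space b] j(2) exec_jump_code[OF WhileF.prems(1), of t i j] WhileF.hyps
      by (intro exI[of _ 1]) auto
  next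
    case True
    then have "runs b P space m 1 (m\<lparr>pc := Suc (pc m)\<rparr>)"
      using runs_1[OF j(1), of space b] j(2) exec_jump_code[OF WhileF.prems(1), of t i j] WhileF.hyps
      by auto
    moreover have "runs b P space (m\<lparr>pc := Suc (pc m)\<rparr>) 1 (m\<lparr>pc := ?e\<rparr>)"
      using runs_1[of "m\<lparr>pc := Suc (pc m)\<rparr>" P space b] j' True by auto
    ultimately show ?thesis using runs_trans by (metis one_add_one order_refl)
  qed
  then obtain k where k: "k \<le> 2" "runs b P space m k (m\<lparr>pc := ?e\<rparr>)" by blast
  then show ?case using WhileF.prems by (intro exI[of _ k] exI[of _ "m\<lparr>pc := ?e\<rparr>"]) auto
qed

end

section \<open>Online construction of the automaton\<close>

abbreviation (input) "vM \<equiv> 2 :: nat"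
abbreviation (input) "vN \<equiv> 3 :: nat"
abbreviation (input) "vI \<equiv> 4 :: nat"
abbreviation (input) "vJ \<equiv> 5 :: nat"
abbreviation (input) "vC \<equiv> 6 :: nat"
abbreviation (input) "vA \<equiv> 7 :: nat"
abbreviation (input) "vP \<equiv> 8 :: nat"
abbreviation (input) "vQ \<equiv> 9 :: nat"
abbreviation (input) "vT \<equiv> 10 :: nat"
abbreviation (input) "vU \<equiv> 11 :: nat"
abbreviation (input) "vLast \<equiv> 12 :: nat"
abbreviation (input) "vCnt \<equiv> 13 :: nat"
abbreviation (input) "vCur \<equiv> 14 :: nat"
abbreviation (input) "vCl \<equiv> 15 :: nat"
abbreviation (input) "vEnd \<equiv> 16 :: nat"
abbreviation (input) "vZero \<equiv> 17 :: nat"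
abbreviation (input) "vOne \<equiv> 18 :: nat"
abbreviation (input) "vSg \<equiv> 19 :: nat"
abbreviation (input) "vSg1 \<equiv> 20 :: nat"
abbreviation (input) "vT1 \<equiv> 21 :: nat"
abbreviation (input) "vT2 \<equiv> 22 :: nat"
abbreviation (input) "vV \<equiv> 23 :: nat"
abbreviation (input) "vL \<equiv> 24 :: nat"

definition add_transitions :: com where
  "add_transitions = While True Eq vQ vZero
     (Atom (StoX vP vC vCur) ;; Atom (Ld vP vP 3) ;; Atom (LdX vQ vP vC))"

definition redirect_transitions :: com where
  "redirect_transitions = While True Eq vU vQ
     (Atom (StoX vP vC vCl) ;; Atom (Ld vP vP 3) ;; Atom (LdX vU vP vC))"

definition copy_row :: com where
  "copy_row = Atom (SetC vA 0) ;; While True Less vA vSg1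
     (Atom (LdX vU vQ vA) ;; Atom (StoX vCl vA vU) ;; Atom (Plus vA vA vOne))"

text \<open>
  Row \<open>i\<close> of the store describes state \<open>i\<close>: entries 0 and 1 are its marks for \<open>x\<close> and \<open>y\<close>, entry 2 is
  \<open>len i\<close>, entry 3 is \<open>lk i\<close> and entry \<open>4 + a\<close> is \<open>dl i a\<close>. The letter \<open>sg\<close> is the separator.
\<close>

locale lw_machine = store_machine +
  fixes x y :: "nat list" and sg :: nat
  assumes inp_eq: "inp = x @ y" and R_eq: "R = sg + 5" and cap_eq: "cap = 2 * length inp + 5"
    and x_lists: "x \<in> lists {..<sg}" and y_lists: "y \<in> lists {..<sg}"
begin

lemma R_simps [simp]: "4 + a < R \<longleftrightarrow> a \<le> sg" "0 < R" "Suc 0 < R" "2 < R" "3 < R"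
  by (auto simp: R_eq)

lemma lim_bounds: "sg + 5 \<le> lim" "5 * cap \<le> lim"
proof -
  have *: "cap * R \<le> lim" using store_le by linarith
  have "1 * R \<le> cap * R" by (intro mult_le_mono1) (simp add: cap_eq)
  then show "sg + 5 \<le> lim" using * R_eq by linarith
  have "cap * 5 \<le> cap * R" by (intro mult_le_mono2) (simp add: R_eq)
  then show "5 * cap \<le> lim" using * by linarith
qed

abbreviation automaton :: "(nat \<Rightarrow> nat \<Rightarrow> nat) \<Rightarrow> nat list \<Rightarrow> nat \<Rightarrow> (nat \<Rightarrow> nat list) \<Rightarrow> bool" where
  "automaton F z cnt W \<equiv> suffix_automaton z sg cnt W (\<lambda>i. F i 2) (\<lambda>i. F i 3) (\<lambda>i a. F i (4 + a))"

abbreviation extension ::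
  "(nat \<Rightarrow> nat \<Rightarrow> nat) \<Rightarrow> nat list \<Rightarrow> nat \<Rightarrow> (nat \<Rightarrow> nat list) \<Rightarrow> nat \<Rightarrow> nat \<Rightarrow> nat \<Rightarrow> nat list \<Rightarrow> bool" where
  "extension F z cnt W \<equiv>
     suffix_automaton_extension z sg cnt W (\<lambda>i. F i 2) (\<lambda>i. F i 3) (\<lambda>i a. F i (4 + a))"

definition longer_suffixes :: "(nat \<Rightarrow> nat \<Rightarrow> nat) \<Rightarrow> nat list \<Rightarrow> nat \<Rightarrow> (nat \<Rightarrow> nat list) \<Rightarrow> nat \<Rightarrow> nat set" where
  "longer_suffixes F z cnt W p = {i \<in> {1..<cnt}. suffix (W i) z \<and> F p 2 < F i 2}"

lemma longer_suffixes_lk: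
  assumes "automaton F z cnt W" "p \<in> {1..<cnt}" "suffix (W p) z"
  shows "longer_suffixes F z cnt W (F p 3) = insert p (longer_suffixes F z cnt W p)"
  using suffix_automaton.len_lk_less_iff[OF assms(1-3)] assms(2,3)
  by (auto simp: longer_suffixes_def)

definition redirect :: "(nat \<Rightarrow> nat \<Rightarrow> nat) \<Rightarrow> nat set \<Rightarrow> nat \<Rightarrow> nat \<Rightarrow> nat \<Rightarrow> nat \<Rightarrow> nat" where
  "redirect F S c v = (\<lambda>i k. if k = 4 + c \<and> i \<in> S then v else F i k)"

lemma upd_redirect: "upd (redirect F S c v) p (4 + c) v = redirect F (insert p S) c v"
  by (auto simp: upd_def redirect_def fun_eq_iff)

lemma redirect_empty: "redirect F {} c v = F"
  by (auto simp: redirect_def)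

lemma wp_add_transitions:
  assumes sa: "automaton (st s) z cnt W"
    and cnt: "cnt \<le> cap"
    and regs: "rg s vZero = 0" "rg s vC = c" "c \<le> sg" "rg s vP = l" "rg s vQ = st s l (4 + c)"
    and l: "l \<in> {1..<cnt}" "W l = z"
    and Q: "\<And>s' p. extension (st s) z cnt W c p (st s p (4 + c)) (if p = 0 then [] else W p @ [c]) \<Longrightarrow>
      rg s' = (rg s)(vP := p, vQ := st s p (4 + c)) \<Longrightarrow>
      st s' = redirect (st s) (longer_suffixes (st s) z cnt W p) c (rg s vCur) \<Longrightarrow>
      acc s' = acc s \<Longrightarrow>
      tm s' + 4 * st s p 2 \<le> tm s + 5 + 4 * st s (st s l 3) 2 \<Longrightarrow>
      st s (st s p 3) 2 \<le> st s (st s (st s l 3) 3) 2 \<Longrightarrow> Q s'"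
  shows "wp add_transitions Q s"
proof -
  interpret suffix_automaton z sg cnt W "\<lambda>i. st s i 2" "\<lambda>i. st s i 3" "\<lambda>i a. st s i (4 + a)"
    by (fact sa)
  let ?F = "st s"
  let ?S = "longer_suffixes ?F z cnt W"
  let ?I = "\<lambda>p s'. p < cnt \<and> (p = 0 \<or> suffix (W p) z) \<and> (\<forall>i\<in>?S p. ?F i (4 + c) = 0) \<and>
    rg s' = (rg s)(vP := p, vQ := ?F p (4 + c)) \<and>
    st s' = redirect ?F (?S p) c (rg s vCur) \<and> acc s' = acc s \<and>
    (p = l \<and> tm s' = tm s \<or>
     tm s' + 4 * ?F p 2 \<le> tm s + 4 + 4 * ?F (?F l 3) 2 \<and> ?F (?F p 3) 2 \<le> ?F (?F (?F l 3) 3) 2)"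
  have len_lk_le: "?F (?F p 3) 2 \<le> ?F p 2" if "p < cnt" for p
    using len_lk_less[of p] lk_bot that by (cases "p = 0") auto
  have Sl: "?S l = {}"
    using len_eq l suffix_length_le by (fastforce simp: longer_suffixes_def)
  have zc: "endpos z (z @ [c]) = {}"
    using endpos_nonempty_iff[of z "z @ [c]"] sublist_length_le[of "z @ [c]" z] by auto
  have l0: "?F l (4 + c) = 0" using dl_nonzero[OF l(1) regs(3)] l zc W_factor by metis
  show ?thesis unfolding add_transitions_def
  proof (rule wp_While[where I = "\<lambda>s'. \<exists>p. ?I p s'" and \<mu> = "\<lambda>s'. ?F (rg s' vP) 2"])
    have "rg s = (rg s)(vP := l, vQ := ?F l (4 + c))" using regs by auto
    then show "\<exists>p. ?I p s" using l Sl by (intro exI[of _ l]) (simp add: redirect_empty)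
  next
    fix s' assume "\<exists>p. ?I p s'" and t: "test Eq vQ vZero s' = True"
    then obtain p where I: "?I p s'" by blast
    then have pc: "?F p (4 + c) = 0" using t regs by simp
    then have p0: "p \<noteq> 0" using dl_bot[OF regs(3)] by (metis zero_neq_one)
    then have p: "p \<in> {1..<cnt}" "suffix (W p) z" using I by auto
    let ?p = "?F p 3"
    have p'less: "?p < cnt" using lk_less p by auto
    have S': "?S ?p = insert p (?S p)" using longer_suffixes_lk[OF sa p] .
    have np: "?p \<notin> ?S ?p" by (simp add: longer_suffixes_def)
    have st': "upd (st s') p (4 + c) (rg s vCur) = redirect ?F (?S ?p) c (rg s vCur)"
      using I S' by (simp add: upd_redirect)
    have lk': "redirect ?F (?S ?p) c v p 3 = ?p" for v by (simp add: redirect_def)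
    have dl': "redirect ?F (?S ?p) c v ?p (4 + c) = ?F ?p (4 + c)" for v
      using np by (simp add: redirect_def)
    have less: "?F ?p 2 < ?F p 2" using len_lk_less[OF p(1)] .
    have step: "?I ?p s''" if "rg s'' = (rg s)(vP := ?p, vQ := ?F ?p (4 + c))"
      "st s'' = redirect ?F (?S ?p) c (rg s vCur)" "acc s'' = acc s" "tm s'' = tm s' + 4" for s''
    proof -
      have "?p = 0 \<or> suffix (W ?p) z" using suffix_W_lk[OF p] .
      moreover have "\<forall>i\<in>?S ?p. ?F i (4 + c) = 0" using I pc S' by auto
      moreover have "tm s'' + 4 * ?F ?p 2 \<le> tm s + 4 + 4 * ?F (?F l 3) 2 \<and>
        ?F (?F ?p 3) 2 \<le> ?F (?F (?F l 3) 3) 2"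
        using I that less len_lk_le[of "?p"] p'less by auto
      ultimately show ?thesis using that p'less by blast
    qed
    show "wp (Atom (StoX vP vC vCur) ;; Atom (Ld vP vP 3) ;; Atom (LdX vQ vP vC))
      (\<lambda>s''. (\<exists>p. ?I p s'') \<and> ?F (rg s'' vP) 2 < ?F (rg s' vP) 2) (tick s')"
    proof -
      have rs: "rg s' = (rg s)(vP := p, vQ := ?F p (4 + c))" and "acc s' = acc s" using I by blast+
      let ?s1 = "atom_ex (StoX vP vC vCur) (tick s')"
      let ?s3 = "atom_ex (LdX vQ vP vC) (atom_ex (Ld vP vP 3) ?s1)"
      have s1: "st ?s1 = redirect ?F (?S ?p) c (rg s vCur)" "rg ?s1 = rg s'"
        using rs st' regs by simp_all
      have s3: "rg ?s3 = (rg s)(vP := ?p, vQ := ?F ?p (4 + c))"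
        "st ?s3 = redirect ?F (?S ?p) c (rg s vCur)" "acc ?s3 = acc s" "tm ?s3 = tm s' + 4"
        using s1 rs regs lk' dl' \<open>acc s' = acc s\<close> by (simp_all del: atom_ex.simps(8)) simp_all
      have "\<exists>p. ?I p ?s3" using step[OF s3] by blast
      moreover have "?F (rg ?s3 vP) 2 < ?F (rg s' vP) 2" using s3(1) rs less by simp
      moreover have "atom_ok (StoX vP vC vCur) (tick s')" "atom_ok (Ld vP vP 3) ?s1"
        "atom_ok (LdX vQ vP vC) (atom_ex (Ld vP vP 3) ?s1)"
        using s1 rs regs lk' p p'less cnt by (simp_all del: atom_ex.simps(8))
      ultimately show ?thesis unfolding wp_simps by blast
    qed
  next
    fix s' assume "\<exists>p. ?I p s'" and t: "test Eq vQ vZero s' \<noteq> True"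
    then obtain p where I: "?I p s'" by blast
    then have pc: "?F p (4 + c) \<noteq> 0" using t regs by simp
    then have "p \<noteq> l" using l0 by auto
    have "extension ?F z cnt W c p (?F p (4 + c)) (if p = 0 then [] else W p @ [c])"
      by unfold_locales (use I regs pc in \<open>auto simp: longer_suffixes_def\<close>)
    then show "Q (tick s')"
      using I \<open>p \<noteq> l\<close> by (intro Q[of p]) auto
  qed
qed

lemma wp_copy_row:
  assumes regs: "rg s vQ = q" "rg s vCl = cl" "rg s vSg1 = Suc sg" "rg s vOne = 1"
    and "q < cap" "cl < cap" "q \<noteq> cl"
    and Q: "\<And>s' u a. rg s' = (rg s)(vU := u, vA := a) \<Longrightarrow>
      st s' = (\<lambda>i k. if i = cl \<and> 4 \<le> k \<and> k \<le> 4 + sg then st s q k else st s i k) \<Longrightarrow>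
      acc s' = acc s \<Longrightarrow> tm s' = tm s + 4 * sg + 6 \<Longrightarrow> Q s'"
  shows "wp copy_row Q s"
proof -
  let ?G = "\<lambda>a i k. if i = cl \<and> 4 \<le> k \<and> k < 4 + a then st s q k else st s i k"
  let ?I = "\<lambda>u a s'. a \<le> Suc sg \<and> rg s' = (rg s)(vU := u, vA := a) \<and> st s' = ?G a \<and>
      acc s' = acc s \<and> tm s' = tm s + 4 * a + 1"
  have "wp (While True Less vA vSg1
     (Atom (LdX vU vQ vA) ;; Atom (StoX vCl vA vU) ;; Atom (Plus vA vA vOne))) Q s'"
    if "\<exists>u a. ?I u a s'" for s'
  proof (rule wp_While[where I = "\<lambda>s'. \<exists>u a. ?I u a s'" and \<mu> = "\<lambda>s'. Suc sg - rg s' vA"])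
    fix s' assume "\<exists>u a. ?I u a s'" and t: "test Less vA vSg1 s' = True"
    then obtain u a where I: "?I u a s'" by blast
    then have a: "a \<le> sg" using t regs by simp
    have G: "upd (?G a) cl (4 + a) (st s q (4 + a)) = ?G (Suc a)"
      by (auto simp: upd_def fun_eq_iff)
    have Gq: "?G a q (4 + a) = st s q (4 + a)" using assms by simp
    have "?I (st s q (4 + a)) (Suc a) s''"
      if "rg s'' = (rg s)(vU := st s q (4 + a), vA := Suc a)" "st s'' = ?G (Suc a)"
        "acc s'' = acc s" "tm s'' = tm s' + 4" for s''
      using that I a by simp
    then show "wp (Atom (LdX vU vQ vA) ;; Atom (StoX vCl vA vU) ;; Atom (Plus vA vA vOne))
      (\<lambda>s''. (\<exists>u a. ?I u a s'') \<and> Suc sg - rg s'' vA < Suc sg - rg s' vA) (tick s')"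
      using I regs assms(5-7) lim_bounds a G Gq
      by (simp add: wp_simps) (intro conjI exI[of _ "st s q (4 + a)"] exI[of _ "Suc a"]; auto simp: fun_upd_twist)
  next
    fix s' assume "\<exists>u a. ?I u a s'" and t: "test Less vA vSg1 s' \<noteq> True"
    then obtain u a where I: "?I u a s'" by blast
    then have "a = Suc sg" using t regs by simp
    moreover have "?G (Suc sg) = (\<lambda>i k. if i = cl \<and> 4 \<le> k \<and> k \<le> 4 + sg then st s q k else st s i k)"
      by (intro ext) auto
    ultimately show "Q (tick s')" using I by (intro Q[of _ u a]) simp_all
  qed (fact that)
  moreover have "?I (rg s vU) 0 (atom_ex (SetC vA 0) s)" by (auto simp: fun_eq_iff)
  ultimately show ?thesis unfolding copy_row_def wp_simps
    using lim_bounds by (intro conjI) (simp, blast)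
qed

end

definition split :: com where
  "split = (Atom (Mov vCl vCnt) ;; Atom (Plus vCnt vCnt vOne) ;; Atom (Sto vCl 2 vT) ;;
     Atom (Ld vU vQ 3) ;; Atom (Sto vCl 3 vU)) ;; copy_row ;; Atom (Mov vU vQ) ;; redirect_transitions ;;
     Atom (Sto vQ 3 vCl) ;; Atom (Sto vCur 3 vCl)"

definition extend :: com where
  "extend = (Atom (Mov vCur vCnt) ;; Atom (Plus vCnt vCnt vOne) ;; Atom (Mov vP vLast) ;;
       Atom (LdX vQ vP vC)) ;; add_transitions ;;
     (Atom (Ld vT vP 2) ;; Atom (Plus vT vT vOne) ;; Atom (Ld vU vQ 2)) ;;
     Branch Eq vT vU (Atom (Sto vCur 3 vQ)) split ;;
     Atom (Ld vT vLast 2) ;; Atom (Plus vT vT vOne) ;; Atom (Sto vCur 2 vT) ;;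
     Atom (Mov vLast vCur)"

context lw_machine
begin

lemma wp_redirect_transitions:
  assumes ex: "extension F z cnt W c p q t"
    and q: "q \<noteq> 1"
    and G: "\<And>i. i < cnt \<Longrightarrow> st s i 3 = F i 3"
      "\<And>i. i < cnt \<Longrightarrow> i \<notin> longer_suffixes F z cnt W p \<Longrightarrow> st s i (4 + c) = F i (4 + c)"
    and cnt: "cnt \<le> cap"
    and regs: "rg s vC = c" "rg s vP = p" "rg s vQ = q" "rg s vU = q"
    and Q: "\<And>s' p' u. rg s' = (rg s)(vP := p', vU := u) \<Longrightarrow>
      st s' = redirect (st s) {i \<in> {1..<cnt}. suffix (W i) z \<and> F i 2 \<le> F p 2 \<and> F i (4 + c) = q}
        c (rg s vCl) \<Longrightarrow>
      acc s' = acc s \<Longrightarrow>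
      tm s' + 4 * F (F q 3) 2 \<le> tm s + 9 + 4 * F (F p 3) 2 \<Longrightarrow> Q s'"
  shows "wp redirect_transitions Q s"
proof -
  interpret suffix_automaton_extension z sg cnt W "\<lambda>i. F i 2" "\<lambda>i. F i 3" "\<lambda>i a. F i (4 + a)" c p q t
    by (fact ex)
  have sa: "automaton F z cnt W" by unfold_locales
  let ?S = "longer_suffixes F z cnt W"
  let ?T = "{i \<in> {1..<cnt}. suffix (W i) z \<and> F i 2 \<le> F p 2 \<and> F i (4 + c) = q}"
  let ?I = "\<lambda>p' s'. p' < cnt \<and> (p' = 0 \<or> suffix (W p') z) \<and> F p' 2 \<le> F p 2 \<and>
    (\<forall>i\<in>?S p' - ?S p. F i (4 + c) = q) \<and>
    rg s' = (rg s)(vP := p', vU := F p' (4 + c)) \<and>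
    st s' = redirect (st s) (?S p' - ?S p) c (rg s vCl) \<and> acc s' = acc s \<and>
    (p' = p \<and> tm s' = tm s \<or> tm s' + 4 * F p' 2 \<le> tm s + 4 + 4 * F (F p 3) 2)"
  show ?thesis unfolding redirect_transitions_def
  proof (rule wp_While[where I = "\<lambda>s'. \<exists>p'. ?I p' s'" and \<mu> = "\<lambda>s'. F (rg s' vP) 2"])
    have "rg s = (rg s)(vP := p, vU := F p (4 + c))" using regs q_eq by auto
    then show "\<exists>p'. ?I p' s"
      using p_less p_suffix by (intro exI[of _ p]) (simp add: redirect_empty)
  next
    fix s' assume "\<exists>p'. ?I p' s'" and t: "test Eq vU vQ s' = True"
    then obtain p' where I: "?I p' s'" by blast
    then have pc: "F p' (4 + c) = q" using t regs by simp
    then have p0: "p' \<noteq> 0" using dl_bot[OF c_le] q by metis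
    then have p: "p' \<in> {1..<cnt}" "suffix (W p') z" using I by auto
    let ?p = "F p' 3"
    have p'less: "?p < cnt" using lk_less p by auto
    have p'S: "p' \<notin> ?S p" using I by (auto simp: longer_suffixes_def)
    have S': "?S ?p - ?S p = insert p' (?S p' - ?S p)"
      using longer_suffixes_lk[OF sa p] p'S by auto
    have np: "?p \<notin> ?S ?p" by (simp add: longer_suffixes_def)
    have less: "F ?p 2 < F p' 2" using len_lk_less[OF p(1)] .
    then have npS: "?p \<notin> ?S p" using I by (auto simp: longer_suffixes_def)
    have st': "upd (st s') p' (4 + c) (rg s vCl) = redirect (st s) (?S ?p - ?S p) c (rg s vCl)"
      using I S' by (simp add: upd_redirect)
    have lk': "redirect (st s) (?S ?p - ?S p) c v p' 3 = ?p" for v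
      using G p by (simp add: redirect_def)
    have dl': "redirect (st s) (?S ?p - ?S p) c v ?p (4 + c) = F ?p (4 + c)" for v
      using np npS G p'less by (simp add: redirect_def)
    have step: "?I ?p s''" if "rg s'' = (rg s)(vP := ?p, vU := F ?p (4 + c))"
      "st s'' = redirect (st s) (?S ?p - ?S p) c (rg s vCl)" "acc s'' = acc s" "tm s'' = tm s' + 4" for s''
    proof -
      have "?p = 0 \<or> suffix (W ?p) z" using suffix_W_lk[OF p] .
      moreover have "\<forall>i\<in>?S ?p - ?S p. F i (4 + c) = q" using I pc S' by auto
      moreover have "tm s'' + 4 * F ?p 2 \<le> tm s + 4 + 4 * F (F p 3) 2"
        using I that less by auto
      moreover have "F ?p 2 \<le> F p 2" using I less by linarith
      ultimately show ?thesis using that p'less by blast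
    qed
    have rs: "rg s' = (rg s)(vP := p', vU := F p' (4 + c))" and "acc s' = acc s" using I by blast+
    let ?s1 = "atom_ex (StoX vP vC vCl) (tick s')"
    let ?s3 = "atom_ex (LdX vU vP vC) (atom_ex (Ld vP vP 3) ?s1)"
    have s1: "st ?s1 = redirect (st s) (?S ?p - ?S p) c (rg s vCl)" "rg ?s1 = rg s'"
      using rs st' regs by simp_all
    have s3: "rg ?s3 = (rg s)(vP := ?p, vU := F ?p (4 + c))"
      "st ?s3 = redirect (st s) (?S ?p - ?S p) c (rg s vCl)" "acc ?s3 = acc s" "tm ?s3 = tm s' + 4"
      using s1 rs regs lk' dl' \<open>acc s' = acc s\<close> by (simp_all del: atom_ex.simps(8)) simp_all
    have "\<exists>p. ?I p ?s3" using step[OF s3] by blast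
    moreover have "F (rg ?s3 vP) 2 < F (rg s' vP) 2" using s3(1) rs less by simp
    moreover have "atom_ok (StoX vP vC vCl) (tick s')" "atom_ok (Ld vP vP 3) ?s1"
      "atom_ok (LdX vU vP vC) (atom_ex (Ld vP vP 3) ?s1)"
      using s1 rs regs lk' p p'less cnt c_le by (simp_all del: atom_ex.simps(8))
    ultimately show "wp (Atom (StoX vP vC vCl) ;; Atom (Ld vP vP 3) ;; Atom (LdX vU vP vC))
      (\<lambda>s''. (\<exists>p'. ?I p' s'') \<and> F (rg s'' vP) 2 < F (rg s' vP) 2) (tick s')"
      unfolding wp_simps by blast
  next
    fix s' assume "\<exists>p'. ?I p' s'" and t: "test Eq vU vQ s' \<noteq> True"
    then obtain p' where I: "?I p' s'" by blast
    then have pc: "F p' (4 + c) \<noteq> q" using t regs by simp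
    then have "p' \<noteq> p" using q_eq by auto
    have S: "?S p' - ?S p = ?T"
    proof
      show "?S p' - ?S p \<subseteq> ?T" using I by (auto simp: longer_suffixes_def)
      have "F p' 2 < F i 2" if "i \<in> ?T" for i
      proof (rule ccontr)
        assume n: "\<not> ?thesis"
        then have "p' \<noteq> 0" using len_pos_nonzero[of i p'] that by auto
        then show False using dl_eq_q_between[of p' i] I that n pc by auto
      qed
      then show "?T \<subseteq> ?S p' - ?S p" by (auto simp: longer_suffixes_def)
    qed
    have "F (F q 3) 2 \<le> Suc (F p' 2)"
    proof (rule len_lk_q_le)
      fix i assume "i \<in> {1..<cnt}" "suffix (W i) z" "F p' 2 < F i 2" "F i 2 \<le> F p 2"
      then have "i \<in> ?S p' - ?S p" by (simp add: longer_suffixes_def)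
      then show "F i (4 + c) = q" using I by blast
    qed
    moreover have "tm s' + 4 * F p' 2 \<le> tm s + 4 + 4 * F (F p 3) 2" using I \<open>p' \<noteq> p\<close> by blast
    ultimately have "tm (tick s') + 4 * F (F q 3) 2 \<le> tm s + 9 + 4 * F (F p 3) 2" by simp
    then show "Q (tick s')"
      using I S by (intro Q[of _ p' "F p' (4 + c)"]) auto
  qed
qed

lemma wp_split:
  assumes ex: "extension F z cnt W c p q t"
    and st: "st s = redirect F (longer_suffixes F z cnt W p) c cnt"
    and len: "F q 2 \<noteq> Suc (F p 2)"
    and cnt: "Suc (Suc cnt) \<le> cap"
    and regs: "rg s vC = c" "rg s vP = p" "rg s vQ = q" "rg s vT = Suc (F p 2)" "rg s vCur = cnt"
      "rg s vCnt = Suc cnt" "rg s vOne = 1" "rg s vSg1 = Suc sg"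
    and Q: "\<And>s'. (\<And>v. v \<notin> {vP, vU, vA, vCl, vCnt} \<Longrightarrow> rg s' v = rg s v) \<Longrightarrow>
      rg s' vCnt = Suc (Suc cnt) \<Longrightarrow>
      (\<lambda>i. st s' i 2) = (\<lambda>i. F i 2)(Suc cnt := Suc (F p 2)) \<Longrightarrow>
      (\<lambda>i. st s' i 3) = (\<lambda>i. F i 3)(cnt := Suc cnt, q := Suc cnt, Suc cnt := F q 3) \<Longrightarrow>
      (\<And>i a. a \<le> sg \<Longrightarrow> st s' i (4 + a) =
        (let d1 = (\<lambda>i. if a = c \<and> i \<in> {1..<cnt} \<and> suffix (W i) z \<and> F p 2 < F i 2 then cnt else F i (4 + a))
         in if i = Suc cnt then d1 q
            else if a = c \<and> i \<in> {1..<cnt} \<and> suffix (W i) z \<and> F i 2 \<le> F p 2 \<and> F i (4 + c) = q then Suc cnt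
            else d1 i)) \<Longrightarrow>
      (\<And>i k. k < 2 \<Longrightarrow> st s' i k = F i k) \<Longrightarrow>
      acc s' = acc s \<Longrightarrow>
      tm s' + 4 * F (F q 3) 2 \<le> tm s + 4 * sg + 23 + 4 * F (F p 3) 2 \<Longrightarrow> Q s'"
  shows "wp split Q s"
proof -
  interpret suffix_automaton_extension z sg cnt W "\<lambda>i. F i 2" "\<lambda>i. F i 3" "\<lambda>i a. F i (4 + a)" c p q t
    by (fact ex)
  let ?S = "longer_suffixes F z cnt W p"
  let ?T = "{i \<in> {1..<cnt}. suffix (W i) z \<and> F i 2 \<le> F p 2 \<and> F i (4 + c) = q}"
  let ?cl = "Suc cnt"
  have q: "q < cnt" "0 < q" using q_mem by auto
  have q1: "q \<noteq> 1"
  proof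
    assume "q = 1"
    then have "F q 2 = 1" using len_eq[of q] q_mem W_root by simp
    moreover have "length t \<le> length (W q)" using suffix_length_le[OF s_suffix_Wq] .
    ultimately show False using len length_s \<open>q = 1\<close> W_root by simp
  qed
  let ?s1 = "atom_ex (Sto vCl 3 vU) (atom_ex (Ld vU vQ 3) (atom_ex (Sto vCl 2 vT)
     (atom_ex (Plus vCnt vCnt vOne) (atom_ex (Mov vCl vCnt) s))))"
  let ?F1 = "redirect F ?S c cnt"
  have r3: "?F1 i 3 = F i 3" "?F1 i 2 = F i 2" for i by (auto simp: redirect_def)
  have s1: "rg ?s1 = (rg s)(vCl := ?cl, vCnt := Suc ?cl, vU := F q 3)"
    "st ?s1 = upd (upd ?F1 ?cl 2 (Suc (F p 2))) ?cl 3 (F q 3)" "acc ?s1 = acc s" "tm ?s1 = tm s + 5"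
    using regs st q r3 by (auto simp: upd_def fun_eq_iff)
  have ok1: "wp (Atom (Mov vCl vCnt) ;; Atom (Plus vCnt vCnt vOne) ;; Atom (Sto vCl 2 vT) ;;
     Atom (Ld vU vQ 3) ;; Atom (Sto vCl 3 vU)) P s" if "P ?s1" for P
    unfolding wp_simps using regs cnt q lim_bounds that by simp
  have "wp copy_row (wp (Atom (Mov vU vQ) ;; redirect_transitions ;; Atom (Sto vQ 3 vCl) ;; Atom (Sto vCur 3 vCl)) Q) ?s1"
  proof (rule wp_copy_row[where q = q and cl = ?cl])
    show "rg ?s1 vQ = q" "rg ?s1 vCl = ?cl" "rg ?s1 vSg1 = Suc sg" "rg ?s1 vOne = 1"
      using s1(1) regs by (simp_all del: atom_ex.simps)
    show "q < cap" "?cl < cap" "q \<noteq> ?cl" using q cnt by auto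
    fix s2 :: ast and u a
    assume s2: "rg s2 = (rg ?s1)(vU := u, vA := a)"
      "st s2 = (\<lambda>i k. if i = ?cl \<and> 4 \<le> k \<and> k \<le> 4 + sg then st ?s1 q k else st ?s1 i k)"
      "acc s2 = acc ?s1" "tm s2 = tm ?s1 + 4 * sg + 6"
    let ?s3 = "atom_ex (Mov vU vQ) s2"
    have s3: "rg ?s3 = (rg s)(vCl := ?cl, vCnt := Suc ?cl, vA := a, vU := q)" "st ?s3 = st s2"
      "acc ?s3 = acc s" "tm ?s3 = tm s + 4 * sg + 12"
      using s2 s1 regs by (auto simp: fun_eq_iff simp del: atom_ex.simps) auto
    have st2: "st s2 i k = (if i = ?cl \<and> 4 \<le> k \<and> k \<le> 4 + sg then ?F1 q k
        else if i = ?cl \<and> k = 2 then Suc (F p 2) else if i = ?cl \<and> k = 3 then F q 3 else ?F1 i k)" for i k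
      using s2(2) s1(2) q by (auto simp: upd_def)
    have "wp redirect_transitions (wp (Atom (Sto vQ 3 vCl) ;; Atom (Sto vCur 3 vCl)) Q) ?s3"
    proof (rule wp_redirect_transitions[OF ex q1])
      show "st ?s3 i 3 = F i 3" if "i < cnt" for i using s3(2) st2 r3 that by simp
      show "st ?s3 i (4 + c) = F i (4 + c)" if "i < cnt" "i \<notin> ?S" for i
        using s3(2) st2 that by (simp add: redirect_def)
      show "cnt \<le> cap" using cnt by simp
      show "rg ?s3 vC = c" "rg ?s3 vP = p" "rg ?s3 vQ = q" "rg ?s3 vU = q"
        using s3(1) regs by (simp_all del: atom_ex.simps)
      fix s4 :: ast and p' u'
      assume s4: "rg s4 = (rg ?s3)(vP := p', vU := u')" "st s4 = redirect (st ?s3) ?T c (rg ?s3 vCl)"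
        "acc s4 = acc ?s3" "tm s4 + 4 * F (F q 3) 2 \<le> tm ?s3 + 9 + 4 * F (F p 3) 2"
      let ?s6 = "atom_ex (Sto vCur 3 vCl) (atom_ex (Sto vQ 3 vCl) s4)"
      have rcl: "rg ?s3 vCl = ?cl" using s3(1) by (simp del: atom_ex.simps)
      have r4: "rg s4 v = rg s v" if "v \<notin> {vP, vU, vA, vCl, vCnt}" for v
        using s4(1) s3(1) that by (simp del: atom_ex.simps)
      have r4': "rg s4 vCnt = Suc ?cl" "rg s4 vCl = ?cl" "rg s4 vQ = q" "rg s4 vCur = cnt"
        using s4(1) s3(1) regs by (simp_all del: atom_ex.simps)
      have st6: "st ?s6 = upd (upd (redirect (st s2) ?T c ?cl) q 3 ?cl) cnt 3 ?cl"
        using s4(2) rcl s3(2) r4' by (simp del: atom_ex.simps) simp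
      have Q6: "Q ?s6"
      proof (rule Q)
        show "rg ?s6 v = rg s v" if "v \<notin> {vP, vU, vA, vCl, vCnt}" for v using r4[OF that] by simp
        show "rg ?s6 vCnt = Suc ?cl" using r4' by simp
        show "(\<lambda>i. st ?s6 i 2) = (\<lambda>i. F i 2)(Suc cnt := Suc (F p 2))"
          unfolding st6 by (auto simp: fun_eq_iff upd_def redirect_def st2)
        show "(\<lambda>i. st ?s6 i 3) = (\<lambda>i. F i 3)(cnt := Suc cnt, q := Suc cnt, Suc cnt := F q 3)"
          unfolding st6 using q by (auto simp: fun_eq_iff upd_def redirect_def st2)
        show "st ?s6 i (4 + a) =
          (let d1 = (\<lambda>i. if a = c \<and> i \<in> {1..<cnt} \<and> suffix (W i) z \<and> F p 2 < F i 2 then cnt else F i (4 + a))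
           in if i = Suc cnt then d1 q
              else if a = c \<and> i \<in> {1..<cnt} \<and> suffix (W i) z \<and> F i 2 \<le> F p 2 \<and> F i (4 + c) = q then Suc cnt
              else d1 i)" if "a \<le> sg" for i a
          unfolding st6 using that
          by (auto simp: upd_def redirect_def st2 longer_suffixes_def Let_def)
        show "st ?s6 i k = F i k" if "k < 2" for i k
          unfolding st6 using that by (auto simp: upd_def redirect_def st2)
        show "acc ?s6 = acc s" using s4(3) s3(3) by (simp del: atom_ex.simps(2))
        show "tm ?s6 + 4 * F (F q 3) 2 \<le> tm s + 4 * sg + 23 + 4 * F (F p 3) 2"
          using s4(4) s3(4) by (simp del: atom_ex.simps(2))
      qed
      show "wp (Atom (Sto vQ 3 vCl) ;; Atom (Sto vCur 3 vCl)) Q s4"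
        unfolding wp_simps using Q6 r4' q cnt by simp
    qed
    then show "wp (Atom (Mov vU vQ) ;; redirect_transitions ;; Atom (Sto vQ 3 vCl) ;; Atom (Sto vCur 3 vCl)) Q s2"
      unfolding wp_Seq[of "Atom (Mov vU vQ)"] wp_Seq[of redirect_transitions] wp_Atom[of "Mov vU vQ"] by simp
  qed
  then show ?thesis unfolding split_def wp_Seq[of "_ ;; _ ;; _"] wp_Seq[of copy_row] by (rule ok1)
qed

end

definition init :: "nat \<Rightarrow> com" where
  "init sg = (Atom (SetC vOne 1) ;; Atom (SetC vSg sg) ;; Atom (SetC vSg1 (Suc sg)) ;;
     Atom (Plus vEnd vM vN) ;; Atom (Plus vEnd vEnd vOne) ;; Atom (Sto vOne 2 vOne) ;;
     Atom (Mov vLast vOne) ;; Atom (SetC vCnt 2) ;; Atom (SetC vA 0)) ;;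
     While True Less vA vSg1 (Atom (StoX vZero vA vOne) ;; Atom (Plus vA vA vOne))"

definition build :: com where
  "build = While True Less vI vEnd
     (Branch Eq vI vM (Atom (Mov vC vSg)) (Atom (Inp vC vJ) ;; Atom (Plus vJ vJ vOne)) ;;
      extend ;; Atom (Plus vI vI vOne))"

context lw_machine
begin

definition pot :: "(nat \<Rightarrow> nat \<Rightarrow> nat) \<Rightarrow> nat \<Rightarrow> nat" where
  "pot F l = F (F l 3) 2 + F (F (F l 3) 3) 2"

lemma wp_extend:
  assumes sa: "automaton (st s) z cnt W"
    and cnt: "Suc (Suc cnt) \<le> cap" and cz: "length z + 2 < lim"
    and regs: "rg s vZero = 0" "rg s vOne = 1" "rg s vSg1 = Suc sg" "rg s vC = c" "rg s vLast = l"
      "rg s vCnt = cnt"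
    and c: "c \<le> sg"
    and l: "l \<in> {1..<cnt}" "W l = z"
    and Q: "\<And>s' cnt' W' l'. automaton (st s') (z @ [c]) cnt' W' \<Longrightarrow> cnt' \<le> Suc (Suc cnt) \<Longrightarrow>
      (\<And>v. v \<notin> {vP, vQ, vT, vU, vA, vCur, vCl, vCnt, vLast} \<Longrightarrow> rg s' v = rg s v) \<Longrightarrow>
      rg s' vLast = l' \<Longrightarrow> l' \<in> {1..<cnt'} \<Longrightarrow> W' l' = z @ [c] \<Longrightarrow> rg s' vCnt = cnt' \<Longrightarrow>
      (\<And>i k. k < 2 \<Longrightarrow> st s' i k = st s i k) \<Longrightarrow> acc s' = acc s \<Longrightarrow>
      tm s' + 4 * pot (st s') l' \<le> tm s + 4 * pot (st s) l + 4 * sg + 50 \<Longrightarrow> Q s'"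
  shows "wp extend Q s"
proof -
  interpret suffix_automaton z sg cnt W "\<lambda>i. st s i 2" "\<lambda>i. st s i 3" "\<lambda>i a. st s i (4 + a)"
    by (fact sa)
  let ?F = "st s"
  have lz: "?F l 2 = Suc (length z)" using len_eq[OF l(1)] l by simp
  let ?fin = "Atom (Ld vT vLast 2) ;; Atom (Plus vT vT vOne) ;; Atom (Sto vCur 2 vT) ;;
     Atom (Mov vLast vCur)"
  let ?if = "Branch Eq vT vU (Atom (Sto vCur 3 vQ)) split"
  let ?mid = "Atom (Ld vT vP 2) ;; Atom (Plus vT vT vOne) ;; Atom (Ld vU vQ 2)"
  let ?s1 = "atom_ex (LdX vQ vP vC) (atom_ex (Mov vP vLast) (atom_ex (Plus vCnt vCnt vOne)
     (atom_ex (Mov vCur vCnt) s)))"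
  have s1: "rg ?s1 = (rg s)(vCur := cnt, vCnt := Suc cnt, vP := l, vQ := ?F l (4 + c))"
    "st ?s1 = ?F" "acc ?s1 = acc s" "tm ?s1 = tm s + 4"
    using regs by (auto simp: fun_eq_iff)
  have ok1: "wp (Atom (Mov vCur vCnt) ;; Atom (Plus vCnt vCnt vOne) ;; Atom (Mov vP vLast) ;;
       Atom (LdX vQ vP vC)) P s" if "P ?s1" for P
    unfolding wp_simps using regs cnt lim_bounds l c that by simp
  have "wp add_transitions (wp ?mid (wp ?if (wp ?fin Q))) ?s1"
  proof (rule wp_add_transitions[where cnt = cnt and W = W and z = z and c = c and l = l])
    show "automaton (st ?s1) z cnt W" unfolding s1(2) by (fact sa)
    show "cnt \<le> cap" using cnt by simp
    show "rg ?s1 vZero = 0" "rg ?s1 vC = c" "c \<le> sg" "rg ?s1 vP = l" "rg ?s1 vQ = st ?s1 l (4 + c)"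
      "l \<in> {1..<cnt}" "W l = z"
      unfolding s1 using regs c l by simp_all
    fix s2 :: ast and p
    let ?q = "?F p (4 + c)"
    let ?t = "if p = 0 then [] else W p @ [c]"
    let ?S = "longer_suffixes ?F z cnt W p"
    let ?F1 = "redirect ?F ?S c cnt"
    assume "extension (st ?s1) z cnt W c p (st ?s1 p (4 + c)) ?t"
      and "rg s2 = (rg ?s1)(vP := p, vQ := st ?s1 p (4 + c))"
      and "st s2 = redirect (st ?s1) (longer_suffixes (st ?s1) z cnt W p) c (rg ?s1 vCur)"
      and "acc s2 = acc ?s1"
      and "tm s2 + 4 * st ?s1 p 2 \<le> tm ?s1 + 5 + 4 * st ?s1 (st ?s1 l 3) 2"
      and "st ?s1 (st ?s1 p 3) 2 \<le> st ?s1 (st ?s1 (st ?s1 l 3) 3) 2"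
    then have ex: "extension ?F z cnt W c p ?q ?t"
      and s2: "rg s2 = (rg s)(vCur := cnt, vCnt := Suc cnt, vP := p, vQ := ?q)"
      "st s2 = ?F1" "acc s2 = acc s"
      and t2: "tm s2 + 4 * ?F p 2 \<le> tm s + 9 + 4 * ?F (?F l 3) 2"
      and pot2: "?F (?F p 3) 2 \<le> ?F (?F (?F l 3) 3) 2"
      unfolding s1 by (simp_all add: fun_eq_iff)
    interpret ex: suffix_automaton_extension z sg cnt W "\<lambda>i. ?F i 2" "\<lambda>i. ?F i 3"
      "\<lambda>i a. ?F i (4 + a)" c p ?q ?t
      by (fact ex)
    let ?s3 = "atom_ex (Ld vU vQ 2) (atom_ex (Plus vT vT vOne) (atom_ex (Ld vT vP 2) s2))"
    have F1: "?F1 i 2 = ?F i 2" "?F1 i 3 = ?F i 3" for i by (auto simp: redirect_def)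
    have pq: "p < cnt" "?q < cnt" "0 < ?q" using ex.p_less ex.q_mem by auto
    have s3: "rg ?s3 = (rg s)(vCur := cnt, vCnt := Suc cnt, vP := p, vQ := ?q, vT := Suc (?F p 2),
        vU := ?F ?q 2)"
      "st ?s3 = ?F1" "acc ?s3 = acc s" "tm ?s3 = tm s2 + 3"
      using s2 F1 regs by (auto simp: fun_eq_iff)
    have plen: "?F p 2 \<le> Suc (length z)"
      using len_eq[of p] ex.length_old[of p] len_bot pq by (cases "p = 0") auto
    have fin: "wp ?fin Q s4"
      if r4: "\<And>v. v \<notin> {vP, vU, vA, vCl, vCnt} \<Longrightarrow> rg s4 v = rg ?s3 v"
        and cnt4: "rg s4 vCnt = cnt'" "cnt' \<le> Suc (Suc cnt)" "cnt < cnt'"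
        and sa4: "\<And>F'. (\<lambda>i. F' i 2) = (\<lambda>i. st s4 i 2)(cnt := Suc (Suc (length z))) \<Longrightarrow>
          (\<lambda>i. F' i 3) = (\<lambda>i. st s4 i 3) \<Longrightarrow> (\<And>i a. F' i (4 + a) = st s4 i (4 + a)) \<Longrightarrow>
          automaton F' (z @ [c]) cnt' W'"
        and W': "W' cnt = z @ [c]"
        and len4: "st s4 l 2 = ?F l 2"
        and k4: "\<And>i k. k < 2 \<Longrightarrow> st s4 i k = ?F i k"
        and acc4: "acc s4 = acc s"
        and lk4: "st s4 cnt 3 = q'" "q' \<noteq> cnt" "st s4 q' 3 = ?F ?q 3" "st s4 q' 2 = Suc (?F p 2)"
        and ln4: "st s4 (?F ?q 3) 2 = ?F (?F ?q 3) 2"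
        and t4: "tm s4 + 4 * ?F (?F ?q 3) 2 \<le> tm ?s3 + 4 * sg + 24 + 4 * ?F (?F p 3) 2"
      for s4 cnt' W' q'
    proof -
      have r: "rg s4 vLast = l" "rg s4 vOne = 1" "rg s4 vCur = cnt"
        using r4[of vLast] r4[of vOne] r4[of vCur] s3(1) regs by (simp_all del: atom_ex.simps)
      let ?s5 = "atom_ex (Mov vLast vCur) (atom_ex (Sto vCur 2 vT) (atom_ex (Plus vT vT vOne)
        (atom_ex (Ld vT vLast 2) s4)))"
      have s5: "rg ?s5 = (rg s4)(vT := Suc (Suc (length z)), vLast := cnt)"
        "st ?s5 = upd (st s4) cnt 2 (Suc (Suc (length z)))" "acc ?s5 = acc s" "tm ?s5 = tm s4 + 4"
        using r len4 lz acc4 by (simp_all add: fun_eq_iff)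
      have lkq: "?F ?q 3 \<noteq> cnt" using lk_less[OF pq(2)] by simp
      have "Q ?s5"
      proof (rule Q)
        show "automaton (st ?s5) (z @ [c]) cnt' W'"
          unfolding s5 by (rule sa4) (auto simp: upd_def fun_eq_iff)
        show "cnt' \<le> Suc (Suc cnt)" by fact
        show "rg ?s5 v = rg s v" if "v \<notin> {vP, vQ, vT, vU, vA, vCur, vCl, vCnt, vLast}" for v
          unfolding s5 using that r4[of v] s3(1) by (simp del: atom_ex.simps)
        show "rg ?s5 vLast = cnt" "rg ?s5 vCnt = cnt'" unfolding s5 using cnt4 by simp_all
        show "cnt \<in> {1..<cnt'}" using cnt4 pq by auto
        show "W' cnt = z @ [c]" by fact
        show "st ?s5 i k = ?F i k" if "k < 2" for i k
          unfolding s5 using that k4 by (simp add: upd_def)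
        show "acc ?s5 = acc s" by (fact s5(3))
        have "st ?s5 cnt 3 = q'" "st ?s5 q' 3 = ?F ?q 3" "st ?s5 q' 2 = Suc (?F p 2)"
          "st ?s5 (?F ?q 3) 2 = ?F (?F ?q 3) 2"
          unfolding s5 using lk4 ln4 lkq by (simp_all add: upd_def)
        then have "pot (st ?s5) cnt = Suc (?F p 2) + ?F (?F ?q 3) 2" by (simp only: pot_def)
        then show "tm ?s5 + 4 * pot (st ?s5) cnt \<le> tm s + 4 * pot ?F l + 4 * sg + 50"
          using t4 s3(4) t2 pot2 unfolding s5(4) by (simp add: pot_def del: atom_ex.simps)
      qed
      then show ?thesis unfolding wp_simps using r len4 lz cz l cnt pq by simp
    qed
    have "wp ?if (wp ?fin Q) ?s3"
    proof (cases "?F ?q 2 = Suc (?F p 2)")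
      case True
      let ?s4 = "atom_ex (Sto vCur 3 vQ) (tick ?s3)"
      have s4: "rg ?s4 = rg ?s3" "st ?s4 = upd ?F1 cnt 3 ?q" "acc ?s4 = acc s" "tm ?s4 = tm ?s3 + 2"
        using s3 by (simp_all del: atom_ex.simps(1-6,8-))
      have "wp ?fin Q ?s4"
      proof (rule fin[where cnt' = "Suc cnt" and q' = ?q])
        show "rg ?s4 v = rg ?s3 v" for v using s4(1) by simp
        show "rg ?s4 vCnt = Suc cnt" unfolding s4 s3 by simp
        show "automaton F' (z @ [c]) (Suc cnt) (W(cnt := z @ [c]))"
          if F': "(\<lambda>i. F' i 2) = (\<lambda>i. st ?s4 i 2)(cnt := Suc (Suc (length z)))"
          "(\<lambda>i. F' i 3) = (\<lambda>i. st ?s4 i 3)" "\<And>i a. F' i (4 + a) = st ?s4 i (4 + a)" for F'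
        proof (rule ex.extend_unsplit[OF True])
          show "(\<lambda>i. F' i 2) = (\<lambda>i. ?F i 2)(cnt := Suc (Suc (length z)))"
            unfolding F' s4 by (auto simp: upd_def redirect_def)
          show "(\<lambda>i. F' i 3) = (\<lambda>i. ?F i 3)(cnt := ?q)"
            unfolding F' s4 by (auto simp: upd_def redirect_def)
          show "F' i (4 + a) = (if a = c \<and> i \<in> {1..<cnt} \<and> suffix (W i) z \<and> ?F p 2 < ?F i 2
            then cnt else ?F i (4 + a))" if "a \<le> sg" for i a
            unfolding F' s4 by (auto simp: upd_def redirect_def longer_suffixes_def)
        qed
        show "st ?s4 l 2 = ?F l 2" unfolding s4 using F1 by (simp add: upd_def)
        show "st ?s4 i k = ?F i k" if "k < 2" for i k
          unfolding s4 using that by (simp add: upd_def redirect_def)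
        show "acc ?s4 = acc s" by (fact s4)
        show "st ?s4 cnt 3 = ?q" unfolding s4 by (simp add: upd_def)
        show "?q \<noteq> cnt" using pq by simp
        show "st ?s4 ?q 3 = ?F ?q 3" "st ?s4 ?q 2 = Suc (?F p 2)"
          unfolding s4 using pq F1 True by (simp_all add: upd_def)
        show "st ?s4 (?F ?q 3) 2 = ?F (?F ?q 3) 2" unfolding s4 using F1 by (simp add: upd_def)
        show "tm ?s4 + 4 * ?F (?F ?q 3) 2 \<le> tm ?s3 + 4 * sg + 24 + 4 * ?F (?F p 3) 2"
          unfolding s4 using ex.len_lk_q_le_unsplit by simp
      qed simp_all
      then show ?thesis
        unfolding wp_Branch wp_Atom using s3(1) True cnt by (simp del: atom_ex.simps)
    next
      case False
      have "wp split (wp ?fin Q) (tick ?s3)"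
      proof (rule wp_split[OF ex _ False cnt])
        show "st (tick ?s3) = ?F1" using s3(2) by simp
        show "rg (tick ?s3) vC = c" "rg (tick ?s3) vP = p" "rg (tick ?s3) vQ = ?q"
          "rg (tick ?s3) vT = Suc (?F p 2)" "rg (tick ?s3) vCur = cnt" "rg (tick ?s3) vCnt = Suc cnt"
          "rg (tick ?s3) vOne = 1" "rg (tick ?s3) vSg1 = Suc sg"
          unfolding tick_sel s3(1) using regs by simp_all
        fix s4 :: ast
        assume s4: "\<And>v. v \<notin> {vP, vU, vA, vCl, vCnt} \<Longrightarrow> rg s4 v = rg (tick ?s3) v"
          "rg s4 vCnt = Suc (Suc cnt)"
          "(\<lambda>i. st s4 i 2) = (\<lambda>i. ?F i 2)(Suc cnt := Suc (?F p 2))"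
          "(\<lambda>i. st s4 i 3) = (\<lambda>i. ?F i 3)(cnt := Suc cnt, ?q := Suc cnt, Suc cnt := ?F ?q 3)"
          "\<And>i a. a \<le> sg \<Longrightarrow> st s4 i (4 + a) =
            (let d1 = (\<lambda>i. if a = c \<and> i \<in> {1..<cnt} \<and> suffix (W i) z \<and> ?F p 2 < ?F i 2 then cnt else ?F i (4 + a))
             in if i = Suc cnt then d1 ?q
                else if a = c \<and> i \<in> {1..<cnt} \<and> suffix (W i) z \<and> ?F i 2 \<le> ?F p 2 \<and> ?F i (4 + c) = ?q then Suc cnt
                else d1 i)"
          "\<And>i k. k < 2 \<Longrightarrow> st s4 i k = ?F i k" "acc s4 = acc (tick ?s3)"
          "tm s4 + 4 * ?F (?F ?q 3) 2 \<le> tm (tick ?s3) + 4 * sg + 23 + 4 * ?F (?F p 3) 2"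
        have len4: "st s4 i 2 = ((\<lambda>i. ?F i 2)(Suc cnt := Suc (?F p 2))) i" for i
          using fun_cong[OF s4(3), of i] .
        have lk4: "st s4 i 3 = ((\<lambda>i. ?F i 3)(cnt := Suc cnt, ?q := Suc cnt, Suc cnt := ?F ?q 3)) i" for i
          using fun_cong[OF s4(4), of i] .
        show "wp ?fin Q s4"
        proof (rule fin[where cnt' = "Suc (Suc cnt)" and q' = "Suc cnt"])
          show "rg s4 v = rg ?s3 v" if "v \<notin> {vP, vU, vA, vCl, vCnt}" for v
            using s4(1)[OF that] by simp
          show "rg s4 vCnt = Suc (Suc cnt)" by fact
          show "automaton F' (z @ [c]) (Suc (Suc cnt)) (W(cnt := z @ [c], Suc cnt := ?t))"
            if F': "(\<lambda>i. F' i 2) = (\<lambda>i. st s4 i 2)(cnt := Suc (Suc (length z)))"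
            "(\<lambda>i. F' i 3) = (\<lambda>i. st s4 i 3)" "\<And>i a. F' i (4 + a) = st s4 i (4 + a)" for F'
          proof (rule ex.extend_split[OF False])
            show "(\<lambda>i. F' i 2) = (\<lambda>i. ?F i 2)(cnt := Suc (Suc (length z)), Suc cnt := Suc (?F p 2))"
              unfolding F' s4(3) by auto
            show "(\<lambda>i. F' i 3) = (\<lambda>i. ?F i 3)(cnt := Suc cnt, ?q := Suc cnt, Suc cnt := ?F ?q 3)"
              unfolding F' s4(4) ..
          qed (simp only: F' s4(5))
          show "st s4 l 2 = ?F l 2" using len4[of l] l by simp
          show "st s4 i k = ?F i k" if "k < 2" for i k using s4(6)[OF that] .
          show "acc s4 = acc s" using s4(7) s3(3) by (simp del: atom_ex.simps)
          show "st s4 cnt 3 = Suc cnt" "st s4 (Suc cnt) 3 = ?F ?q 3" using lk4 pq by simp_all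
          show "st s4 (Suc cnt) 2 = Suc (?F p 2)" using len4 by simp
          show "st s4 (?F ?q 3) 2 = ?F (?F ?q 3) 2" using len4 lk_less[OF pq(2)] by simp
          show "tm s4 + 4 * ?F (?F ?q 3) 2 \<le> tm ?s3 + 4 * sg + 24 + 4 * ?F (?F p 3) 2"
            using s4(8) by (simp del: atom_ex.simps)
        qed simp_all
      qed
      then show ?thesis
        unfolding wp_Branch using s3(1) False by (simp del: atom_ex.simps)
    qed
    then show "wp ?mid (wp ?if (wp ?fin Q)) s2"
      unfolding wp_Seq wp_Atom using s2 pq cnt F1 plen cz regs by simp
  qed
  then show ?thesis
    unfolding extend_def wp_Seq[of "Atom _ ;; Atom _ ;; Atom _ ;; Atom _"] wp_Seq[of add_transitions]
      wp_Seq[of ?mid] wp_Seq[of ?if]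
    by (rule ok1)
qed

definition consts_ok :: "ast \<Rightarrow> bool" where
  "consts_ok s \<longleftrightarrow> rg s vZero = 0 \<and> rg s vOne = 1 \<and> rg s vSg = sg \<and> rg s vSg1 = Suc sg \<and>
     rg s vM = length x \<and> rg s vN = length y \<and> rg s vEnd = Suc (length inp)"

lemma length_inp: "length inp = length x + length y"
  by (simp add: inp_eq)

lemma inp_lim: "length x + length y + 5 < lim"
  using lim_bounds(2) cap_eq length_inp by linarith

lemma wp_init:
  assumes s: "rg s = (\<lambda>_. 0)(vM := length x, vN := length y)" "st s = (\<lambda>_ _. 0)" "acc s = 0" "tm s = 0"
    and Q: "\<And>s'. consts_ok s' \<Longrightarrow> rg s' vI = 0 \<Longrightarrow> rg s' vJ = 0 \<Longrightarrow> rg s' vLast = 1 \<Longrightarrow>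
      rg s' vCnt = 2 \<Longrightarrow> automaton (st s') [] 2 (\<lambda>_. []) \<Longrightarrow> (\<And>i k. k < 2 \<Longrightarrow> st s' i k = 0) \<Longrightarrow>
      pot (st s') 1 = 0 \<Longrightarrow> acc s' = 0 \<Longrightarrow> tm s' = 3 * sg + 13 \<Longrightarrow> Q s'"
  shows "wp (init sg) Q s"
proof -
  let ?r = "\<lambda>a. (\<lambda>_. 0)(vM := length x, vN := length y, vOne := 1, vSg := sg, vSg1 := Suc sg,
    vEnd := Suc (length inp), vLast := 1, vCnt := 2, vA := a)"
  let ?F = "\<lambda>a i k. if i = 0 \<and> 4 \<le> k \<and> k < 4 + a \<or> i = 1 \<and> k = 2 then 1 else 0"
  let ?I = "\<lambda>a s'. a \<le> Suc sg \<and> rg s' = ?r a \<and> st s' = ?F a \<and> acc s' = 0 \<and> tm s' = 3 * a + 9"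
  have cap1: "1 < cap" "0 < cap" using cap_eq by auto
  have "wp (While True Less vA vSg1 (Atom (StoX vZero vA vOne) ;; Atom (Plus vA vA vOne))) Q s'"
    if "\<exists>a. ?I a s'" for s'
  proof (rule wp_While[where I = "\<lambda>s'. \<exists>a. ?I a s'" and \<mu> = "\<lambda>s'. Suc sg - rg s' vA"])
    fix s' assume "\<exists>a. ?I a s'" and t: "test Less vA vSg1 s' = True"
    then obtain a where I: "?I a s'" by blast
    then have a: "a \<le> sg" using t by simp
    let ?s2 = "atom_ex (Plus vA vA vOne) (atom_ex (StoX vZero vA vOne) (tick s'))"
    have "?I (Suc a) ?s2" using I a by (auto simp: upd_def fun_eq_iff)
    then have "\<exists>a. ?I a ?s2" by (rule exI[of _ "Suc a"])
    moreover have "Suc sg - rg ?s2 vA < Suc sg - rg s' vA" using I a by simp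
    moreover have "atom_ok (StoX vZero vA vOne) (tick s')"
      "atom_ok (Plus vA vA vOne) (atom_ex (StoX vZero vA vOne) (tick s'))"
      using I a cap1 lim_bounds by simp_all
    ultimately show "wp (Atom (StoX vZero vA vOne) ;; Atom (Plus vA vA vOne))
      (\<lambda>s''. (\<exists>a. ?I a s'') \<and> Suc sg - rg s'' vA < Suc sg - rg s' vA) (tick s')"
      unfolding wp_simps by blast
  next
    fix s' assume "\<exists>a. ?I a s'" and t: "test Less vA vSg1 s' \<noteq> True"
    then obtain a where I: "?I a s'" by blast
    then have a: "a = Suc sg" using t by simp
    have F: "st (tick s') = ?F (Suc sg)" and r: "rg (tick s') = ?r (Suc sg)" using I a by simp_all
    show "Q (tick s')"
    proof (rule Q)
      show "automaton (st (tick s')) [] 2 (\<lambda>_. [])"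
        unfolding F by (rule suffix_automaton_Nil) auto
      show "consts_ok (tick s')" unfolding consts_ok_def r by simp
      show "rg (tick s') vI = 0" "rg (tick s') vJ = 0" "rg (tick s') vLast = 1" "rg (tick s') vCnt = 2"
        unfolding r by simp_all
      show "st (tick s') i k = 0" if "k < 2" for i k unfolding F using that by simp
      show "pot (st (tick s')) 1 = 0" unfolding F pot_def by simp
      show "acc (tick s') = 0" "tm (tick s') = 3 * sg + 13" using I a by simp_all
    qed
  qed (fact that)
  moreover
  let ?s1 = "atom_ex (SetC vA 0) (atom_ex (SetC vCnt 2) (atom_ex (Mov vLast vOne)
    (atom_ex (Sto vOne 2 vOne) (atom_ex (Plus vEnd vEnd vOne) (atom_ex (Plus vEnd vM vN)
    (atom_ex (SetC vSg1 (Suc sg)) (atom_ex (SetC vSg sg) (atom_ex (SetC vOne 1) s))))))))"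
  have "?I 0 ?s1" using s length_inp by (auto simp: upd_def fun_eq_iff)
  then have "\<exists>a. ?I a ?s1" by (rule exI[of _ 0])
  ultimately have "wp (While True Less vA vSg1 (Atom (StoX vZero vA vOne) ;; Atom (Plus vA vA vOne))) Q ?s1"
    by blast
  then show ?thesis
    unfolding init_def wp_Seq wp_Atom using s lim_bounds length_inp cap1 inp_lim by simp
qed

definition joined :: "nat list" where
  "joined = x @ [sg] @ y"

lemma length_joined: "length joined = Suc (length inp)"
  by (simp add: joined_def inp_eq)

lemma joined_nth:
  assumes "i < length joined"
  shows "joined ! i = (if i = length x then sg else inp ! (if i \<le> length x then i else i - 1))"
  using assms by (auto simp: joined_def inp_eq nth_append nth_Cons')

lemma joined_le: "i < length joined \<Longrightarrow> joined ! i \<le> sg"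
proof -
  assume "i < length joined"
  then have "joined ! i \<in> set joined" by simp
  then show ?thesis using x_lists y_lists by (fastforce simp: joined_def)
qed

lemma wp_build:
  assumes "consts_ok s" "rg s vI = 0" "rg s vJ = 0" "rg s vLast = 1" "rg s vCnt = 2"
    "automaton (st s) [] 2 (\<lambda>_. [])" "\<And>i k. k < 2 \<Longrightarrow> st s i k = 0" "pot (st s) 1 = 0" "acc s = 0"
    and Q: "\<And>s' cnt W. consts_ok s' \<Longrightarrow> automaton (st s') joined cnt W \<Longrightarrow> cnt < cap \<Longrightarrow>
      rg s' vCnt = cnt \<Longrightarrow> (\<And>i k. k < 2 \<Longrightarrow> st s' i k = 0) \<Longrightarrow> acc s' = 0 \<Longrightarrow>
      tm s' \<le> tm s + 1 + (4 * sg + 55) * Suc (length inp) \<Longrightarrow> Q s'"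
  shows "wp build Q s"
proof -
  let ?J = "\<lambda>i. if i \<le> length x then i else i - 1"
  let ?I = "\<lambda>i cnt W l s'. i \<le> length joined \<and> consts_ok s' \<and> rg s' vI = i \<and> rg s' vJ = ?J i \<and>
    rg s' vLast = l \<and> l \<in> {1..<cnt} \<and> W l = take i joined \<and> rg s' vCnt = cnt \<and> cnt \<le> 2 * i + 2 \<and>
    automaton (st s') (take i joined) cnt W \<and> (\<forall>i k. k < 2 \<longrightarrow> st s' i k = 0) \<and> acc s' = 0 \<and>
    tm s' + 4 * pot (st s') l \<le> tm s + (4 * sg + 55) * i"
  let ?fetch = "Branch Eq vI vM (Atom (Mov vC vSg)) (Atom (Inp vC vJ) ;; Atom (Plus vJ vJ vOne))"
  show ?thesis unfolding build_def
  proof (rule wp_While[where I = "\<lambda>s'. \<exists>i cnt W l. ?I i cnt W l s'" and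
        \<mu> = "\<lambda>s'. length joined - rg s' vI"])
    have "?I 0 2 (\<lambda>_. []) 1 s" using assms(1-9) by simp
    then show "\<exists>i cnt W l. ?I i cnt W l s"
      by (intro exI[of _ 0] exI[of _ 2] exI[of _ "\<lambda>_. []"] exI[of _ 1])
  next
    fix s' assume "\<exists>i cnt W l. ?I i cnt W l s'" and t: "test Less vI vEnd s' = True"
    then obtain i cnt W l where I: "?I i cnt W l s'" by blast
    then have c: "consts_ok s'" and rI: "rg s' vI = i" and rJ: "rg s' vJ = ?J i" by blast+
    have i: "i < length joined" using t c rI by (simp add: consts_ok_def length_joined)
    have tk: "take (Suc i) joined = take i joined @ [joined ! i]" by (rule take_Suc_conv_app_nth[OF i])
    have J: "?J i < length inp" if "i \<noteq> length x" using that i by (auto simp: length_joined inp_eq)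
    have fetch: "wp ?fetch P (tick s')"
      if P: "\<And>s2. (\<And>v. v \<notin> {vC, vJ} \<Longrightarrow> rg s2 v = rg s' v) \<Longrightarrow> rg s2 vC = joined ! i \<Longrightarrow>
        rg s2 vJ = ?J (Suc i) \<Longrightarrow> st s2 = st s' \<Longrightarrow> acc s2 = acc s' \<Longrightarrow> tm s2 \<le> tm s' + 4 \<Longrightarrow> P s2" for P
    proof (cases "i = length x")
      case True
      let ?s2 = "atom_ex (Mov vC vSg) (tick (tick s'))"
      have "P ?s2" by (rule P) (use True c rI rJ joined_nth[OF i] in \<open>auto simp: consts_ok_def\<close>)
      then show ?thesis using True c rI by (simp add: wp_simps consts_ok_def del: atom_ex.simps)
    next
      case False
      let ?s2 = "atom_ex (Plus vJ vJ vOne) (atom_ex (Inp vC vJ) (tick (tick s')))"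
      have "P ?s2" by (rule P) (use False c rI rJ joined_nth[OF i] in \<open>auto simp: consts_ok_def\<close>)
      moreover have "length inp + 1 < lim" using lim_bounds cap_eq by linarith
      ultimately show ?thesis using False c rI rJ J[OF False]
        by (simp add: wp_simps consts_ok_def del: atom_ex.simps) (simp add: consts_ok_def)
    qed
    have "wp ?fetch (wp extend (wp (Atom (Plus vI vI vOne))
      (\<lambda>s''. (\<exists>i cnt W l. ?I i cnt W l s'') \<and> length joined - rg s'' vI < length joined - rg s' vI))) (tick s')"
    proof (rule fetch)
      fix s2 :: ast
      assume s2: "\<And>v. v \<notin> {vC, vJ} \<Longrightarrow> rg s2 v = rg s' v" "rg s2 vC = joined ! i" "rg s2 vJ = ?J (Suc i)"
        "st s2 = st s'" "acc s2 = acc s'" "tm s2 \<le> tm s' + 4"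
      have c2: "consts_ok s2" using c s2(1) by (simp add: consts_ok_def)
      have ib: "i \<le> length inp" using i by (simp add: length_joined)
      show "wp extend (wp (Atom (Plus vI vI vOne))
        (\<lambda>s''. (\<exists>i cnt W l. ?I i cnt W l s'') \<and> length joined - rg s'' vI < length joined - rg s' vI)) s2"
      proof (rule wp_extend[where z = "take i joined" and cnt = cnt and W = W and c = "joined ! i" and l = l])
        show "automaton (st s2) (take i joined) cnt W" using I s2(4) by simp
        show "Suc (Suc cnt) \<le> cap" using I ib cap_eq by linarith
        show "length (take i joined) + 2 < lim" using ib lim_bounds cap_eq by simp
        show "rg s2 vZero = 0" "rg s2 vOne = 1" "rg s2 vSg1 = Suc sg"
          using c2 by (simp_all add: consts_ok_def)
        show "rg s2 vC = joined ! i" by fact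
        show "rg s2 vLast = l" "rg s2 vCnt = cnt" using I s2(1) by simp_all
        show "joined ! i \<le> sg" using joined_le i by blast
        show "l \<in> {1..<cnt}" "W l = take i joined" using I by blast+
        fix s3 :: ast and cnt' W' l'
        assume s3: "automaton (st s3) (take i joined @ [joined ! i]) cnt' W'" "cnt' \<le> Suc (Suc cnt)"
          "\<And>v. v \<notin> {vP, vQ, vT, vU, vA, vCur, vCl, vCnt, vLast} \<Longrightarrow> rg s3 v = rg s2 v"
          "rg s3 vLast = l'" "l' \<in> {1..<cnt'}" "W' l' = take i joined @ [joined ! i]" "rg s3 vCnt = cnt'"
          "\<And>i k. k < 2 \<Longrightarrow> st s3 i k = st s2 i k" "acc s3 = acc s2"
          "tm s3 + 4 * pot (st s3) l' \<le> tm s2 + 4 * pot (st s2) l + 4 * sg + 50"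
        let ?s4 = "atom_ex (Plus vI vI vOne) s3"
        have r3: "rg s3 vI = i" "rg s3 vOne = 1" "rg s3 vJ = ?J (Suc i)"
          using s3(3) s2(1,3) rI c2 by (simp_all add: consts_ok_def)
        have "consts_ok ?s4" using c2 s3(3) by (simp add: consts_ok_def)
        moreover have "tm ?s4 + 4 * pot (st ?s4) l' \<le> tm s + (4 * sg + 55) * Suc i"
        proof -
          have "tm s' + 4 * pot (st s') l \<le> tm s + (4 * sg + 55) * i" using I by blast
          then show ?thesis using s3(10) s2(4,6) by simp
        qed
        ultimately have "?I (Suc i) cnt' W' l' ?s4"
          using i I s3 s2 r3 tk by (simp add: joined_def[symmetric])
        then have "\<exists>i cnt W l. ?I i cnt W l ?s4" by blast
        moreover have "length joined - rg ?s4 vI < length joined - rg s' vI" using r3 rI i by simp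
        moreover have "atom_ok (Plus vI vI vOne) s3" using r3 ib inp_lim length_inp by simp
        ultimately show "wp (Atom (Plus vI vI vOne))
          (\<lambda>s''. (\<exists>i cnt W l. ?I i cnt W l s'') \<and> length joined - rg s'' vI < length joined - rg s' vI) s3"
          unfolding wp_Atom by blast
      qed
    qed
    then show "wp (?fetch ;; extend ;; Atom (Plus vI vI vOne))
      (\<lambda>s''. (\<exists>i cnt W l. ?I i cnt W l s'') \<and> length joined - rg s'' vI < length joined - rg s' vI) (tick s')"
      unfolding wp_Seq[of ?fetch] wp_Seq[of extend] .
  next
    fix s' assume "\<exists>i cnt W l. ?I i cnt W l s'" and t: "test Less vI vEnd s' \<noteq> True"
    then obtain i cnt W l where I: "?I i cnt W l s'" by blast
    then have i: "i = length joined" using t by (simp add: consts_ok_def length_joined)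
    show "Q (tick s')"
    proof (rule Q)
      show "consts_ok (tick s')" using I by (simp add: consts_ok_def)
      show "automaton (st (tick s')) joined cnt W" using I i by simp
      show "cnt < cap" using I i cap_eq by (simp add: length_joined)
      show "tm (tick s') \<le> tm s + 1 + (4 * sg + 55) * Suc (length inp)"
      proof -
        have "tm s' + 4 * pot (st s') l \<le> tm s + (4 * sg + 55) * i" using I by blast
        then show ?thesis unfolding i length_joined by simp
      qed
    qed (use I in auto)
  qed
qed

end

section \<open>Marking factors and summing up\<close>

definition mark_up :: "nat \<Rightarrow> com" where
  "mark_up k = While True Eq vT vZero
     (Atom (Sto vQ k vOne) ;; Atom (Ld vQ vQ 3) ;; Atom (Ld vT vQ k))"

definition mark :: "nat \<Rightarrow> nat \<Rightarrow> com" where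
  "mark k v = (Atom (Mov vP vOne) ;; Atom (Sto vP k vOne) ;; Atom (SetC vI 0)) ;;
     While True Less vI v
       ((Atom (Inp vC vJ) ;; Atom (Plus vJ vJ vOne) ;; Atom (LdX vP vP vC) ;; Atom (Mov vQ vP) ;;
         Atom (Ld vT vQ k)) ;; mark_up k ;; Atom (Plus vI vI vOne))"

context lw_machine
begin

definition marked :: "(nat \<Rightarrow> nat \<Rightarrow> nat) \<Rightarrow> nat \<Rightarrow> nat set \<Rightarrow> nat \<Rightarrow> nat \<Rightarrow> nat" where
  "marked F k M = (\<lambda>i k'. if k' = k \<and> i \<in> M then 1 else F i k')"

lemma upd_marked: "upd (marked F k M) i k 1 = marked F k (insert i M)"
  by (auto simp: marked_def upd_def fun_eq_iff)

lemma wp_mark_up: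
  assumes sa: "automaton F z cnt W"
    and F: "\<And>i. F i k = 0" and k: "k < 2" and cnt: "cnt < cap"
    and st: "st s = marked F k M" and M: "M \<subseteq> {1..<cnt}" "1 \<in> M" "\<And>j. j \<in> M \<Longrightarrow> j \<noteq> 1 \<Longrightarrow> F j 3 \<in> M"
    and N: "M \<subseteq> N" "\<And>j. j \<in> N \<Longrightarrow> j \<noteq> 1 \<Longrightarrow> F j 3 \<in> N" "p \<in> N"
    and p: "p \<in> {1..<cnt}"
    and regs: "rg s vZero = 0" "rg s vOne = 1" "rg s vQ = p" "rg s vT = marked F k M p k"
    and Q: "\<And>s' M' q t. rg s' = (rg s)(vQ := q, vT := t) \<Longrightarrow> st s' = marked F k M' \<Longrightarrow>
      M' \<subseteq> {1..<cnt} \<Longrightarrow> M \<subseteq> M' \<Longrightarrow> p \<in> M' \<Longrightarrow> M' \<subseteq> N \<Longrightarrow> (\<And>j. j \<in> M' \<Longrightarrow> j \<noteq> 1 \<Longrightarrow> F j 3 \<in> M') \<Longrightarrow>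
      acc s' = acc s \<Longrightarrow> tm s' + 4 * card M = tm s + 4 * card M' + 1 \<Longrightarrow> Q s'"
  shows "wp (mark_up k) Q s"
proof -
  interpret suffix_automaton z sg cnt W "\<lambda>i. F i 2" "\<lambda>i. F i 3" "\<lambda>i a. F i (4 + a)"
    by (fact sa)
  have kR: "k < R" using k R_eq by simp
  let ?I = "\<lambda>M' q s'. M' \<subseteq> {1..<cnt} \<and> M \<subseteq> M' \<and> M' \<subseteq> N \<and> q \<in> {1..<cnt} \<and> q \<in> N \<and> (p = q \<or> p \<in> M') \<and>
    (\<forall>j\<in>M'. j \<noteq> 1 \<longrightarrow> F j 3 \<in> M' \<or> F j 3 = q) \<and>
    rg s' = (rg s)(vQ := q, vT := marked F k M' q k) \<and> st s' = marked F k M' \<and> acc s' = acc s \<and>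
    tm s' + 4 * card M = tm s + 4 * card M'"
  show ?thesis unfolding mark_up_def
  proof (rule wp_While[where I = "\<lambda>s'. \<exists>M' q. ?I M' q s'" and \<mu> = "\<lambda>s'. F (rg s' vQ) 2"])
    have "rg s = (rg s)(vQ := p, vT := marked F k M p k)" using regs by auto
    then have "?I M p s" using M N st p by auto
    then show "\<exists>M' q. ?I M' q s" by (intro exI[of _ M] exI[of _ p])
  next
    fix s' assume "\<exists>M' q. ?I M' q s'" and t: "test Eq vT vZero s' = True"
    then obtain M' q where I: "?I M' q s'" by blast
    then have q: "q \<in> {1..<cnt}" "q \<in> N"
      and rs: "rg s' = (rg s)(vQ := q, vT := marked F k M' q k)" "st s' = marked F k M'" "acc s' = acc s"
      by blast+
    have qM: "q \<notin> M'" using t rs regs by (auto simp: marked_def split: if_splits)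
    then have q1: "q \<noteq> 1" using I M by blast
    then have q2: "q \<in> {2..<cnt}" using q by auto
    let ?q = "F q 3" and ?M = "insert q M'"
    have q': "?q \<in> {1..<cnt}" using lk_mem q2 by blast
    let ?s1 = "atom_ex (Sto vQ k vOne) (tick s')"
    let ?s3 = "atom_ex (Ld vT vQ k) (atom_ex (Ld vQ vQ 3) ?s1)"
    have m3: "marked F k ?M i 3 = F i 3" for i using k by (simp add: marked_def)
    have s1: "st ?s1 = marked F k ?M" "rg ?s1 = rg s'" "acc ?s1 = acc s" "tm ?s1 = tm s' + 2"
      using rs regs by (simp_all add: upd_marked[unfolded One_nat_def])
    have s3: "rg ?s3 = (rg s)(vQ := ?q, vT := marked F k ?M ?q k)" "st ?s3 = marked F k ?M"
      "acc ?s3 = acc s" "tm ?s3 = tm s' + 4"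
      using s1 rs m3 by (simp_all del: atom_ex.simps(7))
    have fin: "finite M'" using I finite_subset by blast
    have "?I ?M ?q ?s3"
    proof -
      have "\<forall>j\<in>?M. j \<noteq> 1 \<longrightarrow> F j 3 \<in> ?M \<or> F j 3 = ?q" using I by blast
      moreover have "tm ?s3 + 4 * card M = tm s + 4 * card ?M"
        using I qM fin unfolding s3(4) by simp
      moreover have "?q \<in> N" using N q q1 by blast
      ultimately show ?thesis using I q q' s3(1-3) by blast
    qed
    then have "\<exists>M' q. ?I M' q ?s3" by (intro exI[of _ ?M] exI[of _ ?q])
    moreover have "F (rg ?s3 vQ) 2 < F (rg s' vQ) 2" using s3(1) rs len_lk_less[OF q(1)] by simp
    moreover have "atom_ok (Sto vQ k vOne) (tick s')" "atom_ok (Ld vQ vQ 3) ?s1"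
      "atom_ok (Ld vT vQ k) (atom_ex (Ld vQ vQ 3) ?s1)"
      using s1 rs m3 q q' cnt kR by (simp_all del: atom_ex.simps(7))
    ultimately show "wp (Atom (Sto vQ k vOne) ;; Atom (Ld vQ vQ 3) ;; Atom (Ld vT vQ k))
      (\<lambda>s''. (\<exists>M' q. ?I M' q s'') \<and> F (rg s'' vQ) 2 < F (rg s' vQ) 2) (tick s')"
      unfolding wp_simps by blast
  next
    fix s' assume "\<exists>M' q. ?I M' q s'" and t: "test Eq vT vZero s' \<noteq> True"
    then obtain M' q where I: "?I M' q s'" by blast
    then have rs: "rg s' = (rg s)(vQ := q, vT := marked F k M' q k)" by blast
    have qM: "q \<in> M'" using t rs regs F by (auto simp: marked_def split: if_splits)
    show "Q (tick s')"
      by (rule Q[of _ q "marked F k M' q k" M']) (use I qM in auto)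
  qed
qed

lemma wp_mark:
  assumes occ: "suffix_automaton_occurrence z sg cnt W (\<lambda>i. F i 2) (\<lambda>i. F i 3) (\<lambda>i a. F i (4 + a)) A X B"
    and F: "\<And>i. F i k = 0" and k: "k < 2" and cnt: "cnt < cap"
    and st: "st s = F"
    and inp: "\<And>i. i < length X \<Longrightarrow> inp ! (off + i) = X ! i" "off + length X \<le> length inp"
    and regs: "rg s vZero = 0" "rg s vOne = 1" "rg s v = length X" "rg s vJ = off"
    and v: "v \<notin> {vI, vJ, vC, vP, vQ, vT}"
    and Q: "\<And>s'. (\<And>v. v \<notin> {vI, vJ, vC, vP, vQ, vT} \<Longrightarrow> rg s' v = rg s v) \<Longrightarrow>
      rg s' vJ = off + length X \<Longrightarrow>
      st s' = marked F k (suffix_automaton.marks z cnt W X) \<Longrightarrow> acc s' = acc s \<Longrightarrow>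
      tm s' \<le> tm s + 4 + 4 * cnt + 8 * length X \<Longrightarrow> Q s'"
  shows "wp (mark k v) Q s"
proof -
  interpret suffix_automaton_occurrence z sg cnt W "\<lambda>i. F i 2" "\<lambda>i. F i 3" "\<lambda>i a. F i (4 + a)" A X B
    by (fact occ)
  have sa: "automaton F z cnt W" by unfold_locales
  have kR: "k < R" using k R_eq by simp
  have marks_lk: "F j 3 \<in> marks X" if jm: "j \<in> marks X" "j \<noteq> 1" for j
  proof -
    have j: "j \<in> {2..<cnt}" using jm by (auto simp: marks_def)
    obtain i p where "i \<le> length X" "p \<in> {1..<cnt}" "endpos z (W p) = endpos z (take i X)"
      "suffix (W j) (W p)" using jm(1) unfolding marks_def by blast
    moreover have "suffix (W (F j 3)) (W p)"
      using lk_strict[OF j] calculation(4) by (metis suffix_order.less_imp_le suffix_order.trans)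
    ultimately show ?thesis using lk_mem[OF j] unfolding marks_def by blast
  qed
  have root: "1 \<in> {1..<cnt}" using cnt_ge by auto
  let ?I = "\<lambda>i M p s'. i \<le> length X \<and> M \<subseteq> {1..<cnt} \<and> 1 \<in> M \<and> M \<subseteq> marks X \<and>
    (\<forall>j\<in>M. j \<noteq> 1 \<longrightarrow> F j 3 \<in> M) \<and>
    (\<forall>i'\<le>i. \<exists>p\<in>M. endpos z (W p) = endpos z (take i' X)) \<and>
    p \<in> {1..<cnt} \<and> endpos z (W p) = endpos z (take i X) \<and>
    (\<forall>v. v \<notin> {vI, vJ, vC, vP, vQ, vT} \<longrightarrow> rg s' v = rg s v) \<and>
    rg s' vI = i \<and> rg s' vJ = off + i \<and> rg s' vP = p \<and> st s' = marked F k M \<and> acc s' = acc s \<and>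
    tm s' \<le> tm s + 3 + 4 * card M + 8 * i"
  let ?body = "Atom (Inp vC vJ) ;; Atom (Plus vJ vJ vOne) ;; Atom (LdX vP vP vC) ;; Atom (Mov vQ vP) ;;
         Atom (Ld vT vQ k)"
  have loop: "wp (While True Less vI v (?body ;; mark_up k ;; Atom (Plus vI vI vOne))) Q s0"
    if "\<exists>i M p. ?I i M p s0" for s0
  proof (rule wp_While[where I = "\<lambda>s'. \<exists>i M p. ?I i M p s'" and \<mu> = "\<lambda>s'. length X - rg s' vI"])
    fix s' assume "\<exists>i M p. ?I i M p s'" and t: "test Less vI v s' = True"
    then obtain i M p where I: "?I i M p s'" by blast
    then have rs: "\<And>v. v \<notin> {vI, vJ, vC, vP, vQ, vT} \<Longrightarrow> rg s' v = rg s v" "rg s' vI = i"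
      "rg s' vJ = off + i" "rg s' vP = p" "st s' = marked F k M" "acc s' = acc s"
      and p: "p \<in> {1..<cnt}" "endpos z (W p) = endpos z (take i X)"
      and M: "M \<subseteq> {1..<cnt}" "1 \<in> M" "M \<subseteq> marks X" "\<And>j. j \<in> M \<Longrightarrow> j \<noteq> 1 \<Longrightarrow> F j 3 \<in> M"
      by blast+
    have i: "i < length X" using t rs regs v by simp
    let ?c = "X ! i"
    have c: "?c \<le> sg" using X_lists i by (auto simp: in_lists_conv_set nth_mem less_imp_le)
    have tk: "take (Suc i) X = take i X @ [?c]" by (rule take_Suc_conv_app_nth[OF i])
    let ?p = "F p (4 + ?c)"
    have e: "endpos z (W p @ [?c]) = endpos z (take (Suc i) X)"
      using endpos_cong_snoc(1)[OF p(2)] tk by simp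
    have ne: "endpos z (take (Suc i) X) \<noteq> {}" using endpos_take[of "Suc i"] i by auto
    have nz: "?p \<noteq> 0" using dl_zero[OF p(1) c] e ne by auto
    have p': "?p \<in> {1..<cnt}" "endpos z (W ?p) = endpos z (take (Suc i) X)"
      using dl_nonzero[OF p(1) c nz] e by auto
    have pm: "?p \<in> marks X" unfolding marks_def using p' i by (auto intro!: exI[of _ "Suc i"] bexI[of _ ?p])
    have off: "off + i < length inp" using i inp(2) by simp
    let ?s1 = "atom_ex (Ld vT vQ k) (atom_ex (Mov vQ vP) (atom_ex (LdX vP vP vC)
      (atom_ex (Plus vJ vJ vOne) (atom_ex (Inp vC vJ) (tick s')))))"
    have mdl: "marked F k M i (4 + a) = F i (4 + a)" for i a using k by (simp add: marked_def)
    have r1: "rg s' vOne = 1" "rg s' vZero = 0" using rs(1) regs by simp_all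
    have s1: "rg ?s1 = (rg s')(vC := ?c, vJ := off + Suc i, vP := ?p, vQ := ?p, vT := marked F k M ?p k)"
      "st ?s1 = marked F k M" "acc ?s1 = acc s" "tm ?s1 = tm s' + 6"
      using rs r1 inp(1)[OF i] mdl by (simp_all add: fun_eq_iff)
    have ok: "wp ?body P (tick s')" if "P ?s1" for P
      unfolding wp_simps using rs r1 inp(1)[OF i] mdl off p p' cnt kR c that inp_lim length_inp by simp
    have "wp (mark_up k) (wp (Atom (Plus vI vI vOne))
      (\<lambda>s''. (\<exists>i M p. ?I i M p s'') \<and> length X - rg s'' vI < length X - rg s' vI)) ?s1"
    proof (rule wp_mark_up[OF sa F k cnt s1(2) M(1,2,4), where N = "marks X" and p = ?p])
      show "M \<subseteq> marks X" "?p \<in> marks X" "?p \<in> {1..<cnt}" by fact+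
      show "F j 3 \<in> marks X" if "j \<in> marks X" "j \<noteq> 1" for j using marks_lk that by blast
      show "rg ?s1 vZero = 0" "rg ?s1 vOne = 1" "rg ?s1 vQ = ?p" "rg ?s1 vT = marked F k M ?p k"
        unfolding s1 using r1 by simp_all
      fix s2 :: ast and M' q u
      assume s2: "rg s2 = (rg ?s1)(vQ := q, vT := u)" "st s2 = marked F k M'" "M' \<subseteq> {1..<cnt}"
        "M \<subseteq> M'" "?p \<in> M'" "M' \<subseteq> marks X" "\<And>j. j \<in> M' \<Longrightarrow> j \<noteq> 1 \<Longrightarrow> F j 3 \<in> M'" "acc s2 = acc ?s1"
        "tm s2 + 4 * card M = tm ?s1 + 4 * card M' + 1"
      let ?s3 = "atom_ex (Plus vI vI vOne) s2"
      have r2: "rg s2 = (rg s')(vC := ?c, vJ := off + Suc i, vP := ?p, vQ := q, vT := u)"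
        unfolding s2 s1 by (simp add: fun_eq_iff)
      have "?I (Suc i) M' ?p ?s3"
      proof (intro conjI)
        show "\<forall>i'\<le>Suc i. \<exists>p\<in>M'. endpos z (W p) = endpos z (take i' X)"
          using I s2(4,5) p' by (metis le_Suc_eq subsetD)
        show "\<forall>v. v \<notin> {vI, vJ, vC, vP, vQ, vT} \<longrightarrow> rg ?s3 v = rg s v" using r2 rs(1) by simp
        show "tm ?s3 \<le> tm s + 3 + 4 * card M' + 8 * Suc i"
        proof -
          have "tm s' \<le> tm s + 3 + 4 * card M + 8 * i" using I by blast
          then show ?thesis using s2(9) s1(4) by (simp del: atom_ex.simps) simp
        qed
        show "acc ?s3 = acc s" using s2(8) s1(3) by (simp del: atom_ex.simps) simp
      qed (use i s2(2-7) M(2) p' r2 rs r1 in auto)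
      then have "\<exists>i M p. ?I i M p ?s3" by (intro exI[of _ "Suc i"] exI[of _ M'] exI[of _ ?p])
      moreover have "length X - rg ?s3 vI < length X - rg s' vI" using r2 rs r1 i by simp
      moreover have "atom_ok (Plus vI vI vOne) s2" using r2 rs r1 off inp_lim length_inp by simp
      ultimately show "wp (Atom (Plus vI vI vOne))
        (\<lambda>s''. (\<exists>i M p. ?I i M p s'') \<and> length X - rg s'' vI < length X - rg s' vI) s2"
        unfolding wp_Atom by blast
    qed
    then show "wp (?body ;; mark_up k ;; Atom (Plus vI vI vOne))
      (\<lambda>s''. (\<exists>i M p. ?I i M p s'') \<and> length X - rg s'' vI < length X - rg s' vI) (tick s')"
      unfolding wp_Seq[of ?body] wp_Seq[of "mark_up k"] by (rule ok)
  next
    fix s' assume "\<exists>i M p. ?I i M p s'" and t: "test Less vI v s' \<noteq> True"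
    then obtain i M p where I: "?I i M p s'" by blast
    then have "rg s' v = rg s v" using v by blast
    then have i: "i = length X" using t regs I by simp
    have M: "M = marks X"
    proof (rule marks_eqI)
      show "M \<subseteq> {1..<cnt}" using I by blast
      show "j \<in> marks X" if "j \<in> M" for j using I that by blast
      show "F j 3 \<in> M" if "j \<in> M" "j \<noteq> 1" for j using I that by blast
      have "\<forall>i'\<le>i. \<exists>p\<in>M. endpos z (W p) = endpos z (take i' X)" using I by blast
      then show "\<exists>p\<in>M. endpos z (W p) = endpos z (take i' X)" if "i' \<le> length X" for i'
        using i that by blast
    qed
    have "card M \<le> card {1..<cnt}" using I by (intro card_mono) auto
    then have "card M \<le> cnt" by simp
    then show "Q (tick s')" using I i M by (intro Q) auto
  qed (fact that)
  let ?s1 = "atom_ex (SetC vI 0) (atom_ex (Sto vP k vOne) (atom_ex (Mov vP vOne) s))"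
  have e1: "endpos z (W 1) = endpos z []" using W_root by simp
  have st1: "st ?s1 = marked F k {1}" using st regs by (auto simp: marked_def upd_def fun_eq_iff)
  have "?I 0 {1} 1 ?s1"
    using st1 regs root root_marked e1 by (auto simp: take_0)
  then have "\<exists>i M p. ?I i M p ?s1" by (intro exI[of _ 0] exI[of _ "{1}"] exI[of _ 1])
  then have "wp (While True Less vI v (?body ;; mark_up k ;; Atom (Plus vI vI vOne))) Q ?s1"
    by (rule loop)
  then show ?thesis
    unfolding mark_def wp_Seq[of "_ ;; _"] wp_Seq[of "Atom _"] wp_Atom using regs root cnt kR lim_bounds by simp
qed

end

definition skip :: com where
  "skip = Atom (Mov vQ vQ)"

definition flag :: "nat \<Rightarrow> nat \<Rightarrow> com" where
  "flag k v = Atom (Mov v vZero) ;; Atom (Ld vQ vP k) ;; Branch Eq vQ vOne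
     (Atom (Ld vQ vU k) ;; Branch Eq vQ vOne
       (Atom (Ld vQ vV k) ;; Branch Eq vQ vZero (Atom (Mov v vOne)) skip) skip) skip"

definition sum_row :: com where
  "sum_row = While True Less vA vSg
     ((Atom (LdX vU vL vA) ;; Atom (LdX vV vP vA)) ;; flag 0 vT1 ;; flag 1 vT2 ;;
      Branch Eq vT1 vT2 skip (Atom (AccInv vT)) ;; Atom (Plus vA vA vOne))"

definition sum_up :: com where
  "sum_up = Atom (Mov vP vOne) ;; While True Less vP vCnt
     ((Atom (Ld vL vP 3) ;; Atom (Ld vT vL 2) ;; Atom (Plus vT vT vOne) ;; Atom (SetC vA 0)) ;;
      sum_row ;; Atom (Plus vP vP vOne))"

context lw_machine
begin

lemma wp_flag:
  assumes regs: "rg s vZero = 0" "rg s vOne = 1" "rg s vP < cap" "rg s vU < cap" "rg s vV < cap"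
    and k: "k < 2" and st: "\<And>i. st s i k = (if i \<in> M then 1 else 0)"
    and v: "v \<in> {vT1, vT2}"
    and Q: "\<And>s' q. rg s' = (rg s)(v := (if rg s vP \<in> M \<and> rg s vU \<in> M \<and> rg s vV \<notin> M then 1 else 0),
        vQ := q) \<Longrightarrow> st s' = st s \<Longrightarrow> acc s' = acc s \<Longrightarrow> tm s' \<le> tm s + 8 \<Longrightarrow> Q s'"
  shows "wp (flag k v) Q s"
proof -
  have kR: "k < R" using k R_eq by simp
  have vs: "v \<noteq> vP" "v \<noteq> vU" "v \<noteq> vV" "v \<noteq> vQ" "v \<noteq> vOne" "v \<noteq> vZero" using v by auto
  note simps = wp_simps flag_def skip_def regs kR st vs[symmetric] vs
  consider (a) "rg s vP \<notin> M" | (b) "rg s vP \<in> M" "rg s vU \<notin> M"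
    | (c) "rg s vP \<in> M" "rg s vU \<in> M" "rg s vV \<in> M" | (d) "rg s vP \<in> M" "rg s vU \<in> M" "rg s vV \<notin> M"
    by blast
  then show ?thesis
  proof cases
    case a
    then show ?thesis by (simp add: simps) (rule Q[where q = 0]; simp add: fun_eq_iff vs)
  next
    case b
    then show ?thesis by (simp add: simps) (rule Q[where q = 0]; simp add: fun_eq_iff vs)
  next
    case c
    then show ?thesis by (simp add: simps) (rule Q[where q = 1]; simp add: fun_eq_iff vs)
  next
    case d
    then show ?thesis by (simp add: simps) (rule Q[where q = 0]; simp add: fun_eq_iff vs)
  qed
qed

lemma wp_sum_row:
  assumes regs: "rg s vZero = 0" "rg s vOne = 1" "rg s vSg = sg" "rg s vP = P" "rg s vL = L" "rg s vA = 0"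
    and PL: "P < cap" "L < cap" "\<And>a. a < sg \<Longrightarrow> st s P (4 + a) < cap" "\<And>a. a < sg \<Longrightarrow> st s L (4 + a) < cap"
    and st: "\<And>i. st s i 0 = (if i \<in> M then 1 else 0)" "\<And>i. st s i 1 = (if i \<in> N then 1 else 0)"
    and Q: "\<And>s'. (\<And>v. v \<notin> {vU, vV, vT1, vT2, vQ, vA} \<Longrightarrow> rg s' v = rg s v) \<Longrightarrow> st s' = st s \<Longrightarrow>
      acc s' = acc s + (\<Sum>b<sg.
        if (P \<in> M \<and> st s L (4 + b) \<in> M \<and> st s P (4 + b) \<notin> M) \<noteq>
           (P \<in> N \<and> st s L (4 + b) \<in> N \<and> st s P (4 + b) \<notin> N)
        then 1 / (of_nat (rg s vT))\<^sup>2 else 0) \<Longrightarrow>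
      tm s' \<le> tm s + 22 * sg + 1 \<Longrightarrow> Q s'"
  shows "wp sum_row Q s"
proof -
  let ?X = "\<lambda>M b. P \<in> M \<and> st s L (4 + b) \<in> M \<and> st s P (4 + b) \<notin> M"
  let ?g = "\<lambda>b. if ?X M b \<noteq> ?X N b then 1 / (of_nat (rg s vT))\<^sup>2 else (0 :: rat)"
  let ?I = "\<lambda>a s'. a \<le> sg \<and> (\<forall>v. v \<notin> {vU, vV, vT1, vT2, vQ, vA} \<longrightarrow> rg s' v = rg s v) \<and> rg s' vA = a \<and>
    st s' = st s \<and> acc s' = acc s + (\<Sum>b<a. ?g b) \<and> tm s' \<le> tm s + 22 * a"
  show ?thesis unfolding sum_row_def
  proof (rule wp_While[where I = "\<lambda>s'. \<exists>a. ?I a s'" and \<mu> = "\<lambda>s'. sg - rg s' vA"])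
    show "\<exists>a. ?I a s" using regs by (intro exI[of _ 0]) simp
  next
    fix s' assume "\<exists>a. ?I a s'" and t: "test Less vA vSg s' = True"
    then obtain a where I: "?I a s'" by blast
    then have rs: "\<And>v. v \<notin> {vU, vV, vT1, vT2, vQ, vA} \<Longrightarrow> rg s' v = rg s v" "rg s' vA = a" "st s' = st s"
      by blast+
    have a: "a < sg" using t rs regs by simp
    let ?Q = "\<lambda>s''. (\<exists>a. ?I a s'') \<and> sg - rg s'' vA < sg - rg s' vA"
    let ?if = "Branch Eq vT1 vT2 skip (Atom (AccInv vT))"
    let ?s1 = "atom_ex (LdX vV vP vA) (atom_ex (LdX vU vL vA) (tick s'))"
    have r: "rg s' vL = L" "rg s' vP = P" "rg s' vZero = 0" "rg s' vOne = 1" using rs(1) regs by simp_all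
    have s1: "rg ?s1 = (rg s')(vU := st s L (4 + a), vV := st s P (4 + a))" "st ?s1 = st s"
      "acc ?s1 = acc s'" "tm ?s1 = tm s' + 3"
      using rs r by (simp_all add: fun_eq_iff)
    have "wp (flag 0 vT1) (wp (flag 1 vT2) (wp ?if (wp (Atom (Plus vA vA vOne)) ?Q))) ?s1"
    proof (rule wp_flag[where M = M])
      show "rg ?s1 vZero = 0" "rg ?s1 vOne = 1" "rg ?s1 vP < cap" "rg ?s1 vU < cap" "rg ?s1 vV < cap"
        unfolding s1 using r PL a by simp_all
      show "st ?s1 i 0 = (if i \<in> M then 1 else 0)" for i unfolding s1 by (rule st)
      fix s2 :: ast and q
      assume "rg s2 = (rg ?s1)(vT1 := (if rg ?s1 vP \<in> M \<and> rg ?s1 vU \<in> M \<and> rg ?s1 vV \<notin> M then 1 else 0),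
        vQ := q)" "st s2 = st ?s1" "acc s2 = acc ?s1" "tm s2 \<le> tm ?s1 + 8"
      then have s2: "rg s2 = (rg s')(vU := st s L (4 + a), vV := st s P (4 + a),
          vT1 := (if ?X M a then 1 else 0), vQ := q)"
        "st s2 = st s" "acc s2 = acc s'" "tm s2 \<le> tm s' + 11"
        unfolding s1 using r by (simp_all add: fun_eq_iff)
      show "wp (flag 1 vT2) (wp ?if (wp (Atom (Plus vA vA vOne)) ?Q)) s2"
      proof (rule wp_flag[where M = N])
        show "rg s2 vZero = 0" "rg s2 vOne = 1" "rg s2 vP < cap" "rg s2 vU < cap" "rg s2 vV < cap"
          unfolding s2 using r PL a by simp_all
        show "st s2 i 1 = (if i \<in> N then 1 else 0)" for i unfolding s2 by (rule st)
        fix s3 :: ast and q'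
        assume "rg s3 = (rg s2)(vT2 := (if rg s2 vP \<in> N \<and> rg s2 vU \<in> N \<and> rg s2 vV \<notin> N then 1 else 0),
          vQ := q')" "st s3 = st s2" "acc s3 = acc s2" "tm s3 \<le> tm s2 + 8"
        then have s3: "rg s3 = (rg s')(vU := st s L (4 + a), vV := st s P (4 + a),
            vT1 := (if ?X M a then 1 else 0), vT2 := (if ?X N a then 1 else 0), vQ := q')"
          "st s3 = st s" "acc s3 = acc s'" "tm s3 \<le> tm s' + 19"
          unfolding s2 using r s2(4) by (simp_all add: fun_eq_iff)
        have fin: "wp (Atom (Plus vA vA vOne)) ?Q s4"
          if s4: "rg s4 = rg s3" "st s4 = st s" "acc s4 = acc s' + ?g a" "tm s4 \<le> tm s3 + 2" for s4
        proof -
          let ?s5 = "atom_ex (Plus vA vA vOne) s4"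
          have "tm s' \<le> tm s + 22 * a" "acc s' = acc s + (\<Sum>b<a. ?g b)" using I by blast+
          then have "?I (Suc a) ?s5"
            using s4 s3 rs r a by (simp add: add.assoc)
          then have "\<exists>a. ?I a ?s5" by (rule exI[of _ "Suc a"])
          moreover have "sg - rg ?s5 vA < sg - rg s' vA" using s4 s3 rs r a by simp
          moreover have "atom_ok (Plus vA vA vOne) s4" using s4 s3 rs r a lim_bounds by simp
          ultimately show ?thesis unfolding wp_Atom by blast
        qed
        show "wp ?if (wp (Atom (Plus vA vA vOne)) ?Q) s3"
        proof (cases "?X M a = ?X N a")
          case True
          have "wp (Atom (Plus vA vA vOne)) ?Q (atom_ex (Mov vQ vQ) (tick s3))"
            by (rule fin) (use s3 True in simp_all)
          then show ?thesis
            unfolding wp_Branch skip_def wp_Atom[of "Mov vQ vQ"] using True by (simp add: s3(1))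
        next
          case False
          have "wp (Atom (Plus vA vA vOne)) ?Q (atom_ex (AccInv vT) (tick s3))"
            by (rule fin) (use s3 rs False in simp_all)
          then show ?thesis
            unfolding wp_Branch wp_Atom[of "AccInv vT"] using False by (auto simp: s3(1))
        qed
      qed simp_all
    qed simp_all
    then show "wp ((Atom (LdX vU vL vA) ;; Atom (LdX vV vP vA)) ;; flag 0 vT1 ;; flag 1 vT2 ;; ?if ;;
      Atom (Plus vA vA vOne)) ?Q (tick s')"
      unfolding wp_Seq[of "_ ;; _"] wp_Seq[of "flag _ _"] wp_Seq[of ?if] wp_Seq[of "Atom _"] wp_Atom[of "LdX _ _ _"]
      using rs r PL a by simp
  next
    fix s' assume "\<exists>a. ?I a s'" and t: "test Less vA vSg s' \<noteq> True"
    then obtain a where I: "?I a s'" by blast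
    then have "rg s' vSg = sg" using regs by simp
    then have "a = sg" using t I by simp
    then show "Q (tick s')" using I by (intro Q) auto
  qed
qed

lemma wp_sum_up:
  assumes sa: "automaton (st s) z cnt W" and cnt: "cnt < cap"
    and regs: "consts_ok s" "rg s vCnt = cnt"
    and st: "\<And>i. st s i 0 = (if i \<in> M then 1 else 0)" "\<And>i. st s i 1 = (if i \<in> N then 1 else 0)"
    and acc: "acc s = 0"
    and len: "\<And>i. i < cnt \<Longrightarrow> st s i 2 \<le> cap"
    and Q: "\<And>s'. acc s' = (\<Sum>P\<in>{1..<cnt}. \<Sum>b<sg.
        if (P \<in> M \<and> st s (st s P 3) (4 + b) \<in> M \<and> st s P (4 + b) \<notin> M) \<noteq>
           (P \<in> N \<and> st s (st s P 3) (4 + b) \<in> N \<and> st s P (4 + b) \<notin> N)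
        then 1 / (of_nat (Suc (st s (st s P 3) 2)))\<^sup>2 else 0) \<Longrightarrow>
      tm s' \<le> tm s + 2 + (22 * sg + 7) * cnt \<Longrightarrow> Q s'"
  shows "wp sum_up Q s"
proof -
  interpret suffix_automaton z sg cnt W "\<lambda>i. st s i 2" "\<lambda>i. st s i 3" "\<lambda>i a. st s i (4 + a)"
    by (fact sa)
  let ?F = "st s"
  let ?h = "\<lambda>P. \<Sum>b<sg.
        if (P \<in> M \<and> ?F (?F P 3) (4 + b) \<in> M \<and> ?F P (4 + b) \<notin> M) \<noteq>
           (P \<in> N \<and> ?F (?F P 3) (4 + b) \<in> N \<and> ?F P (4 + b) \<notin> N)
        then 1 / (of_nat (Suc (?F (?F P 3) 2)))\<^sup>2 else (0 :: rat)"
  have dl_less: "?F i (4 + a) < cap" if "i < cnt" "a < sg" for i a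
  proof (cases "i = 0 \<or> ?F i (4 + a) = 0")
    case True
    then show ?thesis using dl_bot[of a] that cap_eq by auto
  next
    case False
    then have "?F i (4 + a) < cnt" using dl_nonzero[of i a] that by auto
    then show ?thesis using cnt by simp
  qed
  let ?C = "{vP, vL, vT, vU, vV, vT1, vT2, vQ, vA}"
  let ?I = "\<lambda>P s'. P \<in> {1..cnt} \<and> (\<forall>v. v \<notin> ?C \<longrightarrow> rg s' v = rg s v) \<and> rg s' vP = P \<and> st s' = ?F \<and>
    acc s' = (\<Sum>P'\<in>{1..<P}. ?h P') \<and> tm s' \<le> tm s + 1 + (22 * sg + 7) * (P - 1)"
  let ?pre = "Atom (Ld vL vP 3) ;; Atom (Ld vT vL 2) ;; Atom (Plus vT vT vOne) ;; Atom (SetC vA 0)"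
  have "wp (While True Less vP vCnt (?pre ;; sum_row ;; Atom (Plus vP vP vOne))) Q s0"
    if "\<exists>P. ?I P s0" for s0
  proof (rule wp_While[where I = "\<lambda>s'. \<exists>P. ?I P s'" and \<mu> = "\<lambda>s'. cnt - rg s' vP"])
    fix s' assume "\<exists>P. ?I P s'" and t: "test Less vP vCnt s' = True"
    then obtain P where I: "?I P s'" by blast
    then have rs: "\<And>v. v \<notin> ?C \<Longrightarrow> rg s' v = rg s v" "rg s' vP = P" "st s' = ?F"
      and P1: "1 \<le> P" by auto
    have P: "P < cnt" using t rs regs by simp
    let ?L = "?F P 3"
    have L: "?L < cnt" using lk_less P by blast
    have r: "rg s' vZero = 0" "rg s' vOne = 1" "rg s' vSg = sg"
      using rs(1) regs by (simp_all add: consts_ok_def)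
    have lim: "?F ?L 2 + 1 < lim" "cnt < lim" using len[OF L] lim_bounds cap_eq cnt by linarith+
    let ?Q = "\<lambda>s''. (\<exists>P. ?I P s'') \<and> cnt - rg s'' vP < cnt - rg s' vP"
    let ?s1 = "atom_ex (SetC vA 0) (atom_ex (Plus vT vT vOne) (atom_ex (Ld vT vL 2)
      (atom_ex (Ld vL vP 3) (tick s'))))"
    have s1: "rg ?s1 = (rg s')(vL := ?L, vT := Suc (?F ?L 2), vA := 0)" "st ?s1 = ?F" "acc ?s1 = acc s'"
      "tm ?s1 = tm s' + 5"
      using rs r by (simp_all add: fun_eq_iff)
    have ok: "wp ?pre R (tick s')" if "R ?s1" for R
      unfolding wp_simps using that rs r P L cnt lim by simp
    have "wp sum_row (wp (Atom (Plus vP vP vOne)) ?Q) ?s1"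
    proof (rule wp_sum_row[where P = P and L = ?L and M = M and N = N])
      show "rg ?s1 vZero = 0" "rg ?s1 vOne = 1" "rg ?s1 vSg = sg" "rg ?s1 vP = P" "rg ?s1 vL = ?L"
        "rg ?s1 vA = 0" unfolding s1 using r rs by simp_all
      show "P < cap" "?L < cap" using P L cnt by simp_all
      show "st ?s1 P (4 + a) < cap" "st ?s1 ?L (4 + a) < cap" if "a < sg" for a
        unfolding s1 using dl_less that P L by blast+
      show "st ?s1 i 0 = (if i \<in> M then 1 else 0)" "st ?s1 i 1 = (if i \<in> N then 1 else 0)" for i
        unfolding s1 by (rule st)+
      fix s2 :: ast
      assume s2: "\<And>v. v \<notin> {vU, vV, vT1, vT2, vQ, vA} \<Longrightarrow> rg s2 v = rg ?s1 v" "st s2 = st ?s1"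
        "acc s2 = acc ?s1 + (\<Sum>b<sg.
        if (P \<in> M \<and> st ?s1 ?L (4 + b) \<in> M \<and> st ?s1 P (4 + b) \<notin> M) \<noteq>
           (P \<in> N \<and> st ?s1 ?L (4 + b) \<in> N \<and> st ?s1 P (4 + b) \<notin> N)
        then 1 / (of_nat (rg ?s1 vT))\<^sup>2 else 0)" "tm s2 \<le> tm ?s1 + 22 * sg + 1"
      have T: "rg ?s1 vT = Suc (?F ?L 2)" unfolding s1 by simp
      have acc2: "acc s2 = acc s' + ?h P" using s2(3) unfolding T s1(2,3) .
      have r2: "rg s2 vP = P" "rg s2 vOne = 1" "rg s2 v = rg s v" if "v \<notin> ?C" for v
        using s2(1)[of vP] s2(1)[of vOne] s2(1)[of v] that rs r unfolding s1 by simp_all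
      have r2': "rg s2 vP = P" "rg s2 vOne = 1" using r2[of vOne] by auto
      let ?s3 = "atom_ex (Plus vP vP vOne) s2"
      have "tm ?s3 \<le> tm s + 1 + (22 * sg + 7) * (Suc P - 1)"
      proof -
        have "tm s' \<le> tm s + 1 + (22 * sg + 7) * (P - 1)" using I by blast
        moreover have "(22 * sg + 7) * P = (22 * sg + 7) * (P - 1) + (22 * sg + 7)"
          using P1 by (metis Suc_diff_1 mult_Suc_right add.commute less_le_trans zero_less_one)
        ultimately show ?thesis using s2(4) s1(4) by (simp del: atom_ex.simps) simp
      qed
      moreover have "acc ?s3 = (\<Sum>P'\<in>{1..<Suc P}. ?h P')"
      proof -
        have "acc s' = (\<Sum>P'\<in>{1..<P}. ?h P')" using I by blast
        then show ?thesis using acc2 P1 by simp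
      qed
      moreover have "\<forall>v. v \<notin> ?C \<longrightarrow> rg ?s3 v = rg s v" using r2(3) by simp
      moreover have "st ?s3 = ?F" using s2(2) s1(2) by (simp del: atom_ex.simps) simp
      moreover have "rg ?s3 vP = Suc P" "Suc P \<in> {1..cnt}" using r2' P by simp_all
      ultimately have "\<exists>P. ?I P ?s3" by (intro exI[of _ "Suc P"] conjI)
      moreover have "cnt - rg ?s3 vP < cnt - rg s' vP" using r2' rs P by simp
      moreover have "atom_ok (Plus vP vP vOne) s2" using r2' P lim by simp
      ultimately show "wp (Atom (Plus vP vP vOne)) ?Q s2" unfolding wp_Atom by blast
    qed
    then show "wp (?pre ;; sum_row ;; Atom (Plus vP vP vOne)) ?Q (tick s')"
      unfolding wp_Seq[of ?pre] wp_Seq[of sum_row] by (rule ok)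
  next
    fix s' assume "\<exists>P. ?I P s'" and t: "test Less vP vCnt s' \<noteq> True"
    then obtain P where I: "?I P s'" by blast
    then have "rg s' vCnt = cnt" using regs by simp
    then have P: "P = cnt" using t I by simp
    show "Q (tick s')"
    proof (rule Q)
      show "acc (tick s') = (\<Sum>P\<in>{1..<cnt}. ?h P)" using I P by simp
      have "(22 * sg + 7) * (P - 1) \<le> (22 * sg + 7) * cnt" using P by (intro mult_le_mono2) simp
      moreover have "tm s' \<le> tm s + 1 + (22 * sg + 7) * (P - 1)" using I by blast
      ultimately show "tm (tick s') \<le> tm s + 2 + (22 * sg + 7) * cnt" unfolding tick_sel by linarith
    qed
  qed (fact that)
  moreover have "?I 1 (atom_ex (Mov vP vOne) s)"
    using regs acc cnt_ge by (auto simp: consts_ok_def)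
  then have "\<exists>P. ?I P (atom_ex (Mov vP vOne) s)" by (rule exI[of _ 1])
  ultimately show ?thesis unfolding sum_up_def wp_Seq[of "Atom _"] wp_Atom by simp
qed

end

definition prog :: "nat \<Rightarrow> com" where
  "prog sg = init sg ;; build ;; Atom (SetC vJ 0) ;; mark 0 vM ;; mark 1 vN ;; sum_up"

context lw_machine
begin

lemma wp_prog:
  assumes s: "rg s = (\<lambda>_. 0)(vM := length x, vN := length y)" "st s = (\<lambda>_ _. 0)" "acc s = 0" "tm s = 0"
  shows "wp (prog sg) (\<lambda>s'. acc s' = LW (minimal_absent_words {..<sg} x) (minimal_absent_words {..<sg} y) \<and>
    tm s' \<le> (120 * sg + 200) * Suc (length inp)) s"
    (is "wp _ ?Q s")
proof -
  have "wp (init sg) (wp build (wp (Atom (SetC vJ 0)) (wp (mark 0 vM) (wp (mark 1 vN) (wp sum_up ?Q))))) s"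
  proof (rule wp_init[OF s])
    fix s1 :: ast
    assume s1: "consts_ok s1" "rg s1 vI = 0" "rg s1 vJ = 0" "rg s1 vLast = 1" "rg s1 vCnt = 2"
      "automaton (st s1) [] 2 (\<lambda>_. [])" "\<And>i k. k < 2 \<Longrightarrow> st s1 i k = 0" "pot (st s1) 1 = 0" "acc s1 = 0"
      "tm s1 = 3 * sg + 13"
    show "wp build (wp (Atom (SetC vJ 0)) (wp (mark 0 vM) (wp (mark 1 vN) (wp sum_up ?Q)))) s1"
    proof (rule wp_build[OF s1(1-9)])
      fix s2 :: ast and cnt W
      assume s2: "consts_ok s2" "automaton (st s2) joined cnt W" "cnt < cap" "rg s2 vCnt = cnt"
        "\<And>i k. k < 2 \<Longrightarrow> st s2 i k = 0" "acc s2 = 0"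
        "tm s2 \<le> tm s1 + 1 + (4 * sg + 55) * Suc (length inp)"
      let ?F = "st s2"
      let ?s3 = "atom_ex (SetC vJ 0) s2"
      let ?M = "suffix_automaton.marks joined cnt W x" and ?N = "suffix_automaton.marks joined cnt W y"
      let ?F4 = "marked ?F 0 ?M"
      let ?F5 = "marked ?F4 1 ?N"
      have F4: "(\<lambda>i. ?F4 i 2) = (\<lambda>i. ?F i 2)" "(\<lambda>i. ?F4 i 3) = (\<lambda>i. ?F i 3)"
        "(\<lambda>i a. ?F4 i (4 + a)) = (\<lambda>i a. ?F i (4 + a))" by (auto simp: marked_def)
      have F5: "(\<lambda>i. ?F5 i 2) = (\<lambda>i. ?F i 2)" "(\<lambda>i. ?F5 i 3) = (\<lambda>i. ?F i 3)"
        "(\<lambda>i a. ?F5 i (4 + a)) = (\<lambda>i a. ?F i (4 + a))" by (auto simp: marked_def)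
      interpret suffix_automaton joined sg cnt W "\<lambda>i. ?F i 2" "\<lambda>i. ?F i 3" "\<lambda>i a. ?F i (4 + a)"
        by (rule s2(2))
      have occx: "suffix_automaton_occurrence joined sg cnt W (\<lambda>i. ?F i 2) (\<lambda>i. ?F i 3)
        (\<lambda>i a. ?F i (4 + a)) [] x ([sg] @ y)"
        by unfold_locales (use x_lists in \<open>auto simp: joined_def\<close>)
      have occy: "suffix_automaton_occurrence joined sg cnt W (\<lambda>i. ?F i 2) (\<lambda>i. ?F i 3)
        (\<lambda>i a. ?F i (4 + a)) (x @ [sg]) y []"
        by unfold_locales (use y_lists in \<open>auto simp: joined_def\<close>)
      have "wp (mark 0 vM) (wp (mark 1 vN) (wp sum_up ?Q)) ?s3"
      proof (rule wp_mark[OF occx, where k = 0 and off = 0])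
        show "?F i 0 = 0" for i using s2(5) by simp
        show "cnt < cap" by fact
        show "st ?s3 = ?F" "rg ?s3 vJ = 0" by simp_all
        show "rg ?s3 vZero = 0" "rg ?s3 vOne = 1" "rg ?s3 vM = length x"
          using s2(1) by (simp_all add: consts_ok_def)
        show "inp ! (0 + i) = x ! i" if "i < length x" for i using that by (simp add: inp_eq nth_append)
        show "0 + length x \<le> length inp" by (simp add: inp_eq)
        fix s4 :: ast
        assume s4: "\<And>v. v \<notin> {vI, vJ, vC, vP, vQ, vT} \<Longrightarrow> rg s4 v = rg ?s3 v" "rg s4 vJ = 0 + length x"
          "st s4 = ?F4" "acc s4 = acc ?s3" "tm s4 \<le> tm ?s3 + 4 + 4 * cnt + 8 * length x"
        have r4: "consts_ok s4" "rg s4 vCnt = cnt"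
          using s4(1) s2(1,4) by (simp_all add: consts_ok_def)
        have occ4: "suffix_automaton_occurrence joined sg cnt W (\<lambda>i. ?F4 i 2) (\<lambda>i. ?F4 i 3)
          (\<lambda>i a. ?F4 i (4 + a)) (x @ [sg]) y []" unfolding F4 by (rule occy)
        show "wp (mark 1 vN) (wp sum_up ?Q) s4"
        proof (rule wp_mark[OF occ4, where k = 1 and off = "length x"])
          show "?F4 i 1 = 0" for i using s2(5) by (simp add: marked_def)
          show "cnt < cap" by fact
          show "st s4 = ?F4" by fact
          show "rg s4 vZero = 0" "rg s4 vOne = 1" "rg s4 vN = length y"
            using r4 by (simp_all add: consts_ok_def)
          show "rg s4 vJ = length x" using s4(2) by simp
          show "inp ! (length x + i) = y ! i" if "i < length y" for i by (simp add: inp_eq nth_append)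
          show "length x + length y \<le> length inp" by (simp add: inp_eq)
          fix s5 :: ast
          assume s5: "\<And>v. v \<notin> {vI, vJ, vC, vP, vQ, vT} \<Longrightarrow> rg s5 v = rg s4 v"
            "st s5 = ?F5" "acc s5 = acc s4" "tm s5 \<le> tm s4 + 4 + 4 * cnt + 8 * length y"
          show "wp sum_up ?Q s5"
          proof (rule wp_sum_up[where M = ?M and N = ?N and W = W and z = joined and cnt = cnt])
            show "automaton (st s5) joined cnt W" unfolding s5 F5 by (rule s2(2))
            show "cnt < cap" by fact
            show "consts_ok s5" "rg s5 vCnt = cnt" using s5(1) r4 by (simp_all add: consts_ok_def)
            show "st s5 i 0 = (if i \<in> ?M then 1 else 0)" "st s5 i 1 = (if i \<in> ?N then 1 else 0)" for i
              unfolding s5 using s2(5) by (simp_all add: marked_def)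
            show "acc s5 = 0" using s5(3) s4(4) s2(6) by simp
            show "st s5 i 2 \<le> cap" if "i < cnt" for i
            proof (cases "i = 0")
              case True
              then show ?thesis using fun_cong[OF F5(1), of 0] len_bot unfolding s5 by simp
            next
              case False
              then have i: "i \<in> {1..<cnt}" using that by auto
              then have "length (W i) \<le> length joined"
                using W_factor endpos_nonempty_iff sublist_length_le by blast
              then show ?thesis
                using len_eq[OF i] fun_cong[OF F5(1), of i] cap_eq unfolding s5 by (simp add: length_joined)
            qed
            fix s6 :: ast
            assume acc6: "acc s6 = (\<Sum>P\<in>{1..<cnt}. \<Sum>b<sg.
              if (P \<in> ?M \<and> st s5 (st s5 P 3) (4 + b) \<in> ?M \<and> st s5 P (4 + b) \<notin> ?M) \<noteq>
                 (P \<in> ?N \<and> st s5 (st s5 P 3) (4 + b) \<in> ?N \<and> st s5 P (4 + b) \<notin> ?N)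
              then 1 / (of_nat (Suc (st s5 (st s5 P 3) 2)))\<^sup>2 else 0)"
              and tm6: "tm s6 \<le> tm s5 + 2 + (22 * sg + 7) * cnt"
            have eqs: "st s5 i 2 = ?F i 2" "st s5 i 3 = ?F i 3" "st s5 i (4 + a) = ?F i (4 + a)" for i a
              unfolding s5 by (simp_all add: marked_def)
            have "acc s6 = LW (minimal_absent_words {..<sg} x) (minimal_absent_words {..<sg} y)"
              using acc6 unfolding LW_eq_sum[OF occx occy] eqs .
            moreover have "tm s6 \<le> (120 * sg + 200) * Suc (length inp)"
            proof -
              have cnt: "cnt \<le> 5 * Suc (length inp)" using s2(3) cap_eq by simp
              then have "(22 * sg + 7) * cnt \<le> (22 * sg + 7) * (5 * Suc (length inp))"
                by (rule mult_le_mono2)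
              moreover have "tm s6 \<le> 3 * sg + 13 + 1 + (4 * sg + 55) * Suc (length inp) + 1 + 8 + 8 * cnt
                + 8 * length inp + 2 + (22 * sg + 7) * cnt"
                using tm6 s5(4) s4(5) s2(7) s1(10) length_inp by simp
              ultimately have "tm s6 \<le> 3 * sg + 25 + (4 * sg + 55) * Suc (length inp) + 8 * (5 * Suc (length inp))
                + 8 * length inp + (22 * sg + 7) * (5 * Suc (length inp))"
                using cnt by linarith
              also have "\<dots> \<le> (120 * sg + 200) * Suc (length inp)" by (simp add: algebra_simps)
              finally show ?thesis .
            qed
            ultimately show "?Q s6" by blast
          qed
        qed simp_all
      qed simp_all
      then show "wp (Atom (SetC vJ 0)) (wp (mark 0 vM) (wp (mark 1 vN) (wp sum_up ?Q))) s2"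
        unfolding wp_Atom using lim_bounds by simp
    qed
  qed
  then show ?thesis unfolding prog_def wp_Seq .
qed

end

definition program :: "nat \<Rightarrow> instr list" where
  "program sg = [Move 6 0, Move 7 1, Arith Add 3 0 1, Const 2 (sg + 5)] @ code (prog sg) 4"

lemma computes_within_program:
  fixes x y :: "'a list" and enc :: "'a \<Rightarrow> nat"
  assumes lists: "map enc x \<in> lists {..<sg}" "map enc y \<in> lists {..<sg}"
    and b: "(5 * sg + 26) * (length x + length y + 1) \<le> 2 ^ b"
  shows "computes_within b (program sg) (init_state enc x y)
    (LW (minimal_absent_words {..<sg} (map enc x)) (minimal_absent_words {..<sg} (map enc y)))
    (4 + 6 * ((120 * sg + 200) * Suc (length x + length y)))
    (length x + length y + (2 * (length x + length y) + 5) * (sg + 5))"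
proof -
  let ?inp = "map enc x @ map enc y"
  let ?N = "length x + length y"
  let ?cap = "2 * ?N + 5"
  let ?lim = "?N + ?cap * (sg + 5)"
  have lim: "?lim \<le> 2 ^ b"
  proof -
    have "?lim \<le> (5 * sg + 26) * (?N + 1)" by (simp add: algebra_simps)
    then show ?thesis using b by (rule order_trans)
  qed
  interpret lw_machine b ?inp "sg + 5" ?cap ?lim "map enc x" "map enc y" sg
    by unfold_locales (use lim lists in auto)
  let ?a = "\<lparr>rg = (\<lambda>_. 0)(vM := length x, vN := length y), st = \<lambda>_ _. 0, acc = 0, tm = 0\<rparr> :: ast"
  let ?L = "LW (minimal_absent_words {..<sg} (map enc x)) (minimal_absent_words {..<sg} (map enc y))"
  have "wp (prog sg) (\<lambda>s'. acc s' = ?L \<and> tm s' \<le> (120 * sg + 200) * Suc (length ?inp)) ?a"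
    by (rule wp_prog) simp_all
  then obtain a' where a': "big (prog sg) ?a a'" "acc a' = ?L" "tm a' \<le> (120 * sg + 200) * Suc ?N"
    unfolding wp_def by auto
  let ?P = "program sg"
  let ?pre = "[Move 6 0, Move 7 1, Arith Add 3 0 1, Const 2 (sg + 5)]"
  let ?start = "init_state enc x y"
  let ?m = "fold (exec_instr b) ?pre ?start"
  have pc0: "pc ?start = 0" by (simp add: init_state_def)
  have "code_at ?P (pc ?start) ?pre"
    unfolding code_at_def program_def pc0
    by (rule exI[of _ "[]"], rule exI[of _ "code (prog sg) 4"]) simp
  then have "runs b ?P space ?start (length ?pre) ?m \<and> pc ?m = pc ?start + length ?pre"
    by (intro runs_straight) simp_all
  moreover have "length ?pre = 4" by simp
  ultimately have pre: "runs b ?P space ?start 4 ?m \<and> pc ?m = 4" unfolding pc0 by (metis add_0)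
  have small: "?N < 2 ^ b" "sg + 5 < 2 ^ b" using lim by (simp_all add: algebra_simps)
  have sim: "sim ?a ?m"
    unfolding sim_def using small by (simp add: init_state_def set_reg_def nth_append)
  have "code_at ?P (pc ?m) (code (prog sg) (pc ?m))"
    unfolding code_at_def program_def
    by (rule exI[of _ ?pre], rule exI[of _ "[]"]) (use pre in simp)
  then obtain n m' where m': "runs b ?P space ?m n m'" "sim a' m'" "pc m' = pc ?m + size_code (prog sg)"
    "n + 6 * tm ?a \<le> 6 * tm a'"
    using runs_big[OF a'(1) sim] by blast
  have r: "runs b ?P space ?start (4 + n) m'" using runs_trans pre m'(1) by blast
  have "halted ?P m'" using m'(3) pre by (simp add: halted_def program_def)
  moreover have "rreg m' 0 = ?L" using m'(2) a'(2) unfolding sim_def by simp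
  moreover have "4 + n \<le> 4 + 6 * ((120 * sg + 200) * Suc ?N)" using m'(4) a'(3) by simp
  ultimately show ?thesis
    using r unfolding computes_within_def runs_def space_def
    by (intro exI[of _ "4 + n"]) auto
qed

lemma linear_bigo:
  fixes f :: "nat \<Rightarrow> nat"
  assumes "\<And>N. f N \<le> C * Suc N"
  shows "(\<lambda>N. real (f N)) \<in> O(\<lambda>N. real N)"
proof (rule bigoI[where c = "2 * real C"])
  show "\<forall>\<^sub>F N in at_top. norm (real (f N)) \<le> 2 * real C * norm (real N)"
    using eventually_ge_at_top[of "1 :: nat"]
  proof eventually_elim
    case (elim N)
    have "C * Suc N \<le> C * (2 * N)" using elim by (intro mult_le_mono2) simp
    then have "f N \<le> C * (2 * N)" using assms[of N] by (rule order_trans[rotated])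
    then have "real (f N) \<le> real (C * (2 * N))" by (rule of_nat_mono)
    then show ?case by simp
  qed
qed

theorem theorem1:
  fixes \<Sigma> :: "'a set" and enc :: "'a \<Rightarrow> nat"
  assumes "finite \<Sigma>"
    and "bij_betw enc \<Sigma> {..<card \<Sigma>}"
  shows "\<exists>(P :: instr list) (c :: nat) (time :: nat \<Rightarrow> nat) (space :: nat \<Rightarrow> nat).
    (\<lambda>N. real (time N)) \<in> O(\<lambda>N. real N) \<and>
    (\<lambda>N. real (space N)) \<in> O(\<lambda>N. real N) \<and>
    (\<forall>x \<in> lists \<Sigma>. \<forall>y \<in> lists \<Sigma>. \<forall>b :: nat.
       c * (length x + length y + 1) \<le> 2 ^ b \<longrightarrow>
       computes_within b P (init_state enc x y)
         (LW (minimal_absent_words \<Sigma> x) (minimal_absent_words \<Sigma> y))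
         (time (length x + length y)) (space (length x + length y)))"
proof -
  let ?sg = "card \<Sigma>"
  let ?time = "\<lambda>N. 4 + 6 * ((120 * ?sg + 200) * Suc N)"
  let ?space = "\<lambda>N. N + (2 * N + 5) * (?sg + 5)"
  have time: "(\<lambda>N. real (?time N)) \<in> O(\<lambda>N. real N)"
    by (rule linear_bigo[where C = "720 * ?sg + 1204"]) (simp add: algebra_simps)
  have space: "(\<lambda>N. real (?space N)) \<in> O(\<lambda>N. real N)"
    by (rule linear_bigo[where C = "5 * ?sg + 26"]) (simp add: algebra_simps)
  have comp: "computes_within b (program ?sg) (init_state enc x y)
      (LW (minimal_absent_words \<Sigma> x) (minimal_absent_words \<Sigma> y))
      (?time (length x + length y)) (?space (length x + length y))"
    if x: "x \<in> lists \<Sigma>" and y: "y \<in> lists \<Sigma>" and b: "(5 * ?sg + 26) * (length x + length y + 1) \<le> 2 ^ b"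
    for x y b
  proof -
    have inj: "inj_on enc \<Sigma>" using assms(2) by (simp add: bij_betw_def)
    have "map enc x \<in> lists {..<?sg}" "map enc y \<in> lists {..<?sg}"
      using x y bij_betwE[OF assms(2)] by auto
    moreover have "LW (minimal_absent_words {..<?sg} (map enc x)) (minimal_absent_words {..<?sg} (map enc y)) =
        LW (minimal_absent_words \<Sigma> x) (minimal_absent_words \<Sigma> y)"
      unfolding minimal_absent_words_map[OF assms(2) x] minimal_absent_words_map[OF assms(2) y]
      by (rule LW_image_map[OF inj]) (auto simp: minimal_absent_words_iff)
    ultimately show ?thesis using computes_within_program[of enc x ?sg y b] b by simp
  qed
  show ?thesis
    by (rule exI[of _ "program ?sg"], rule exI[of _ "5 * ?sg + 26"], rule exI[of _ ?time],
        rule exI[of _ ?space]) (use time space comp in blast)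
qed

end
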